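(* Let $\Delta$ be a pure shifted complex of dimension $d$ on vertex set $\{1,\dots,n\}$. Let $\sigma=\{\ell_1<\cdots<\ell_{d+1}\}$ be a facet of $\Delta$ that is maximal among the facets of $\Delta$ in Gale order, and such that $\ell_1\geq 2$. Then $$\frac{\hat{k}_d(\Delta)}{\hat{k}_d(\Delta\setminus\sigma)}=\prod_{q=1}^{d+1}\frac{D_{\ell_q}}{D_{\ell_q-1}},$$ where $D_q=\sum_{r=1}^{q}x_r$.
   Context: Shifted complexes: a (pure) abstract simplicial complex $\Delta$ on the vertex set $\{1,\dots,n\}$ is shifted if whenever $\tau\in\Delta$ and $q\in\tau$, then $(\tau\setminus\{q\})\cup\{r\}\in\Delta$ for every $r<q$. The Gale order on $k$-element sets of positive integers is defined by $\{a_1<\cdots<a_k\}\leq\{b_1<\cdots<b_k\}$ if $a_i\leq b_i$ for all $1\leq i\leq k$; a pure complex is shifted if and only if its facets form an order ideal in Gale order. $\Delta\setminus\sigma$ denotes the complex obtained from $\Delta$ by removing only the facet $\sigma$ (all proper subsets of $\sigma$ remain). Weights: each vertex $q\in\{1,\dots,n\}$ has an indeterminate weight $x_q$, and a $d$-face $\tau=\{j_1,\dots,j_{d+1}\}$ has weight $x_\tau=x_{j_1}\cdots x_{j_{d+1}}$. Spanning trees and weighted tree-number: For a $d$-dimensional simplicial complex $\Sigma$, let $\Sigma_d$ be its set of $d$-dimensional faces, $\Sigma^{(d-1)}$ its $(d-1)$-skeleton, and $b_i(\Sigma)=\operatorname{rank}\tilde H_i(\Sigma;\mathbb{Z})$ (reduced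 homology). A $d$-dimensional spanning tree of $\Sigma$ is a $d$-dimensional subcomplex $\Upsilon\subseteq\Sigma$ with $\Upsilon^{(d-1)}=\Sigma^{(d-1)}$, $b_{d-1}(\Upsilon)=b_{d-1}(\Sigma)$ and $b_d(\Upsilon)=0$; $\mathcal{T}_d(\Sigma)$ is the set of these. Let $\mathbf{t}_{d-1}(\Upsilon)$ be the order of the torsion subgroup of $\tilde H_{d-1}(\Upsilon;\mathbb{Z})$. The weighted tree-number is $$\hat k_d(\Sigma)=\sum_{\Upsilon\in\mathcal{T}_d(\Sigma)}\Big(\prod_{\tau\in\Upsilon_d}x_\tau\Big)\,\mathbf{t}_{d-1}(\Upsilon)^2.$$ *)

theory Defs
  imports
    "HOL-Algebra.Free_Abelian_Groups"
    "HOL-Computational_Algebra.Polynomial_Factorial"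
begin

section \<open>Simplicial complexes on positive integers\<close>

definition simplicial_complex :: "nat set set \<Rightarrow> bool" where
  "simplicial_complex K \<longleftrightarrow> {} \<in> K \<and> (\<forall>\<tau>\<in>K. finite \<tau> \<and> (\<forall>\<rho>. \<rho> \<subseteq> \<tau> \<longrightarrow> \<rho> \<in> K))"

text \<open>Dimensions are integers: the empty face has dimension \<open>-1\<close>.\<close>

definition face_dim :: "nat set \<Rightarrow> int" where
  "face_dim \<tau> = int (card \<tau>) - 1"

definition complex_dim :: "nat set set \<Rightarrow> int" where
  "complex_dim K = Max (face_dim ` K)"

definition faces :: "int \<Rightarrow> nat set set \<Rightarrow> nat set set" where
  "faces i K = {\<tau> \<in> K. face_dim \<tau> = i}"

definition skeleton :: "int \<Rightarrow> nat set set \<Rightarrow> nat set set" where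
  "skeleton i K = {\<tau> \<in> K. face_dim \<tau> \<le> i}"

definition facets :: "nat set set \<Rightarrow> nat set set" where
  "facets K = {\<tau> \<in> K. \<forall>\<rho>\<in>K. \<tau> \<subseteq> \<rho> \<longrightarrow> \<rho> = \<tau>}"

definition pure_complex :: "nat set set \<Rightarrow> bool" where
  "pure_complex K \<longleftrightarrow> (\<forall>\<tau>\<in>facets K. face_dim \<tau> = complex_dim K)"

text \<open>Vertices are positive, so the replacement vertex \<open>r\<close> starts at \<open>1\<close>.\<close>

definition shifted :: "nat set set \<Rightarrow> bool" where
  "shifted K \<longleftrightarrow> (\<forall>\<tau>\<in>K. \<forall>q\<in>\<tau>. \<forall>r\<in>{1..<q}. insert r (\<tau> - {q}) \<in> K)"

definition gale_le :: "nat set \<Rightarrow> nat set \<Rightarrow> bool" where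
  "gale_le A B \<longleftrightarrow> finite A \<and> finite B \<and> card A = card B \<and>
     (\<forall>i < card A. sorted_list_of_set A ! i \<le> sorted_list_of_set B ! i)"

section \<open>Rank and torsion of abelian groups\<close>

text \<open>Families over a finite set, with integer exponents; the group is written multiplicatively.\<close>

definition int_independent :: "('a, 'b) monoid_scheme \<Rightarrow> 'a set \<Rightarrow> bool" where
  "int_independent G S \<longleftrightarrow> finite S \<and> S \<subseteq> carrier G \<and>
     (\<forall>c :: 'a \<Rightarrow> int. finprod G (\<lambda>s. s [^]\<^bsub>G\<^esub> c s) S = \<one>\<^bsub>G\<^esub> \<longrightarrow> (\<forall>s\<in>S. c s = 0))"

text \<open>The supremum is a maximum when \<open>G\<close> has finite rank, in particular for every
  finitely generated abelian group.\<close>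

definition ab_rank :: "('a, 'b) monoid_scheme \<Rightarrow> nat" where
  "ab_rank G = Sup {card S | S. int_independent G S}"

definition torsion_elements :: "('a, 'b) monoid_scheme \<Rightarrow> 'a set" where
  "torsion_elements G = {g \<in> carrier G. \<exists>m::nat. 0 < m \<and> g [^]\<^bsub>G\<^esub> m = \<one>\<^bsub>G\<^esub>}"

section \<open>Reduced simplicial homology over the integers\<close>

text \<open>The complex is augmented: \<open>faces (-1) K = {{}}\<close>, so the chain group in degree \<open>-1\<close> is
  infinite cyclic.\<close>

definition simplicial_chain_group :: "int \<Rightarrow> nat set set \<Rightarrow> (nat set \<Rightarrow>\<^sub>0 int) monoid" where
  "simplicial_chain_group i K = free_Abelian_group (faces i K)"

text \<open>Faces are oriented by the order of the vertices, so the sign attached to deleting \<open>v\<close> is given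
  by the number of vertices of the face preceding \<open>v\<close>.\<close>

definition simplicial_boundary :: "(nat set \<Rightarrow>\<^sub>0 int) \<Rightarrow> (nat set \<Rightarrow>\<^sub>0 int)" where
  "simplicial_boundary =
     frag_extend (\<lambda>\<tau>. \<Sum>v\<in>\<tau>. frag_cmul ((- 1) ^ card {u \<in> \<tau>. u < v}) (frag_of (\<tau> - {v})))"

definition simplicial_cycles :: "int \<Rightarrow> nat set set \<Rightarrow> (nat set \<Rightarrow>\<^sub>0 int) set" where
  "simplicial_cycles i K =
     kernel (simplicial_chain_group i K) (simplicial_chain_group (i - 1) K) simplicial_boundary"

definition simplicial_boundaries :: "int \<Rightarrow> nat set set \<Rightarrow> (nat set \<Rightarrow>\<^sub>0 int) set" where
  "simplicial_boundaries i K = simplicial_boundary ` carrier (simplicial_chain_group (i + 1) K)"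

definition reduced_homology_group :: "int \<Rightarrow> nat set set \<Rightarrow> (nat set \<Rightarrow>\<^sub>0 int) set monoid" where
  "reduced_homology_group i K =
     subgroup_generated (simplicial_chain_group i K) (simplicial_cycles i K)
       Mod simplicial_boundaries i K"

definition betti :: "int \<Rightarrow> nat set set \<Rightarrow> nat" where
  "betti i K = ab_rank (reduced_homology_group i K)"

definition torsion_order :: "int \<Rightarrow> nat set set \<Rightarrow> nat" where
  "torsion_order i K = card (torsion_elements (reduced_homology_group i K))"

section \<open>Spanning trees and the weighted tree-number\<close>

definition spanning_trees :: "int \<Rightarrow> nat set set \<Rightarrow> nat set set set" where
  "spanning_trees d K = {T. T \<subseteq> K \<and> simplicial_complex T \<and> complex_dim T = d \<and>
     skeleton (d - 1) T = skeleton (d - 1) K \<and>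
     betti (d - 1) T = betti (d - 1) K \<and> betti d T = 0}"

text \<open>Integer polynomials in indeterminates indexed by the natural numbers, as finitely supported
  functions from monomials (exponent vectors) to coefficients.\<close>

type_synonym weight_poly = "(nat \<Rightarrow>\<^sub>0 nat) \<Rightarrow>\<^sub>0 int"

definition vertex_weight :: "nat \<Rightarrow> weight_poly" where
  "vertex_weight q = Poly_Mapping.single (Poly_Mapping.single q 1) 1"

definition face_weight :: "nat set \<Rightarrow> weight_poly" where
  "face_weight \<tau> = (\<Prod>q\<in>\<tau>. vertex_weight q)"

definition weighted_tree_number :: "int \<Rightarrow> nat set set \<Rightarrow> weight_poly" where
  "weighted_tree_number d K =
     (\<Sum>T\<in>spanning_trees d K. (\<Prod>\<tau>\<in>faces d T. face_weight \<tau>) * of_nat (torsion_order (d - 1) T) ^ 2)"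

definition weight_sum :: "nat \<Rightarrow> weight_poly" where
  "weight_sum q = (\<Sum>r=1..q. vertex_weight r)"

end

theory Submission
  imports Defs
begin

text \<open>
  Write \<open>\<partial>\<tau>\<close> for the boundary of a \<open>d\<close>-face \<open>\<tau>\<close>.  A subcomplex with full \<open>(d-1)\<close>-skeleton is a
  spanning tree exactly when the vectors \<open>\<partial>\<tau>\<close> of its \<open>d\<close>-faces are independent and their span contains
  a nonzero multiple of the boundary of every \<open>d\<close>-face (\<open>trees_eq\<close>), and \<open>t\<^sub>d\<^sub>-\<^sub>1\<close> is the index of this span
  in its saturation (\<open>torsion_order_subcomplex\<close>).  The weighted tree-number is therefore a sum over the bases \<open>B\<close> of a
  finite family of integer vectors, each weighted by \<open>(\<Prod>\<tau>\<in>B. x\<^sub>\<tau>)\<close> times the square of an index.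

  For such a family there is a theorem of Kirchhoff type (\<open>basis_weight_sum_avoiding\<close>): if the basis
  vector \<open>e\<^sub>\<sigma>\<close> is split as \<open>e\<^sub>\<sigma> = z + c\<close> with \<open>z\<close> a cycle and \<open>c\<close> orthogonal to all cycles for the form
  \<open>\<Sum>u\<^sub>\<tau>v\<^sub>\<tau>/x\<^sub>\<tau>\<close>, then the bases avoiding \<open>\<sigma>\<close> carry the fraction \<open>z\<^sub>\<sigma>\<close> of the total weight.  It follows from
  the exchange of one element of a basis: if \<open>m \<partial>\<sigma> = \<Sum>n\<^sub>\<tau> \<partial>\<tau>\<close> over \<open>B\<close>, then replacing \<open>\<tau>\<close> by \<open>\<sigma>\<close>
  multiplies the index by \<open>|n\<^sub>\<tau>/m|\<close> (\<open>lattice_basis_exchange\<close>), which makes the contributions of the two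
  bases to the two sides agree.

  For a shifted complex and a Gale-maximal facet \<open>\<sigma> = {l\<^sub>1 < \<dots> < l\<^sub>d\<^sub>+\<^sub>1}\<close> the splitting can be written
  down.  With \<open>u\<^sub>q = \<Sum>r\<le>q. x\<^sub>r e\<^sub>r\<close>, the exterior product of the \<open>0\<close>-cycles \<open>e\<^bsub>l\<^sub>q\<^esub> - u\<^bsub>l\<^sub>q\<^esub>/D\<^bsub>l\<^sub>q\<^esub>\<close> is a
  \<open>d\<close>-cycle supported on the sets below \<open>\<sigma>\<close> in Gale order, hence on \<open>\<Delta>\<close>, and its coefficient at \<open>\<sigma>\<close> is
  \<open>\<Prod>D\<^bsub>l\<^sub>q-1\<^esub>/D\<^bsub>l\<^sub>q\<^esub>\<close>.  That the difference from \<open>e\<^sub>\<sigma>\<close> is orthogonal to the cycles of \<open>\<Delta>\<close> is where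
  maximality enters: the error terms live on sets strictly above \<open>\<sigma>\<close>, which are not in \<open>\<Delta>\<close>.
  Up to the factor \<open>\<Prod>D\<^bsub>l\<^sub>q\<^esub>\<close>, the product does not change when its factors are replaced by the differences
  of consecutive \<open>0\<close>-cycles \<open>D\<^bsub>l\<^sub>q\<^esub> e\<^bsub>l\<^sub>q\<^esub> - u\<^bsub>l\<^sub>q\<^esub>\<close>, which are supported on the
  intervals \<open>[l\<^sub>q\<^sub>-\<^sub>1, l\<^sub>q]\<close>; these overlap only in end points, so every coefficient of the exterior product becomes a single product without signs, and both properties can be verified term by term
  (\<open>\<Psi>_cycle\<close>, \<open>\<Psi>_coboundary\<close>).

  Finally, \<open>l\<^sub>1 \<ge> 2\<close> makes \<open>\<partial>\<sigma>\<close> a combination of boundaries of faces containing the vertex \<open>1\<close>, so that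
  the spanning trees of \<open>\<Delta> \<setminus> \<sigma>\<close> are those of \<open>\<Delta>\<close> that avoid \<open>\<sigma>\<close>.
\<close>

section \<open>Integer combinations of a family of vectors\<close>

text \<open>The weights are rational functions, and integer relations are divided by integers in their field.\<close>

instance fract :: ("{idom, ring_char_0}") field_char_0
proof
  have "inj (\<lambda>n. to_fract (of_nat n :: 'a))" by (auto intro!: injI)
  moreover have "to_fract (of_nat n :: 'a) = of_nat n" for n by (induction n) auto
  ultimately show "inj (of_nat :: nat \<Rightarrow> 'a fract)" by (simp add: inj_def)
qed

definition int_comb :: "('f \<Rightarrow> 'r \<Rightarrow>\<^sub>0 int) \<Rightarrow> 'f set \<Rightarrow> ('f \<Rightarrow> int) \<Rightarrow> 'r \<Rightarrow>\<^sub>0 int" where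
  "int_comb a B c = (\<Sum>i\<in>B. frag_cmul (c i) (a i))"

definition int_span :: "('f \<Rightarrow> 'r \<Rightarrow>\<^sub>0 int) \<Rightarrow> 'f set \<Rightarrow> ('r \<Rightarrow>\<^sub>0 int) set" where
  "int_span a B = range (int_comb a B)"

definition int_indep :: "('f \<Rightarrow> 'r \<Rightarrow>\<^sub>0 int) \<Rightarrow> 'f set \<Rightarrow> bool" where
  "int_indep a B \<longleftrightarrow> (\<forall>c. int_comb a B c = 0 \<longrightarrow> (\<forall>i\<in>B. c i = 0))"

lemma lookup_int_comb:
  "Poly_Mapping.lookup (int_comb a B c) r = (\<Sum>i\<in>B. c i * Poly_Mapping.lookup (a i) r)"
  by (simp add: int_comb_def lookup_sum)

lemma int_comb_add: "int_comb a B c + int_comb a B c' = int_comb a B (\<lambda>i. c i + c' i)"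
  by (simp add: int_comb_def frag_cmul_distrib sum.distrib)

lemma int_comb_diff: "int_comb a B c - int_comb a B c' = int_comb a B (\<lambda>i. c i - c' i)"
  by (simp add: int_comb_def frag_cmul_diff_distrib sum_subtractf)

lemma int_comb_cmul: "frag_cmul k (int_comb a B c) = int_comb a B (\<lambda>i. k * c i)"
  by (simp add: int_comb_def frag_cmul_sum)

lemma int_comb_cong: "(\<And>i. i \<in> B \<Longrightarrow> c i = c' i) \<Longrightarrow> int_comb a B c = int_comb a B c'"
  by (simp add: int_comb_def)

lemma int_comb_remove:
  "finite B \<Longrightarrow> i \<in> B \<Longrightarrow> int_comb a B c = frag_cmul (c i) (a i) + int_comb a (B - {i}) c"
  by (simp add: int_comb_def sum.remove)

lemma int_comb_insert:
  "finite B \<Longrightarrow> i \<notin> B \<Longrightarrow> int_comb a (insert i B) c = frag_cmul (c i) (a i) + int_comb a B c"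
  by (simp add: int_comb_def)

lemma int_comb_extend:
  assumes "finite C" "B \<subseteq> C"
  shows "int_comb a B c = int_comb a C (\<lambda>i. if i \<in> B then c i else 0)"
  unfolding int_comb_def by (rule sum.mono_neutral_cong_left) (use assms in auto)

lemma int_span_mono: "finite C \<Longrightarrow> B \<subseteq> C \<Longrightarrow> int_span a B \<subseteq> int_span a C"
  unfolding int_span_def by (auto simp: int_comb_extend[of C B])

lemma int_span_base:
  assumes "finite B" "i \<in> B" shows "a i \<in> int_span a B"
proof -
  have "int_comb a B (\<lambda>j. if j = i then 1 else 0) = a i"
    using assms by (simp add: int_comb_remove[of B i]) (simp add: int_comb_def)
  then show ?thesis unfolding int_span_def by (metis rangeI)
qed

lemma int_indepD: "int_indep a B \<Longrightarrow> int_comb a B c = 0 \<Longrightarrow> i \<in> B \<Longrightarrow> c i = 0"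
  by (auto simp: int_indep_def)

lemma int_indep_unique:
  assumes "int_indep a B" "int_comb a B c = int_comb a B c'" "i \<in> B" shows "c i = c' i"
  using int_indepD[OF assms(1), of "\<lambda>i. c i - c' i" i] assms by (simp flip: int_comb_diff)

text \<open>
  Integer independence survives extension of scalars.  Given a relation over the field with a
  nonzero coefficient at \<open>i\<close>, one coordinate in which \<open>a i\<close> does not vanish is eliminated from all
  other vectors with integer multipliers; this keeps independence and the relation, and there is one
  vector fewer.
\<close>

lemma int_indep_imp_field_indep:
  fixes k :: "'f \<Rightarrow> 'k::field_char_0"
  assumes "finite B" "int_indep a B" 
    "\<And>r. (\<Sum>i\<in>B. k i * of_int (Poly_Mapping.lookup (a i) r)) = 0" "i \<in> B"
  shows "k i = 0"
  using assms
proof (induction "card B" arbitrary: B a i)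
  case 0 then show ?case by simp
next
  case (Suc N)
  show ?case
  proof (rule ccontr)
    assume ki: "k i \<noteq> 0"
    let ?L = "\<lambda>j r. Poly_Mapping.lookup (a j) r"
    have "a i \<noteq> 0"
    proof
      assume "a i = 0"
      then have "int_comb a B (\<lambda>j. if j = i then 1 else 0) = 0" 
        by (auto simp: int_comb_def intro!: sum.neutral)
      from int_indepD[OF Suc.prems(2) this \<open>i \<in> B\<close>] show False by simp
    qed
    then obtain s where s: "?L i s \<noteq> 0" by (metis lookup_zero poly_mapping_eqI)
    let ?p = "?L i s"
    define b where "b j = frag_cmul ?p (a j) - frag_cmul (?L j s) (a i)" for j
    let ?B = "B - {i}"
    have fin: "finite ?B" and cardB: "N = card ?B" using Suc by auto
    have "int_indep b ?B"
      unfolding int_indep_def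
    proof (intro allI impI ballI)
      fix c j assume c: "int_comb b ?B c = 0" and j: "j \<in> ?B"
      let ?c = "\<lambda>j. if j = i then - (\<Sum>h\<in>?B. c h * ?L h s) else ?p * c j"
      have "int_comb a B ?c = frag_cmul (?c i) (a i) + int_comb a ?B ?c"
        using Suc.prems by (intro int_comb_remove) auto
      also have "int_comb a ?B ?c = int_comb a ?B (\<lambda>j. ?p * c j)"
        by (intro int_comb_cong) auto
      also have "frag_cmul (?c i) (a i) + \<dots> = int_comb b ?B c"
        unfolding b_def int_comb_def
        by (intro poly_mapping_eqI)
          (simp add: lookup_add lookup_sum lookup_minus algebra_simps sum_subtractf sum_distrib_left)
      finally have "int_comb a B ?c = 0" using c by simp
      from int_indepD[OF Suc.prems(2) this, of j] j s show "c j = 0" by auto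
    qed
    moreover have "(\<Sum>j\<in>?B. k j * of_int (Poly_Mapping.lookup (b j) r)) = 0" for r
    proof -
      have rel: "(\<Sum>j\<in>?B. k j * of_int (?L j r)) = - k i * of_int (?L i r)" for r
        using Suc.prems(3)[of r] Suc.prems(1,4) by (simp add: sum.remove eq_neg_iff_add_eq_0 add.commute)
      have "(\<Sum>j\<in>?B. k j * of_int (Poly_Mapping.lookup (b j) r))
         = of_int ?p * (\<Sum>j\<in>?B. k j * of_int (?L j r)) - of_int (?L i r) * (\<Sum>j\<in>?B. k j * of_int (?L j s))"
        by (simp add: b_def lookup_minus algebra_simps sum_subtractf sum_distrib_left)
      also have "\<dots> = 0" by (simp add: rel)
      finally show ?thesis .
    qed
    ultimately have kj: "k j = 0" if "j \<in> ?B" for j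
      using Suc.hyps(1)[OF cardB fin] that by blast
    have "k i * of_int ?p = 0"
      using Suc.prems(3)[of s] Suc.prems(1,4) kj by (simp add: sum.remove)
    then show False using ki s by simp
  qed
qed

text \<open>The same elimination, by induction on the number of coordinates; it bounds the rank of chain groups.\<close>

lemma int_dependent_of_card_less:
  assumes "finite S" "finite I" "card S < card I" "\<And>i. i \<in> I \<Longrightarrow> Poly_Mapping.keys (v i) \<subseteq> S"
  shows "\<not> int_indep v I"
  using assms
proof (induction S arbitrary: I v rule: finite_induct)
  case empty
  then obtain i where "i \<in> I" by fastforce
  moreover have "int_comb v I (\<lambda>_. 1) = 0"
    using empty by (auto simp: int_comb_def intro!: sum.neutral)
  ultimately show ?case by (auto simp: int_indep_def intro!: exI[of _ "\<lambda>_. 1::int"])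
next
  case (insert s S)
  let ?L = "\<lambda>j. Poly_Mapping.lookup (v j) s"
  show ?case
  proof (cases "\<forall>i\<in>I. ?L i = 0")
    case True
    then have "Poly_Mapping.keys (v i) \<subseteq> S" if "i \<in> I" for i
      using insert.prems(3)[OF that] that by (auto simp: in_keys_iff)
    then show ?thesis using insert by (intro insert.IH) auto
  next
    case False
    then obtain i where i: "i \<in> I" "?L i \<noteq> 0" by blast
    define w where "w j = frag_cmul (?L i) (v j) - frag_cmul (?L j) (v i)" for j
    have "Poly_Mapping.keys (w j) \<subseteq> S" if "j \<in> I - {i}" for j
    proof
      fix r assume r: "r \<in> Poly_Mapping.keys (w j)"
      then have "r \<noteq> s" by (auto simp: w_def in_keys_iff lookup_minus)
      moreover have "r \<in> Poly_Mapping.keys (v j) \<union> Poly_Mapping.keys (v i)"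
        using r by (auto simp: w_def in_keys_iff lookup_minus)
      ultimately show "r \<in> S" using insert.prems(3)[of j] insert.prems(3)[OF i(1)] that by auto
    qed
    moreover have "card S < card (I - {i})" using insert i by simp
    ultimately have "\<not> int_indep w (I - {i})" using insert by (intro insert.IH) auto
    then obtain c j where c: "int_comb w (I - {i}) c = 0" and j: "j \<in> I - {i}" "c j \<noteq> 0"
      by (auto simp: int_indep_def)
    let ?c = "\<lambda>j. if j = i then - (\<Sum>h\<in>I - {i}. c h * ?L h) else ?L i * c j"
    have "int_comb v I ?c = frag_cmul (?c i) (v i) + int_comb v (I - {i}) ?c"
      using insert.prems i by (intro int_comb_remove) auto
    also have "int_comb v (I - {i}) ?c = int_comb v (I - {i}) (\<lambda>j. ?L i * c j)"
      by (intro int_comb_cong) auto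
    also have "frag_cmul (?c i) (v i) + \<dots> = int_comb w (I - {i}) c"
      unfolding w_def int_comb_def
      by (intro poly_mapping_eqI)
        (simp add: lookup_add lookup_sum lookup_minus algebra_simps sum_subtractf sum_distrib_left)
    finally have "int_comb v I ?c = 0" using c by simp
    moreover have "?c j \<noteq> 0" using i j by auto
    ultimately show ?thesis using j by (force simp: int_indep_def intro!: exI[of _ ?c] bexI[of _ j])
  qed
qed

section \<open>Subgroups and indices\<close>

definition frag_subgroup :: "('r \<Rightarrow>\<^sub>0 int) set \<Rightarrow> bool" where
  "frag_subgroup H \<longleftrightarrow> 0 \<in> H \<and> (\<forall>x\<in>H. \<forall>y\<in>H. x - y \<in> H)"

lemma frag_subgroup_0: "frag_subgroup H \<Longrightarrow> 0 \<in> H"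
  and frag_subgroup_diff: "frag_subgroup H \<Longrightarrow> x \<in> H \<Longrightarrow> y \<in> H \<Longrightarrow> x - y \<in> H"
  by (auto simp: frag_subgroup_def)

lemma frag_subgroup_minus: "frag_subgroup H \<Longrightarrow> x \<in> H \<Longrightarrow> - x \<in> H"
  using frag_subgroup_diff[of H 0 x] frag_subgroup_0[of H] by simp

lemma frag_subgroup_add: "frag_subgroup H \<Longrightarrow> x \<in> H \<Longrightarrow> y \<in> H \<Longrightarrow> x + y \<in> H"
  using frag_subgroup_diff[of H x "- y"] frag_subgroup_minus[of H y] by simp

lemma frag_subgroup_cmul: "frag_subgroup H \<Longrightarrow> x \<in> H \<Longrightarrow> frag_cmul k x \<in> H"
  by (rule frag_closure_minus_cmul[where P = "\<lambda>x. x \<in> H"])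
    (auto intro: frag_subgroup_0 frag_subgroup_diff)

lemma frag_subgroup_sum:
  "frag_subgroup H \<Longrightarrow> (\<And>i. i \<in> I \<Longrightarrow> f i \<in> H) \<Longrightarrow> sum f I \<in> H"
  by (induction I rule: infinite_finite_induct) (auto intro: frag_subgroup_0 frag_subgroup_add)

lemma frag_subgroup_int_span: "frag_subgroup (int_span a B)"
proof -
  have "int_comb a B (\<lambda>_. 0) = 0" by (simp add: int_comb_def)
  then have "0 \<in> int_span a B" unfolding int_span_def by (metis rangeI)
  then show ?thesis by (auto simp: frag_subgroup_def int_span_def int_comb_diff)
qed

lemma int_span_subset:
  assumes "frag_subgroup H" "\<And>i. i \<in> B \<Longrightarrow> a i \<in> H" shows "int_span a B \<subseteq> H"
  using assms by (auto simp: int_span_def int_comb_def intro!: frag_subgroup_sum frag_subgroup_cmul)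

definition frag_coset :: "('r \<Rightarrow>\<^sub>0 int) set \<Rightarrow> ('r \<Rightarrow>\<^sub>0 int) \<Rightarrow> ('r \<Rightarrow>\<^sub>0 int) set" where
  "frag_coset H x = (\<lambda>h. h + x) ` H"

text \<open>Infinite index gives the value \<open>0\<close>.  All index formulas below are products of cardinalities and
  remain true for this value.\<close>

definition coset_index :: "('r \<Rightarrow>\<^sub>0 int) set \<Rightarrow> ('r \<Rightarrow>\<^sub>0 int) set \<Rightarrow> nat" where
  "coset_index X H = card (frag_coset H ` X)"

lemma mem_frag_coset: "z \<in> frag_coset H x \<longleftrightarrow> z - x \<in> H"
proof
  assume "z - x \<in> H"
  then have "(z - x) + x \<in> frag_coset H x" unfolding frag_coset_def by (rule imageI)
  then show "z \<in> frag_coset H x" by simp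
qed (auto simp: frag_coset_def)

lemma frag_coset_eq_iff:
  assumes H: "frag_subgroup H" shows "frag_coset H x = frag_coset H y \<longleftrightarrow> x - y \<in> H"
proof
  assume "frag_coset H x = frag_coset H y"
  then show "x - y \<in> H" using mem_frag_coset[of x H x] frag_subgroup_0[OF H] by (simp add: mem_frag_coset)
next
  assume xy: "x - y \<in> H"
  have "z - x \<in> H \<longleftrightarrow> z - y \<in> H" for z
    using frag_subgroup_add[OF H, of "z - x" "x - y"] frag_subgroup_diff[OF H, of "z - y" "x - y"] xy
    by (auto simp: algebra_simps)
  then show "frag_coset H x = frag_coset H y" by (auto simp: mem_frag_coset)
qed

text \<open>If \<open>g\<close> has order \<open>m\<close> modulo \<open>H\<close>, each coset of \<open>H' = H + \<int>g\<close> is the disjoint union of the cosets of \<open>H\<close>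
  through \<open>c + i g\<close> for \<open>0 \<le> i < m\<close>, where \<open>c\<close> is a chosen representative.\<close>

lemma coset_index_adjoin:
  assumes H: "frag_subgroup H" and X: "frag_subgroup X" and HX: "H \<subseteq> X" and g: "g \<in> X"
    and m: "m > 0" and ord: "\<And>k. frag_cmul k g \<in> H \<longleftrightarrow> m dvd k"
    and H': "frag_subgroup H'" "\<And>x. x \<in> H' \<longleftrightarrow> (\<exists>k. x - frag_cmul k g \<in> H)"
  shows "coset_index X H = nat m * coset_index X H'"
proof -
  define rep where "rep c = (SOME x. x \<in> X \<and> frag_coset H' x = c)" for c
  have rep: "rep c \<in> X" "frag_coset H' (rep c) = c" if "c \<in> frag_coset H' ` X" for c
    using someI_ex[of "\<lambda>x. x \<in> X \<and> frag_coset H' x = c"] that unfolding rep_def by blast+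
  let ?f = "\<lambda>(c, i). frag_coset H (rep c + frag_cmul i g)"
  have "bij_betw ?f (frag_coset H' ` X \<times> {0..<m}) (frag_coset H ` X)"
    unfolding bij_betw_def
  proof (intro conjI inj_onI)
    fix p q assume p: "p \<in> frag_coset H' ` X \<times> {0..<m}" and q: "q \<in> frag_coset H' ` X \<times> {0..<m}"
      and eq: "?f p = ?f q"
    obtain c i d j where pq: "p = (c, i)" "q = (d, j)" by (cases p, cases q)
    have *: "(rep c - rep d) - frag_cmul (j - i) g \<in> H"
      using eq by (simp add: pq frag_coset_eq_iff[OF H] frag_cmul_diff_distrib algebra_simps)
    then have "rep c - rep d \<in> H'" using H'(2) by blast
    then have "c = d" using rep p q pq frag_coset_eq_iff[OF H'(1)] by (metis mem_Sigma_iff)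
    then have "frag_cmul (i - j) g \<in> H" using * by simp
    then have "m dvd i - j" using ord by simp
    then have "i = j" using p q pq m zdvd_imp_le[of m "i - j"] zdvd_imp_le[of m "j - i"]
      by (auto simp: dvd_diff_commute) (smt (verit))
    with \<open>c = d\<close> pq show "p = q" by simp
  next
    show "?f ` (frag_coset H' ` X \<times> {0..<m}) = frag_coset H ` X"
    proof (intro equalityI subsetI)
      fix y assume "y \<in> ?f ` (frag_coset H' ` X \<times> {0..<m})"
      then show "y \<in> frag_coset H ` X"
        using rep g X by (auto intro!: imageI frag_subgroup_add frag_subgroup_cmul)
    next
      fix y assume "y \<in> frag_coset H ` X"
      then obtain x where x: "x \<in> X" "y = frag_coset H x" by blast
      let ?c = "frag_coset H' x"
      have "x - rep ?c \<in> H'" using rep[of ?c] x frag_coset_eq_iff[OF H'(1)] by (metis imageI)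
      then obtain k where k: "x - rep ?c - frag_cmul k g \<in> H" using H'(2) by blast
      have "frag_cmul (k - k mod m) g \<in> H" by (simp add: ord minus_mod_eq_mult_div)
      from frag_subgroup_add[OF H k this] have "x - (rep ?c + frag_cmul (k mod m) g) \<in> H"
        by (simp add: frag_cmul_diff_distrib algebra_simps)
      then have "y = ?f (?c, k mod m)" using x frag_coset_eq_iff[OF H] by simp
      then show "y \<in> ?f ` (frag_coset H' ` X \<times> {0..<m})" using x m by (intro image_eqI) auto
    qed
  qed
  then have "card (frag_coset H ` X) = card (frag_coset H' ` X \<times> {0..<m})"
    using bij_betw_same_card by metis
  then show ?thesis by (simp add: coset_index_def card_cartesian_product)
qed

section \<open>Bases of a lattice and their exchange\<close>

definition lattice_bases :: "('f \<Rightarrow> 'r \<Rightarrow>\<^sub>0 int) \<Rightarrow> 'f set \<Rightarrow> 'f set set" where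
  "lattice_bases a F =
     {B. B \<subseteq> F \<and> int_indep a B \<and> (\<forall>i\<in>F. \<exists>m. m \<noteq> 0 \<and> frag_cmul m (a i) \<in> int_span a B)}"

definition saturation :: "('r \<Rightarrow>\<^sub>0 int) set \<Rightarrow> ('r \<Rightarrow>\<^sub>0 int) set \<Rightarrow> ('r \<Rightarrow>\<^sub>0 int) set" where
  "saturation X H = {x \<in> X. \<exists>m. m \<noteq> 0 \<and> frag_cmul m x \<in> H}"

lemma frag_subgroup_saturation:
  assumes X: "frag_subgroup X" and H: "frag_subgroup H"
  shows "frag_subgroup (saturation X H)"
  unfolding frag_subgroup_def
proof (intro conjI ballI)
  show "0 \<in> saturation X H"
    using X H by (auto simp: saturation_def frag_subgroup_0 intro: exI[of _ 1])
next
  fix x y assume "x \<in> saturation X H" "y \<in> saturation X H"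
  then obtain m n where *: "x \<in> X" "y \<in> X" "m \<noteq> 0" "n \<noteq> 0" "frag_cmul m x \<in> H" "frag_cmul n y \<in> H"
    by (auto simp: saturation_def)
  have "frag_cmul (m * n) (x - y) = frag_cmul n (frag_cmul m x) - frag_cmul m (frag_cmul n y)"
    by (rule poly_mapping_eqI) (simp add: lookup_minus algebra_simps)
  also have "\<dots> \<in> H" using * H by (blast intro: frag_subgroup_diff frag_subgroup_cmul)
  finally show "x - y \<in> saturation X H"
    using * frag_subgroup_diff[OF X] by (auto simp: saturation_def intro!: exI[of _ "m * n"])
qed

lemma subset_saturation: "H \<subseteq> X \<Longrightarrow> H \<subseteq> saturation X H"
  by (auto simp: saturation_def intro!: exI[of _ 1])

lemma saturation_closed:
  "x \<in> X \<Longrightarrow> m \<noteq> 0 \<Longrightarrow> frag_cmul m x \<in> saturation X H \<Longrightarrow> x \<in> saturation X H"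
  unfolding saturation_def by auto (metis mult_eq_0_iff)

lemma saturation_mono: "H \<subseteq> H' \<Longrightarrow> saturation X H \<subseteq> saturation X H'"
  by (auto simp: saturation_def)

lemma int_span_insert_iff:
  assumes "finite B" "s \<notin> B"
  shows "x \<in> int_span a (insert s B) \<longleftrightarrow> (\<exists>k. x - frag_cmul k (a s) \<in> int_span a B)"
proof
  assume "x \<in> int_span a (insert s B)"
  then obtain c where "x = int_comb a (insert s B) c" by (auto simp: int_span_def)
  then have "x - frag_cmul (c s) (a s) = int_comb a B c" using assms by (simp add: int_comb_insert)
  then show "\<exists>k. x - frag_cmul k (a s) \<in> int_span a B" by (auto simp: int_span_def)
next
  assume "\<exists>k. x - frag_cmul k (a s) \<in> int_span a B"
  then obtain k c where k: "x - frag_cmul k (a s) = int_comb a B c" by (auto simp: int_span_def)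
  have "int_comb a (insert s B) (c(s := k)) = frag_cmul k (a s) + int_comb a B (c(s := k))"
    using assms by (simp add: int_comb_insert)
  also have "int_comb a B (c(s := k)) = int_comb a B c" using assms by (intro int_comb_cong) auto
  finally have "x = int_comb a (insert s B) (c(s := k))" using k by (metis diff_add_cancel add.commute)
  then show "x \<in> int_span a (insert s B)" by (auto simp: int_span_def)
qed

lemma ex_order_mod_subgroup:
  assumes H: "frag_subgroup H" and m: "m \<noteq> 0" "frag_cmul m g \<in> H"
  obtains p :: int where "p > 0" "\<And>k. frag_cmul k g \<in> H \<longleftrightarrow> p dvd k"
proof -
  have "frag_cmul \<bar>m\<bar> g \<in> H"
    using m frag_subgroup_minus[OF H, of "frag_cmul m g"] by (cases "m \<ge> 0") auto
  then have ex: "\<exists>n::nat. n > 0 \<and> frag_cmul (int n) g \<in> H" using m by (intro exI[of _ "nat \<bar>m\<bar>"]) auto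
  define p where "p = (LEAST n::nat. n > 0 \<and> frag_cmul (int n) g \<in> H)"
  have p: "p > 0" "frag_cmul (int p) g \<in> H" using LeastI_ex[OF ex] unfolding p_def by auto
  have least: "\<not> (n > 0 \<and> frag_cmul (int n) g \<in> H)" if "n < p" for n
    using not_less_Least that unfolding p_def by blast
  have "frag_cmul k g \<in> H \<longleftrightarrow> int p dvd k" for k
  proof
    assume "int p dvd k"
    then obtain q where "k = q * int p" by (metis dvdE mult.commute)
    then show "frag_cmul k g \<in> H" using frag_subgroup_cmul[OF H p(2), of q] by simp
  next
    assume k: "frag_cmul k g \<in> H"
    have "frag_cmul (k mod int p) g = frag_cmul k g - frag_cmul (k div int p) (frag_cmul (int p) g)"
      by (simp flip: frag_cmul_diff_distrib add: minus_div_mult_eq_mod)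
    also have "\<dots> \<in> H" using H k p by (blast intro: frag_subgroup_diff frag_subgroup_cmul)
    finally have "frag_cmul (int (nat (k mod int p))) g \<in> H" using p by simp
    moreover have "nat (k mod int p) < p" using p by (simp add: nat_less_iff)
    ultimately have "nat (k mod int p) = 0" using least[of "nat (k mod int p)"] by simp
    moreover have "k mod int p \<ge> 0" using p by simp
    ultimately have "k mod int p = 0" by simp
    then show "int p dvd k" by (rule mod_0_imp_dvd)
  qed
  with p show thesis by (intro that[of "int p"]) auto
qed

text \<open>A finite family of vectors in a group \<open>X\<close>.  In the application \<open>X\<close> consists of the cycles of
  codimension one, and only the elements of \<open>X\<close> count as torsion.\<close>

locale lattice_family =
  fixes a :: "'f \<Rightarrow> 'r \<Rightarrow>\<^sub>0 int" and F :: "'f set" and X :: "('r \<Rightarrow>\<^sub>0 int) set"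
  assumes finite_F: "finite F" and subgroup_X: "frag_subgroup X" and a_in_X: "\<And>i. i \<in> F \<Longrightarrow> a i \<in> X"
begin

definition basis_index :: "'f set \<Rightarrow> nat" where
  "basis_index B = coset_index (saturation X (int_span a B)) (int_span a B)"

lemma int_span_subset_X: "B \<subseteq> F \<Longrightarrow> int_span a B \<subseteq> X"
  using a_in_X by (intro int_span_subset subgroup_X) auto

lemma lattice_basesD:
  assumes "B \<in> lattice_bases a F"
  shows "B \<subseteq> F" "finite B" "int_indep a B" 
    and lattice_basis_relation: "i \<in> F \<Longrightarrow> \<exists>m n. m \<noteq> 0 \<and> frag_cmul m (a i) = int_comb a B n"
  using assms finite_F by (auto simp: lattice_bases_def int_span_def image_iff intro: finite_subset)

lemma finite_lattice_bases: "finite (lattice_bases a F)"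
  using finite_F by (auto simp: lattice_bases_def intro: finite_subset[of _ "Pow F"])

text \<open>The ambient group in which the index is taken is therefore the same for all bases.\<close>

lemma saturation_basis:
  assumes "B \<in> lattice_bases a F"
  shows "saturation X (int_span a B) = saturation X (int_span a F)"
proof
  show "saturation X (int_span a B) \<subseteq> saturation X (int_span a F)"
    using lattice_basesD[OF assms] finite_F by (intro saturation_mono int_span_mono)
  have "int_span a F \<subseteq> saturation X (int_span a B)"
    using assms a_in_X subgroup_X
    by (intro int_span_subset frag_subgroup_saturation frag_subgroup_int_span)
      (auto simp: lattice_bases_def saturation_def)
  then show "saturation X (int_span a F) \<subseteq> saturation X (int_span a B)"
    using saturation_closed[of _ X _ "int_span a B"] unfolding saturation_def[of X "int_span a F"] by blast
qed

text \<open>Let \<open>p\<close> be the order of \<open>a s\<close> modulo the span of \<open>B\<close>, with \<open>p a\<^sub>s = \<Sum>q\<^sub>i a\<^sub>i\<close>.  Then \<open>|q\<^sub>t|\<close> is the order of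
  \<open>a t\<close> modulo the span of \<open>B'\<close>: a multiple of \<open>a t\<close> in that span involves a multiple of \<open>a s\<close> that lies in
  the span of \<open>B\<close>, hence a multiple \<open>i p a\<^sub>s\<close>, and then the coefficient at \<open>t\<close> is \<open>i q\<^sub>t\<close>.  Both spans sit in the
  common group spanned by \<open>B \<union> {s}\<close> with indices \<open>p\<close> and \<open>|q\<^sub>t|\<close>, and \<open>m q\<^sub>t = p n\<^sub>t\<close>.\<close>

lemma lattice_basis_exchange:
  assumes B: "B \<in> lattice_bases a F" and s: "s \<in> F - B" and t: "t \<in> B"
    and rel: "m \<noteq> 0" "frag_cmul m (a s) = int_comb a B n" "n t \<noteq> 0"
  defines "B' \<equiv> insert s (B - {t})"
  shows "B' \<in> lattice_bases a F"
    and "nat \<bar>m\<bar> * basis_index B' = nat \<bar>n t\<bar> * basis_index B"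
    and "\<exists>n'. frag_cmul (n t) (a t) = int_comb a B' n' \<and> n' s = m"
proof -
  note BD = lattice_basesD[OF B]
  let ?C = "B - {t}"
  have finC: "finite ?C" and sC: "s \<notin> ?C" and st: "s \<noteq> t" using BD s t by auto
  have B'F: "B' \<subseteq> F" and finB': "finite B'" using BD s unfolding B'_def by auto
  have rel': "frag_cmul p (a t) = int_comb a B' ((\<lambda>i. - c i)(s := q))"
    if "frag_cmul q (a s) = int_comb a B c" "c t = p" for p q c
  proof -
    have "int_comb a B' ((\<lambda>i. - c i)(s := q)) = frag_cmul q (a s) + int_comb a ?C ((\<lambda>i. - c i)(s := q))"
      unfolding B'_def using finC sC by (simp add: int_comb_insert)
    also have "int_comb a ?C ((\<lambda>i. - c i)(s := q)) = int_comb a ?C (\<lambda>i. - c i)"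
      using sC by (intro int_comb_cong) auto
    also have "\<dots> = - int_comb a ?C c" using int_comb_cmul[of "-1" a ?C c] by simp
    finally show ?thesis using that int_comb_remove[OF BD(2) t, of a c] by (simp add: fun_upd_def)
  qed
  from rel'[OF rel(2) refl] 
  show rel_t: "\<exists>n'. frag_cmul (n t) (a t) = int_comb a B' n' \<and> n' s = m" by (metis fun_upd_same)

  have indep: "int_indep a B'"
    unfolding int_indep_def
  proof (intro allI impI)
    fix c assume c: "int_comb a B' c = 0"
    have "0 = frag_cmul m (int_comb a B' c)" using c by simp
    also have "\<dots> = frag_cmul (c s) (frag_cmul m (a s)) + int_comb a ?C (\<lambda>i. m * c i)"
      unfolding B'_def using finC sC
      by (simp add: int_comb_insert frag_cmul_distrib2 int_comb_cmul mult.commute)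
    also have "\<dots> = int_comb a B (\<lambda>i. c s * n i) + int_comb a ?C (\<lambda>i. m * c i)"
      by (simp add: rel int_comb_cmul)
    also have "\<dots> = int_comb a B (\<lambda>i. c s * n i + (if i \<in> ?C then m * c i else 0))"
      using BD(2) by (subst int_comb_extend[of B ?C]) (auto simp: int_comb_add)
    finally have *: "c s * n i + (if i \<in> ?C then m * c i else 0) = 0" if "i \<in> B" for i
      using int_indepD[OF BD(3) _ that] by metis
    from *[OF t] rel have "c s = 0" by simp
    moreover have "c i = 0" if "i \<in> ?C" for i using *[of i] that \<open>c s = 0\<close> rel by simp
    ultimately show "\<forall>i\<in>B'. c i = 0" by (simp add: B'_def)
  qed
  have span: "int_span a F \<subseteq> saturation X (int_span a B')"
  proof -
    have "a i \<in> saturation X (int_span a B')" if "i \<in> B" for i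
    proof (cases "i = t")
      case True
      then show ?thesis using rel rel_t a_in_X BD(1) t by (auto simp: saturation_def int_span_def)
    next
      case False
      then have "i \<in> B'" using that by (simp add: B'_def)
      then show ?thesis using subset_saturation[OF int_span_subset_X[OF B'F]] int_span_base[OF finB'] by blast
    qed
    then have sub: "int_span a B \<subseteq> saturation X (int_span a B')"
      by (intro int_span_subset frag_subgroup_saturation frag_subgroup_int_span subgroup_X)
    have "a i \<in> saturation X (int_span a B')" if "i \<in> F" for i
      using BD(4)[OF that] sub saturation_closed[OF a_in_X[OF that]] unfolding int_span_def[of a B] by (metis rangeI subsetD)
    then show ?thesis by (intro int_span_subset frag_subgroup_saturation frag_subgroup_int_span subgroup_X)
  qed
  show B': "B' \<in> lattice_bases a F"
    using indep B'F span int_span_base[OF finite_F, of _ a] unfolding lattice_bases_def saturation_def by blast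

  obtain p where p: "p > 0" "\<And>k. frag_cmul k (a s) \<in> int_span a B \<longleftrightarrow> p dvd k"
    using ex_order_mod_subgroup[OF frag_subgroup_int_span rel(1), of "a s" a B] rel(2)
    by (auto simp: int_span_def)
  obtain q where q: "frag_cmul p (a s) = int_comb a B q" using p(2)[of p] by (auto simp: int_span_def)
  have mq: "m * q i = p * n i" if "i \<in> B" for i
  proof (rule int_indep_unique[OF BD(3) _ that])
    show "int_comb a B (\<lambda>i. m * q i) = int_comb a B (\<lambda>i. p * n i)"
      by (simp flip: int_comb_cmul q rel(2) add: mult.commute)
  qed
  have qt: "q t \<noteq> 0" using mq[OF t] p rel by auto
  have ord_t: "frag_cmul k (a t) \<in> int_span a B' \<longleftrightarrow> \<bar>q t\<bar> dvd k" for k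
  proof
    assume "\<bar>q t\<bar> dvd k"
    then obtain j where "k = j * q t" by (metis abs_dvd_iff dvdE mult.commute)
    moreover have "frag_cmul (q t) (a t) \<in> int_span a B'" using rel'[OF q refl] by (auto simp: int_span_def)
    ultimately show "frag_cmul k (a t) \<in> int_span a B'"
      using frag_subgroup_cmul[OF frag_subgroup_int_span, of "frag_cmul (q t) (a t)" a B' j] by simp
  next
    assume "frag_cmul k (a t) \<in> int_span a B'"
    then obtain j where "frag_cmul k (a t) - frag_cmul j (a s) \<in> int_span a ?C"
      unfolding B'_def int_span_insert_iff[OF finC sC] by blast
    then obtain c where j: "frag_cmul k (a t) - frag_cmul j (a s) = int_comb a ?C c"
      by (auto simp: int_span_def)
    define e where "e i = (if i = t then k else 0) - (if i \<in> ?C then c i else 0)" for i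
    have "int_comb a B (\<lambda>i. if i = t then k else 0) = frag_cmul k (a t)"
      using BD(2) t by (simp add: int_comb_remove[of B t]) (simp add: int_comb_def)
    then have "int_comb a B e = frag_cmul k (a t) - int_comb a ?C c"
      using BD(2) unfolding e_def by (subst int_comb_extend[of B ?C]) (auto simp flip: int_comb_diff)
    also have "\<dots> = frag_cmul j (a s)" using j by (simp add: algebra_simps)
    finally have js: "frag_cmul j (a s) = int_comb a B e" ..
    then have "p dvd j" using p(2) by (auto simp: int_span_def)
    then obtain i where i: "j = i * p" by (metis dvdE mult.commute)
    have "int_comb a B e = int_comb a B (\<lambda>h. i * q h)" 
      unfolding int_comb_cmul[symmetric] js[symmetric] q[symmetric] i by simp
    from int_indep_unique[OF BD(3) this t] have "k = i * q t" by (simp add: e_def)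
    then show "\<bar>q t\<bar> dvd k" by simp
  qed
  let ?S = "saturation X (int_span a F)"
  have aS: "a i \<in> ?S" if "i \<in> F" for i
    using subset_saturation[OF int_span_subset_X[OF subset_refl]] int_span_base[OF finite_F that] by blast
  have S: "frag_subgroup ?S" by (intro frag_subgroup_saturation frag_subgroup_int_span subgroup_X)
  have spanS: "int_span a C \<subseteq> ?S" if "C \<subseteq> F" for C using aS that by (intro int_span_subset S) auto
  have 1: "coset_index ?S (int_span a B) = nat p * coset_index ?S (int_span a (insert s B))"
    using s BD p aS
    by (intro coset_index_adjoin[where g = "a s"] S frag_subgroup_int_span spanS int_span_insert_iff) auto
  have "insert s B = insert t B'" "t \<notin> B'" using t st by (auto simp: B'_def)
  then have 2: "coset_index ?S (int_span a B') = nat \<bar>q t\<bar> * coset_index ?S (int_span a (insert s B))"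
    using t BD ord_t aS B'F finB' qt
    by (intro coset_index_adjoin[where g = "a t"] S frag_subgroup_int_span spanS) 
      (auto simp: int_span_insert_iff)
  have 3: "nat \<bar>m\<bar> * nat \<bar>q t\<bar> = nat \<bar>n t\<bar> * nat p"
    using mq[OF t] p by (simp flip: nat_mult_distrib abs_mult add: mult.commute) (simp add: abs_mult nat_mult_distrib)
  show "nat \<bar>m\<bar> * basis_index B' = nat \<bar>n t\<bar> * basis_index B"
    unfolding basis_index_def saturation_basis[OF B] saturation_basis[OF B'] 1 2
    using 3 by (metis mult.assoc)
qed

text \<open>The rational coordinates of \<open>a i\<close> in the basis \<open>B\<close>, as elements of the field of weights.\<close>

definition basis_coord :: "'f set \<Rightarrow> 'f \<Rightarrow> 'f \<Rightarrow> 'k::field_char_0" where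
  "basis_coord B i j = (SOME q. \<exists>m n. m \<noteq> 0 \<and> frag_cmul m (a i) = int_comb a B n \<and> q = of_int (n j) / of_int m)"

lemma basis_coord_eq:
  fixes i j :: 'f and n :: "'f \<Rightarrow> int"
  assumes B: "B \<in> lattice_bases a F" and j: "j \<in> B"
    and rel: "m \<noteq> 0" "frag_cmul m (a i) = int_comb a B n"
  shows "basis_coord B i j = (of_int (n j) / of_int m :: 'k::field_char_0)"
proof -
  let ?P = "\<lambda>q::'k. \<exists>m n. m \<noteq> 0 \<and> frag_cmul m (a i) = int_comb a B n \<and> q = of_int (n j) / of_int m"
  have "?P (basis_coord B i j)" unfolding basis_coord_def by (rule someI_ex) (use rel in blast)
  then obtain m' n' where *: "m' \<noteq> 0" "frag_cmul m' (a i) = int_comb a B n'"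
    "basis_coord B i j = (of_int (n' j) / of_int m' :: 'k)" by blast
  have "m * n' j = m' * n j"
  proof (rule int_indep_unique[OF lattice_basesD(3)[OF B] _ j])
    show "int_comb a B (\<lambda>j. m * n' j) = int_comb a B (\<lambda>j. m' * n j)"
      by (simp flip: int_comb_cmul *(2) rel(2) add: mult.commute)
  qed
  then have "of_int (m * n' j) = (of_int (m' * n j) :: 'k)" by (rule arg_cong)
  then have "of_int m' * (of_int m * basis_coord B i j) = of_int m' * (of_int (n j) :: 'k)"
    using *(1,3) by simp
  then have "of_int m * basis_coord B i j = (of_int (n j) :: 'k)" using *(1) by simp
  then show ?thesis using rel(1) by (simp add: field_simps)
qed

lemma basis_coord_self:
  assumes B: "B \<in> lattice_bases a F" and "i \<in> B" "j \<in> B"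
  shows "basis_coord B i j = (if i = j then 1 else 0)"
proof -
  have "frag_cmul 1 (a i) = int_comb a B (\<lambda>j. if j = i then 1 else 0)"
    using lattice_basesD(2)[OF B] assms by (simp add: int_comb_remove[of B i]) (simp add: int_comb_def)
  from basis_coord_eq[OF B assms(3) _ this] show ?thesis by auto
qed

lemma basis_coord_expand:
  assumes B: "B \<in> lattice_bases a F" and i: "i \<in> F"
  shows "of_int (Poly_Mapping.lookup (a i) r)
       = (\<Sum>j\<in>B. basis_coord B i j * of_int (Poly_Mapping.lookup (a j) r))"
proof -
  obtain m n where rel: "m \<noteq> 0" "frag_cmul m (a i) = int_comb a B n"
    using lattice_basis_relation[OF B i] by blast
  have "of_int m * of_int (Poly_Mapping.lookup (a i) r) 
      = of_int (Poly_Mapping.lookup (frag_cmul m (a i)) r)" by simp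
  also have "\<dots> = (\<Sum>j\<in>B. of_int (n j) * of_int (Poly_Mapping.lookup (a j) r))"
    by (simp add: rel lookup_int_comb)
  also have "\<dots> = of_int m * (\<Sum>j\<in>B. basis_coord B i j * of_int (Poly_Mapping.lookup (a j) r))"
    using rel(1) unfolding sum_distrib_left by (intro sum.cong refl) (simp add: basis_coord_eq[OF B _ rel])
  finally show ?thesis using rel(1) by simp
qed

definition basis_weight :: "('f \<Rightarrow> 'k) \<Rightarrow> 'f set \<Rightarrow> 'k::field_char_0" where
  "basis_weight x B = (\<Prod>i\<in>B. x i) * of_nat (basis_index B) ^ 2"

text \<open>The square of the index is what makes the factor a square \<open>\<kappa>\<^sup>2\<close> of the coordinate: together with
  the reciprocal coordinate \<open>1/\<kappa>\<close> of the reverse exchange it makes the two terms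
  \<open>w(B) \<kappa> x\<^sub>s/x\<^sub>t\<close> and \<open>w(B') (1/\<kappa>)\<close> equal.\<close>

lemma basis_weight_exchange:
  assumes B: "B \<in> lattice_bases a F" and s: "s \<in> F - B" and t: "t \<in> B"
    and nz: "basis_coord B s t \<noteq> (0::'k::field_char_0)"
    and x: "\<And>i. i \<in> F \<Longrightarrow> x i \<noteq> 0"
  defines "B' \<equiv> insert s (B - {t})"
  shows "B' \<in> lattice_bases a F" 
    and "basis_coord B' t s = 1 / (basis_coord B s t :: 'k)"
    and "basis_weight x B' = basis_weight x B * x s / x t * (basis_coord B s t :: 'k) ^ 2"
proof -
  obtain m n where rel: "m \<noteq> 0" "frag_cmul m (a s) = int_comb a B n"
    using lattice_basis_relation[OF B] s by blast
  have c: "basis_coord B s t = (of_int (n t) / of_int m :: 'k)" by (rule basis_coord_eq[OF B t rel])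
  have nt: "n t \<noteq> 0" using nz c by auto
  note ex = lattice_basis_exchange[OF B s t rel nt, folded B'_def]
  show B': "B' \<in> lattice_bases a F" by (rule ex)
  obtain n' where n': "frag_cmul (n t) (a t) = int_comb a B' n'" "n' s = m" using ex(3) by blast
  have "s \<in> B'" by (simp add: B'_def)
  from basis_coord_eq[OF B' this nt n'(1)] show "basis_coord B' t s = 1 / (basis_coord B s t :: 'k)"
    using c n' by simp
  have "(of_nat (nat \<bar>m\<bar> * basis_index B'))^2 = (of_nat (nat \<bar>n t\<bar> * basis_index B) :: 'k)^2"
    using ex(2) by simp
  moreover have "(of_nat (nat \<bar>z\<bar>))^2 = (of_int z :: 'k)^2" for z by (cases "z \<ge> 0") auto
  ultimately have "(of_int m)^2 * (of_nat (basis_index B'))^2 = (of_int (n t))^2 * (of_nat (basis_index B) :: 'k)^2"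
    by (simp only: of_nat_mult power_mult_distrib)
  then have idx: "of_nat (basis_index B')^2 = (basis_coord B s t :: 'k)^2 * of_nat (basis_index B)^2"
    using rel(1) by (simp add: c power_divide field_simps)
  have "prod x B = x t * prod x (B - {t})" using lattice_basesD(2)[OF B] t by (rule prod.remove)
  moreover have "prod x B' = x s * prod x (B - {t})"
    unfolding B'_def using lattice_basesD(2)[OF B] s by (subst prod.insert) auto
  moreover have "x t \<noteq> 0" using x t lattice_basesD(1)[OF B] by auto
  ultimately have "prod x B' = prod x B * x s / x t" by simp
  then show "basis_weight x B' = basis_weight x B * x s / x t * (basis_coord B s t :: 'k) ^ 2"
    by (simp add: basis_weight_def idx)
qed

text \<open>Here \<open>\<psi>\<close> is a cycle and \<open>D e\<^sub>s - \<psi>\<close> is \<open>x\<close> times a coboundary.  A basis containing \<open>s\<close> expresses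
  \<open>\<psi> s\<close> through the values of \<open>\<psi>\<close> outside the basis, since the coordinates of a cycle vanish.  A basis
  avoiding \<open>s\<close> expresses \<open>(D - \<psi> s)/x\<^sub>s\<close> through the values of \<open>\<psi>\<close> on the basis, since a coboundary is
  determined linearly by its values there.  Summing with weights, the terms of the first kind
  indexed by \<open>(B \<ni> s, i)\<close> match those of the second kind indexed by \<open>(B - s + i, i)\<close>.\<close>

theorem basis_weight_sum_avoiding:
  fixes x \<psi> :: "'f \<Rightarrow> 'k::field_char_0"
  assumes s: "s \<in> F" and x: "\<And>i. i \<in> F \<Longrightarrow> x i \<noteq> 0"
    and cycle: "\<And>r. (\<Sum>i\<in>F. \<psi> i * of_int (Poly_Mapping.lookup (a i) r)) = 0"
    and coboundary: "\<And>i. i \<in> F \<Longrightarrow> (if i = s then D else 0) - \<psi> i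
        = x i * (\<Sum>r\<in>R. of_int (Poly_Mapping.lookup (a i) r) * y r)"
  shows "\<psi> s * (\<Sum>B\<in>lattice_bases a F. basis_weight x B)
       = D * (\<Sum>B\<in>{B \<in> lattice_bases a F. s \<notin> B}. basis_weight x B)"
proof -
  let ?\<B> = "lattice_bases a F"
  let ?w = "basis_weight x"
  let ?In = "{B \<in> ?\<B>. s \<in> B}" and ?Out = "{B \<in> ?\<B>. s \<notin> B}"
  have fin: "finite ?In" "finite ?Out" using finite_lattice_bases by auto
  have in_eq: "\<psi> s = - (\<Sum>i\<in>F - B. \<psi> i * basis_coord B i s)" if B: "B \<in> ?In" for B
  proof -
    have B': "B \<in> ?\<B>" and sB: "s \<in> B" using B by auto
    note BD = lattice_basesD[OF B']
    have "(\<Sum>j\<in>B. (\<Sum>i\<in>F. \<psi> i * basis_coord B i j) * of_int (Poly_Mapping.lookup (a j) r)) = 0" for r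
    proof -
      have "0 = (\<Sum>i\<in>F. \<psi> i * (\<Sum>j\<in>B. basis_coord B i j * of_int (Poly_Mapping.lookup (a j) r)))"
        using cycle[of r] by (simp flip: basis_coord_expand[OF B'] cong: sum.cong)
      also have "\<dots> = (\<Sum>j\<in>B. (\<Sum>i\<in>F. \<psi> i * basis_coord B i j) * of_int (Poly_Mapping.lookup (a j) r))"
        unfolding sum_distrib_left sum_distrib_right by (subst sum.swap) (simp add: mult.assoc)
      finally show ?thesis ..
    qed
    from int_indep_imp_field_indep[OF BD(2,3) this sB]
    have "0 = (\<Sum>i\<in>F. \<psi> i * basis_coord B i s)" by simp
    also have "\<dots> = (\<Sum>i\<in>F - B. \<psi> i * basis_coord B i s) + (\<Sum>i\<in>B. \<psi> i * basis_coord B i s)"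
      using finite_F BD(1) by (subst sum.subset_diff) auto
    also have "(\<Sum>i\<in>B. \<psi> i * basis_coord B i s) = (\<Sum>i\<in>B. if i = s then \<psi> i else 0)"
      using sB by (intro sum.cong refl) (auto simp: basis_coord_self[OF B'])
    also have "\<dots> = \<psi> s" using sB BD(2) by simp
    finally show ?thesis by (simp add: eq_neg_iff_add_eq_0 add.commute)
  qed
  have out_eq: "D - \<psi> s = - (\<Sum>j\<in>B. basis_coord B s j * \<psi> j * x s / x j)" if B: "B \<in> ?Out" for B
  proof -
    have B': "B \<in> ?\<B>" and sB: "s \<notin> B" using B by auto
    note BD = lattice_basesD[OF B']
    have pot: "(\<Sum>r\<in>R. of_int (Poly_Mapping.lookup (a j) r) * y r) = - \<psi> j / x j" if "j \<in> B" for j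
    proof -
      have "j \<in> F" "j \<noteq> s" using that BD sB by auto
      then show ?thesis using coboundary[of j] x[of j] by (simp add: field_simps)
    qed
    have "D - \<psi> s = x s * (\<Sum>r\<in>R. of_int (Poly_Mapping.lookup (a s) r) * y r)" using coboundary[OF s] by simp
    also have "(\<Sum>r\<in>R. of_int (Poly_Mapping.lookup (a s) r) * y r)
       = (\<Sum>j\<in>B. basis_coord B s j * (\<Sum>r\<in>R. of_int (Poly_Mapping.lookup (a j) r) * y r))"
      unfolding basis_coord_expand[OF B' s] sum_distrib_left sum_distrib_right
      by (subst sum.swap) (simp add: mult.assoc)
    also have "\<dots> = (\<Sum>j\<in>B. basis_coord B s j * (- \<psi> j / x j))" using pot by (intro sum.cong) auto
    finally show ?thesis by (simp add: sum_distrib_left sum_negf algebra_simps)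
  qed
  \<comment> \<open>The exchange is possible only where the coordinate does not vanish; the other pairs contribute nothing.\<close>
  let ?P = "{(B, j). B \<in> ?Out \<and> j \<in> B \<and> basis_coord B s j \<noteq> (0::'k)}"
  let ?Q = "{(B, i). B \<in> ?In \<and> i \<in> F - B \<and> basis_coord B i s \<noteq> (0::'k)}"
  have "(D - \<psi> s) * sum ?w ?Out = - (\<Sum>B\<in>?Out. \<Sum>j\<in>B. ?w B * basis_coord B s j * \<psi> j * x s / x j)"
    unfolding sum_distrib_left sum_negf[symmetric]
  proof (rule sum.cong[OF refl])
    fix B assume "B \<in> ?Out"
    then show "(D - \<psi> s) * ?w B = (\<Sum>j\<in>B. - (?w B * basis_coord B s j * \<psi> j * x s / x j))"
      unfolding out_eq[OF \<open>B \<in> ?Out\<close>] by (simp add: sum_distrib_left sum_negf mult_ac)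
  qed
  also have "(\<Sum>B\<in>?Out. \<Sum>j\<in>B. ?w B * basis_coord B s j * \<psi> j * x s / x j)
     = (\<Sum>(B, j)\<in>Sigma ?Out (\<lambda>B. B). ?w B * basis_coord B s j * \<psi> j * x s / x j)"
    using fin lattice_basesD(2) by (intro sum.Sigma) auto
  also have "\<dots> = (\<Sum>(B, j)\<in>?P. ?w B * basis_coord B s j * \<psi> j * x s / x j)"
    using fin lattice_basesD(2) by (intro sum.mono_neutral_right) auto
  also have "\<dots> = (\<Sum>(B, i)\<in>?Q. ?w B * \<psi> i * basis_coord B i s)"
  proof (rule sum.reindex_bij_witness[where i = "\<lambda>(B, j). (insert j (B - {s}), j)" and j = "\<lambda>(B, j). (insert s (B - {j}), j)"])
    fix p assume p: "p \<in> ?P"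
    then obtain B j where pj: "p = (B, j)" and B: "B \<in> ?\<B>" "s \<notin> B" "j \<in> B" "basis_coord B s j \<noteq> (0::'k)" by auto
    note ex = basis_weight_exchange[OF B(1) _ B(3,4) x] 
    have sFB: "s \<in> F - B" using s B by simp
    show "(\<lambda>(B, j). (insert j (B - {s}), j)) ((\<lambda>(B, j). (insert s (B - {j}), j)) p) = p"
      using B by (auto simp: pj)
    show "(\<lambda>(B, j). (insert s (B - {j}), j)) p \<in> ?Q"
      using ex(1,2)[OF sFB] B lattice_basesD(1)[OF B(1)] by (auto simp: pj)
    have "x j \<noteq> 0" using x B lattice_basesD(1)[OF B(1)] by auto
    then show "(case (\<lambda>(B, j). (insert s (B - {j}), j)) p of (B, i) \<Rightarrow> ?w B * \<psi> i * basis_coord B i s)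
        = (case p of (B, j) \<Rightarrow> ?w B * basis_coord B s j * \<psi> j * x s / x j)"
      using ex(2,3)[OF sFB] B(4) by (simp add: pj power2_eq_square)
  next
    fix p assume p: "p \<in> ?Q"
    then obtain B i where pi: "p = (B, i)" and B: "B \<in> ?\<B>" "i \<in> F - B" "s \<in> B" "basis_coord B i s \<noteq> (0::'k)" by auto
    note ex = basis_weight_exchange[OF B x]
    show "(\<lambda>(B, j). (insert s (B - {j}), j)) ((\<lambda>(B, j). (insert j (B - {s}), j)) p) = p"
      using B by (auto simp: pi)
    show "(\<lambda>(B, j). (insert j (B - {s}), j)) p \<in> ?P"
      using ex(1,2) B by (auto simp: pi)
  qed
  also have "\<dots> = (\<Sum>(B, i)\<in>Sigma ?In (\<lambda>B. F - B). ?w B * \<psi> i * basis_coord B i s)"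
    using fin finite_F by (intro sum.mono_neutral_left) auto
  also have "\<dots> = (\<Sum>B\<in>?In. \<Sum>i\<in>F - B. ?w B * \<psi> i * basis_coord B i s)"
    using fin finite_F by (intro sum.Sigma[symmetric]) auto
  also have "- \<dots> = (\<Sum>B\<in>?In. ?w B * (- (\<Sum>i\<in>F - B. \<psi> i * basis_coord B i s)))"
    by (simp add: sum_distrib_left sum_negf mult.assoc)
  also have "\<dots> = (\<Sum>B\<in>?In. ?w B * \<psi> s)"
    using in_eq by (intro sum.cong refl) auto
  also have "\<dots> = \<psi> s * sum ?w ?In" by (simp add: sum_distrib_left mult.commute)
  finally have *: "(D - \<psi> s) * sum ?w ?Out = \<psi> s * sum ?w ?In" .
  have "sum ?w ?\<B> = sum ?w (?In \<union> ?Out)" by (intro sum.cong) auto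
  also have "\<dots> = sum ?w ?In + sum ?w ?Out" using fin by (intro sum.union_disjoint) auto
  finally have "\<psi> s * sum ?w ?\<B> = \<psi> s * sum ?w ?In + \<psi> s * sum ?w ?Out" by (simp add: distrib_left)
  also have "\<dots> = D * sum ?w ?Out" unfolding *[symmetric] by (simp add: left_diff_distrib)
  finally show ?thesis .
qed

end

section \<open>Rank and torsion of quotients of free abelian groups\<close>

definition indep_mod :: "('r \<Rightarrow>\<^sub>0 int) set \<Rightarrow> ('r \<Rightarrow>\<^sub>0 int) set \<Rightarrow> bool" where
  "indep_mod B I \<longleftrightarrow> finite I \<and> (\<forall>c. int_comb (\<lambda>z. z) I c \<in> B \<longrightarrow> (\<forall>z\<in>I. c z = 0))"

text \<open>The rank of \<open>Z/B\<close> computed with representatives in \<open>Z\<close> instead of cosets.\<close>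

definition rank_mod :: "('r \<Rightarrow>\<^sub>0 int) set \<Rightarrow> ('r \<Rightarrow>\<^sub>0 int) set \<Rightarrow> nat" where
  "rank_mod Z B = Sup {card I | I. I \<subseteq> Z \<and> indep_mod B I}"

lemma indep_modD:
  "indep_mod B I \<Longrightarrow> int_comb (\<lambda>z. z) I c \<in> B \<Longrightarrow> z \<in> I \<Longrightarrow> c z = 0"
  by (auto simp: indep_mod_def)

lemma indep_mod_antimono: "B \<subseteq> M \<Longrightarrow> indep_mod M I \<Longrightarrow> indep_mod B I"
  by (auto simp: indep_mod_def)

lemma indep_mod_card_le:
  assumes S: "finite S" and Z: "\<And>z. z \<in> Z \<Longrightarrow> Poly_Mapping.keys z \<subseteq> S"
    and B: "0 \<in> B" and I: "I \<subseteq> Z" "indep_mod B I"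
  shows "card I \<le> card S"
proof (rule ccontr)
  assume "\<not> card I \<le> card S"
  then have "\<not> int_indep (\<lambda>z. z) I"
    using I Z by (intro int_dependent_of_card_less[OF S]) (auto simp: indep_mod_def)
  then show False using I B by (auto simp: int_indep_def indep_mod_def)
qed

text \<open>The supremum that defines the rank is a maximum because ranks are bounded by the number of coordinates.\<close>

lemma rank_mod_attained:
  assumes S: "finite S" and Z: "\<And>z. z \<in> Z \<Longrightarrow> Poly_Mapping.keys z \<subseteq> S" and B: "0 \<in> B"
  shows "\<exists>I. I \<subseteq> Z \<and> indep_mod B I \<and> card I = rank_mod Z B"
    and "\<And>I. I \<subseteq> Z \<Longrightarrow> indep_mod B I \<Longrightarrow> card I \<le> rank_mod Z B"
proof -
  let ?N = "{card I | I. I \<subseteq> Z \<and> indep_mod B I}"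
  have "?N \<subseteq> {..card S}" using indep_mod_card_le[where B = B, OF S Z B] by auto
  then have fin: "finite ?N" by (rule finite_subset) simp
  have "indep_mod B {}" by (simp add: indep_mod_def)
  then have ne: "?N \<noteq> {}" by blast
  then have R: "rank_mod Z B = Max ?N" unfolding rank_mod_def Sup_nat_def by (simp only: if_False)
  have "rank_mod Z B \<in> ?N" unfolding R by (rule Max_in[OF fin ne])
  then show "\<exists>I. I \<subseteq> Z \<and> indep_mod B I \<and> card I = rank_mod Z B" by auto
  show "card I \<le> rank_mod Z B" if "I \<subseteq> Z" "indep_mod B I" for I
    unfolding R using that by (intro Max_ge[OF fin]) auto
qed

lemma rank_mod_zero_iff:
  assumes S: "finite S" and Z: "\<And>z. z \<in> Z \<Longrightarrow> Poly_Mapping.keys z \<subseteq> S"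
  shows "rank_mod Z {0} = 0 \<longleftrightarrow> Z \<subseteq> {0}"
proof
  assume r: "rank_mod Z {0} = 0"
  show "Z \<subseteq> {0}"
  proof
    fix z assume z: "z \<in> Z"
    show "z \<in> {0}"
    proof (rule ccontr)
      assume "z \<notin> {0}"
      then have "indep_mod {0} {z}" by (simp add: indep_mod_def int_comb_def)
      then have "card {z} \<le> rank_mod Z {0}" using z by (intro rank_mod_attained(2)[OF S Z]) auto
      with r show False by simp
    qed
  qed
next
  assume Z0: "Z \<subseteq> {0}"
  obtain I where I: "I \<subseteq> Z" "indep_mod {0} I" "card I = rank_mod Z {0}"
    using rank_mod_attained(1)[where B = "{0}", OF S Z] by auto
  have "0 \<notin> I"
  proof
    assume "0 \<in> I"
    with I(1) Z0 have "I = {0}" by auto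
    then show False using indep_modD[OF I(2), of "\<lambda>_. 1" 0] by (simp add: int_comb_def)
  qed
  then have "I = {}" using I Z0 by auto
  then show "rank_mod Z {0} = 0" using I by simp
qed

text \<open>Passing from \<open>Z/B\<close> to the smaller quotient \<open>Z/M\<close> keeps the rank exactly when \<open>M/B\<close> is torsion: an
  element of \<open>M\<close> of infinite order modulo \<open>B\<close> could be added to a maximal independent set for \<open>M\<close>.\<close>

lemma rank_mod_eq_iff:
  assumes S: "finite S" and Z: "\<And>z. z \<in> Z \<Longrightarrow> Poly_Mapping.keys z \<subseteq> S"
    and sub: "frag_subgroup M" "B \<subseteq> M" "M \<subseteq> Z" "frag_subgroup B"
  shows "rank_mod Z B = rank_mod Z M \<longleftrightarrow> M \<subseteq> saturation Z B"
proof
  assume M: "M \<subseteq> saturation Z B"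
  have "indep_mod B I = indep_mod M I" for I
  proof
    assume I: "indep_mod B I"
    show "indep_mod M I" unfolding indep_mod_def
    proof (intro conjI allI impI ballI)
      show "finite I" using I by (simp add: indep_mod_def)
      fix c z assume c: "int_comb (\<lambda>z. z) I c \<in> M" and z: "z \<in> I"
      then obtain m where m: "m \<noteq> 0" "frag_cmul m (int_comb (\<lambda>z. z) I c) \<in> B"
        using M by (auto simp: saturation_def)
      then show "c z = 0" using indep_modD[OF I, of "\<lambda>i. m * c i" z] z by (simp add: int_comb_cmul)
    qed
  qed (use sub in \<open>auto intro: indep_mod_antimono\<close>)
  then show "rank_mod Z B = rank_mod Z M" by (simp add: rank_mod_def)
next
  assume eq: "rank_mod Z B = rank_mod Z M"
  show "M \<subseteq> saturation Z B"
  proof (rule ccontr)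
    assume "\<not> M \<subseteq> saturation Z B"
    then obtain g where "g \<in> M" "g \<notin> saturation Z B" by blast
    then have g: "g \<in> M" "g \<in> Z" "\<And>m. frag_cmul m g \<in> B \<Longrightarrow> m = 0"
      using sub unfolding saturation_def by blast+
    obtain I where I: "I \<subseteq> Z" "indep_mod M I" "card I = rank_mod Z M"
      using rank_mod_attained(1)[where B = M, OF S Z] frag_subgroup_0[OF sub(1)] by blast
    have finI: "finite I" using I by (simp add: indep_mod_def)
    have gI: "g \<notin> I"
    proof
      assume "g \<in> I"
      then have "int_comb (\<lambda>z. z) I (\<lambda>z. if z = g then 1 else 0) = g"
        using finI by (simp add: int_comb_remove[of I g]) (simp add: int_comb_def)
      with indep_modD[OF I(2) _ \<open>g \<in> I\<close>, of "\<lambda>z. if z = g then 1 else 0"] g show False by simp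
    qed
    have "indep_mod B (insert g I)" unfolding indep_mod_def
    proof (intro conjI allI impI)
      show "finite (insert g I)" using finI by simp
      fix c assume "int_comb (\<lambda>z. z) (insert g I) c \<in> B"
      then have c: "frag_cmul (c g) g + int_comb (\<lambda>z. z) I c \<in> B" using finI gI by (simp add: int_comb_insert)
      have "(frag_cmul (c g) g + int_comb (\<lambda>z. z) I c) - frag_cmul (c g) g \<in> M"
        using c sub g by (intro frag_subgroup_diff frag_subgroup_cmul) auto
      then have cI: "\<forall>z\<in>I. c z = 0" using indep_modD[OF I(2)] by simp
      then have "int_comb (\<lambda>z. z) I c = 0" by (simp add: int_comb_def)
      with c g cI show "\<forall>z\<in>insert g I. c z = 0" by auto
    qed
    then have "card (insert g I) \<le> rank_mod Z B"
      using g I sub by (intro rank_mod_attained(2)[OF S Z]) (auto simp: frag_subgroup_0)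
    then show False using eq I finI gI by simp
  qed
qed

text \<open>The quotient group in the form in which homology groups are given.\<close>

locale frag_quotient =
  fixes S :: "'r set" and Z B :: "('r \<Rightarrow>\<^sub>0 int) set"
  assumes Z_keys: "\<And>z. z \<in> Z \<Longrightarrow> Poly_Mapping.keys z \<subseteq> S"
    and Z: "frag_subgroup Z" and B: "frag_subgroup B" and B_Z: "B \<subseteq> Z"
begin

abbreviation "G \<equiv> subgroup_generated (free_Abelian_group S) Z"
abbreviation "Q \<equiv> G Mod B"

lemma subgroup_of_free: 
  assumes "frag_subgroup H" "H \<subseteq> Z" shows "subgroup H (free_Abelian_group S)"
proof
  show "H \<subseteq> carrier (free_Abelian_group S)" using Z_keys assms by auto
  fix x assume x: "x \<in> H"
  then have "Poly_Mapping.keys x \<subseteq> S" using Z_keys assms by auto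
  then show "inv\<^bsub>free_Abelian_group S\<^esub> x \<in> H" using frag_subgroup_minus[OF assms(1) x] by simp
qed (use assms in \<open>auto simp: frag_subgroup_0 frag_subgroup_add\<close>)

lemma carrier_G: "carrier G = Z"
  using subgroup.carrier_subgroup_generated_subgroup[OF subgroup_of_free[OF Z]] by simp

lemma comm_group_G: "comm_group G"
  by (intro group.abelian_subgroup_generated abelian_free_Abelian_group group_free_Abelian_group)

lemma subgroup_B: "subgroup B G"
  using subgroup_of_free[OF B B_Z] B_Z carrier_G
  by (simp add: group.subgroup_subgroup_generated_iff[OF group_free_Abelian_group])

sublocale normal B G
  using comm_group.subgroup_imp_normal[OF comm_group_G subgroup_B] .

lemma comm_group_Q: "comm_group Q"
  using comm_group.abelian_FactGroup[OF comm_group_G subgroup_B] .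

lemma r_coset_G: "B #>\<^bsub>G\<^esub> x = frag_coset B x"
  by (auto simp: r_coset_def frag_coset_def)

lemma carrier_Q: "carrier Q = frag_coset B ` Z"
  by (simp add: carrier_FactGroup carrier_G r_coset_G)

lemma mult_Q: "x \<in> Z \<Longrightarrow> y \<in> Z \<Longrightarrow> frag_coset B x \<otimes>\<^bsub>Q\<^esub> frag_coset B y = frag_coset B (x + y)"
  using rcos_sum[of x y] by (simp add: carrier_G r_coset_G)

lemma pow_G: "x \<in> Z \<Longrightarrow> x [^]\<^bsub>G\<^esub> (k::int) = frag_cmul k x"
  using group.int_pow_subgroup_generated[OF group_free_Abelian_group, of x S Z k] Z_keys[of x]
  by (simp add: carrier_G)

lemma int_pow_Q: "x \<in> Z \<Longrightarrow> frag_coset B x [^]\<^bsub>Q\<^esub> (k::int) = frag_coset B (frag_cmul k x)"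
  using FactGroup_int_pow[of x k] by (simp add: carrier_G r_coset_G pow_G)

lemma nat_pow_Q: "x \<in> Z \<Longrightarrow> frag_coset B x [^]\<^bsub>Q\<^esub> (k::nat) = frag_coset B (frag_cmul (int k) x)"
  using int_pow_Q[of x "int k"] by (simp add: int_pow_int)

lemma frag_coset_eq_B_iff: "frag_coset B x = B \<longleftrightarrow> x \<in> B"
  using frag_coset_eq_iff[OF B, of x 0] by (simp add: frag_coset_def)

lemma finprod_Q:
  assumes "finite I" "\<And>C. C \<in> I \<Longrightarrow> rep C \<in> Z \<and> frag_coset B (rep C) = C"
  shows "finprod Q (\<lambda>C. C [^]\<^bsub>Q\<^esub> (c C :: int)) I = frag_coset B (int_comb rep I c)"
  using assms
proof (induction I rule: finite_induct)
  case empty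
  interpret Q: comm_group Q by (rule comm_group_Q)
  show ?case using frag_coset_eq_B_iff[of 0] frag_subgroup_0[OF B] by (simp add: int_comb_def)
next
  case (insert C I)
  interpret Q: comm_group Q by (rule comm_group_Q)
  have Cin: "D \<in> carrier Q" if "D \<in> insert C I" for D
    using insert.prems[OF that] unfolding carrier_Q by (metis imageI)
  have "finprod Q (\<lambda>C. C [^]\<^bsub>Q\<^esub> c C) (insert C I)
     = C [^]\<^bsub>Q\<^esub> c C \<otimes>\<^bsub>Q\<^esub> finprod Q (\<lambda>C. C [^]\<^bsub>Q\<^esub> c C) I"
    using insert.hyps Cin by (intro Q.finprod_insert) auto
  also have "finprod Q (\<lambda>C. C [^]\<^bsub>Q\<^esub> c C) I = frag_coset B (int_comb rep I c)"
    using insert by simp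
  also have "C [^]\<^bsub>Q\<^esub> c C = frag_coset B (frag_cmul (c C) (rep C))"
    using int_pow_Q[of "rep C" "c C"] insert.prems by simp
  also have "frag_coset B (frag_cmul (c C) (rep C)) \<otimes>\<^bsub>Q\<^esub> frag_coset B (int_comb rep I c)
     = frag_coset B (frag_cmul (c C) (rep C) + int_comb rep I c)"
    unfolding int_comb_def
    by (intro mult_Q frag_subgroup_cmul[OF Z] frag_subgroup_sum[OF Z]) (use insert.prems in auto)
  finally show ?case using insert.hyps by (simp add: int_comb_insert)
qed

text \<open>Choosing representatives turns an independent set of cosets into a set independent modulo \<open>B\<close>, and
  conversely distinct elements of a set independent modulo \<open>B\<close> lie in distinct cosets.\<close>

lemma ab_rank_Q: "ab_rank Q = rank_mod Z B"
proof -
  define rep where "rep C = (SOME x. x \<in> Z \<and> frag_coset B x = C)" for C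
  have rep: "rep C \<in> Z \<and> frag_coset B (rep C) = C" if "C \<in> frag_coset B ` Z" for C
    unfolding rep_def by (rule someI_ex) (use that in blast)
  have comb: "int_independent Q I \<longleftrightarrow> finite I \<and> I \<subseteq> frag_coset B ` Z 
      \<and> (\<forall>c. int_comb r I c \<in> B \<longrightarrow> (\<forall>C\<in>I. c C = 0))"
    if r: "\<And>C. C \<in> I \<Longrightarrow> r C \<in> Z \<and> frag_coset B (r C) = C" for I r
    using finprod_Q[of I r, OF _ r] unfolding int_independent_def carrier_Q
    by (auto simp: frag_coset_eq_B_iff)
  have "{card I | I. int_independent Q I} = {card I | I. I \<subseteq> Z \<and> indep_mod B I}"
  proof (intro equalityI subsetI)
    fix n assume "n \<in> {card I | I. int_independent Q I}"
    then obtain I where n: "n = card I" and I: "int_independent Q I" by blast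
    have sub: "I \<subseteq> frag_coset B ` Z" "finite I" using I unfolding int_independent_def carrier_Q by auto
    have "rep C \<in> Z \<and> frag_coset B (rep C) = C" if "C \<in> I" for C using rep that sub by blast
    from iffD1[OF comb[of I rep, OF this] I]
    have key: "\<forall>C\<in>I. c C = 0" if "int_comb rep I c \<in> B" for c using that by simp
    have inj: "inj_on rep I" by (rule inj_on_inverseI[of _ "frag_coset B"]) (use rep sub in blast)
    have "indep_mod B (rep ` I)" unfolding indep_mod_def
    proof (intro conjI allI impI)
      show "finite (rep ` I)" using sub by simp
      fix c assume "int_comb (\<lambda>z. z) (rep ` I) c \<in> B"
      also have "int_comb (\<lambda>z. z) (rep ` I) c = int_comb rep I (c \<circ> rep)"
        using inj by (simp add: int_comb_def sum.reindex)
      finally have "int_comb rep I (c \<circ> rep) \<in> B" .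
      then have "\<forall>C\<in>I. (c \<circ> rep) C = 0" using key[of "c \<circ> rep"] by simp
      then show "\<forall>z\<in>rep ` I. c z = 0" by simp
    qed
    moreover have "rep ` I \<subseteq> Z" using rep sub by auto
    moreover have "card (rep ` I) = n" using inj n by (simp add: card_image)
    ultimately show "n \<in> {card I | I. I \<subseteq> Z \<and> indep_mod B I}" by blast
  next
    fix n assume "n \<in> {card I | I. I \<subseteq> Z \<and> indep_mod B I}"
    then obtain I where n: "n = card I" and I: "I \<subseteq> Z" "indep_mod B I" by blast
    have finI: "finite I" using I by (simp add: indep_mod_def)
    have inj: "inj_on (frag_coset B) I"
    proof (rule inj_onI, rule ccontr)
      fix x y assume xy: "x \<in> I" "y \<in> I" "frag_coset B x = frag_coset B y" "x \<noteq> y"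
      let ?c = "\<lambda>z. if z = x then 1 else if z = y then - 1 else (0::int)"
      have "int_comb (\<lambda>z. z) I ?c = x + int_comb (\<lambda>z. z) (I - {x}) ?c"
        using xy finI by (simp add: int_comb_remove[of I x])
      also have "int_comb (\<lambda>z. z) (I - {x}) ?c = - y"
        using xy finI by (simp add: int_comb_remove[of "I - {x}" y]) (simp add: int_comb_def)
      finally have "int_comb (\<lambda>z. z) I ?c \<in> B" using xy frag_coset_eq_iff[OF B] by simp
      from indep_modD[OF I(2) this xy(1)] show False by simp
    qed
    let ?r = "the_inv_into I (frag_coset B)"
    have r: "?r C \<in> Z \<and> frag_coset B (?r C) = C" if "C \<in> frag_coset B ` I" for C
      using that I inj by (auto simp: the_inv_into_f_f)
    have "int_independent Q (frag_coset B ` I)"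
    proof (intro iffD2[OF comb[of "frag_coset B ` I" ?r, OF r]] conjI allI impI)
      fix c assume "int_comb ?r (frag_coset B ` I) c \<in> B"
      also have "int_comb ?r (frag_coset B ` I) c = int_comb (\<lambda>z. z) I (c \<circ> frag_coset B)"
        using inj by (simp add: int_comb_def sum.reindex the_inv_into_f_f)
      finally show "\<forall>C\<in>frag_coset B ` I. c C = 0"
        using indep_modD[OF I(2), of "c \<circ> frag_coset B"] by simp
    qed (use finI I in auto)
    moreover have "card (frag_coset B ` I) = n" using inj n by (simp add: card_image)
    ultimately show "n \<in> {card I | I. int_independent Q I}" by blast
  qed
  then show ?thesis by (simp add: ab_rank_def rank_mod_def)
qed

lemma card_torsion_Q: "card (torsion_elements Q) = coset_index (saturation Z B) B"
proof -
  have "torsion_elements Q = frag_coset B ` saturation Z B"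
  proof (intro equalityI subsetI)
    fix C assume "C \<in> torsion_elements Q"
    then obtain x m where x: "x \<in> Z" "C = frag_coset B x" "0 < m" "C [^]\<^bsub>Q\<^esub> (m::nat) = B"
      by (auto simp: torsion_elements_def carrier_Q)
    then have "frag_cmul (int m) x \<in> B" by (simp add: nat_pow_Q frag_coset_eq_B_iff)
    moreover have "int m \<noteq> 0" using x by simp
    ultimately have "x \<in> saturation Z B" using x(1) unfolding saturation_def by blast
    then show "C \<in> frag_coset B ` saturation Z B" unfolding x(2) by (rule imageI)
  next
    fix C assume "C \<in> frag_coset B ` saturation Z B"
    then obtain x m where x: "x \<in> Z" "C = frag_coset B x" "m \<noteq> 0" "frag_cmul m x \<in> B"
      by (auto simp: saturation_def)
    have "frag_cmul (int (nat \<bar>m\<bar>)) x \<in> B"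
      using x frag_subgroup_minus[OF B, of "frag_cmul m x"] by (cases "m \<ge> 0") auto
    then have "C [^]\<^bsub>Q\<^esub> (nat \<bar>m\<bar>) = B" unfolding x(2) nat_pow_Q[OF x(1)] frag_coset_eq_B_iff .
    moreover have "nat \<bar>m\<bar> > 0" using x by simp
    moreover have "C \<in> carrier Q" unfolding carrier_Q x(2) using x(1) by (rule imageI)
    ultimately show "C \<in> torsion_elements Q"
      unfolding torsion_elements_def one_FactGroup by blast
  qed
  then show ?thesis by (simp add: coset_index_def)
qed

end

section \<open>Simplicial chains\<close>

abbreviation bd :: "nat set \<Rightarrow> nat set \<Rightarrow>\<^sub>0 int" where
  "bd \<tau> \<equiv> simplicial_boundary (frag_of \<tau>)"

text \<open>The incidence number of \<open>\<tau>\<close> and \<open>\<tau> - {v}\<close>, in an arbitrary ring.\<close>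

definition pos_sign :: "nat set \<Rightarrow> nat \<Rightarrow> 'a::ring_1" where
  "pos_sign \<tau> v = (- 1) ^ card {u \<in> \<tau>. u < v}"

lemma of_int_pos_sign [simp]: "of_int (pos_sign \<tau> v) = pos_sign \<tau> v"
  by (simp add: pos_sign_def)

lemma pos_sign_insert_self: "pos_sign (insert v \<tau>) v = pos_sign \<tau> v"
  unfolding pos_sign_def by (rule arg_cong[of _ _ "\<lambda>S. (-1) ^ card S"]) auto

lemma bd_eq: "bd \<tau> = (\<Sum>v\<in>\<tau>. frag_cmul (pos_sign \<tau> v) (frag_of (\<tau> - {v})))"
  by (simp add: simplicial_boundary_def pos_sign_def)

lemma lookup_bd: "Poly_Mapping.lookup (bd \<tau>) \<rho> = (\<Sum>v\<in>\<tau>. if \<rho> = \<tau> - {v} then pos_sign \<tau> v else 0)"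
  by (simp add: bd_eq lookup_sum if_distrib[of "(*) _"] cong: if_cong)

lemma lookup_bd_facet:
  assumes "finite \<tau>" "v \<in> \<tau>" shows "Poly_Mapping.lookup (bd \<tau>) (\<tau> - {v}) = pos_sign \<tau> v"
proof -
  have "(\<Sum>u\<in>\<tau>. if \<tau> - {v} = \<tau> - {u} then pos_sign \<tau> u else 0) = (\<Sum>u\<in>\<tau>. if u = v then pos_sign \<tau> v else (0::int))"
    using assms by (intro sum.cong refl) auto
  then show ?thesis using assms by (simp add: lookup_bd)
qed

lemma simplicial_boundary_eq_comb:
  assumes "finite S" "Poly_Mapping.keys c \<subseteq> S"
  shows "simplicial_boundary c = int_comb bd S (Poly_Mapping.lookup c)"
proof -
  have "simplicial_boundary c = int_comb bd (Poly_Mapping.keys c) (Poly_Mapping.lookup c)"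
    unfolding simplicial_boundary_def int_comb_def by (subst frag_extend_def) simp
  also have "\<dots> = int_comb bd S (Poly_Mapping.lookup c)"
    unfolding int_comb_def using assms
    by (intro sum.mono_neutral_left) (auto simp: in_keys_iff)
  finally show ?thesis .
qed

lemma simplicial_boundary_diff: "simplicial_boundary (a - b) = simplicial_boundary a - simplicial_boundary b"
  unfolding simplicial_boundary_def by (rule frag_extend_diff)

lemma simplicial_boundary_add: "simplicial_boundary (a + b) = simplicial_boundary a + simplicial_boundary b"
  unfolding simplicial_boundary_def by (rule frag_extend_add)

lemma simplicial_boundary_cmul: "simplicial_boundary (frag_cmul k a) = frag_cmul k (simplicial_boundary a)"
  unfolding simplicial_boundary_def by (rule frag_extend_cmul)

lemma simplicial_boundary_0: "simplicial_boundary 0 = 0"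
  by (simp add: simplicial_boundary_def)

lemma simplicial_boundary_sum:
  "simplicial_boundary (\<Sum>i\<in>I. f i) = (\<Sum>i\<in>I. simplicial_boundary (f i))"
  by (induction I rule: infinite_finite_induct) (simp_all add: simplicial_boundary_0 simplicial_boundary_add)

lemma pos_sign_swap:
  assumes "finite \<tau>" "u \<in> \<tau>" "v \<in> \<tau>" "u \<noteq> v"
  shows "pos_sign \<tau> v * pos_sign (\<tau> - {v}) u = - (pos_sign \<tau> u * pos_sign (\<tau> - {u}) v :: int)"
proof -
  have *: "pos_sign \<tau> v * pos_sign (\<tau> - {v}) u = - (pos_sign \<tau> u * pos_sign (\<tau> - {u}) v :: int)"
    if uv: "u < v" "u \<in> \<tau>" for u v
  proof -
    have "{w \<in> \<tau> - {v}. w < u} = {w \<in> \<tau>. w < u}" using uv by auto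
    moreover have "{w \<in> \<tau>. w < v} = insert u {w \<in> \<tau> - {u}. w < v}" using uv by auto
    then have "card {w \<in> \<tau>. w < v} = Suc (card {w \<in> \<tau> - {u}. w < v})"
      using assms(1) by (simp only: ) (subst card_insert_disjoint, auto)
    ultimately show ?thesis by (simp add: pos_sign_def)
  qed
  show ?thesis using *[of u v] *[of v u] assms by (cases "u < v") auto
qed

text \<open>Exchanging the order in which two vertices are deleted changes the sign of the term, so the double
  sum equals its own negative.\<close>

lemma boundary_of_boundary_simplex:
  assumes fin: "finite \<tau>" shows "simplicial_boundary (bd \<tau>) = 0"
proof -
  define f where "f = (\<lambda>(v, u). frag_cmul (pos_sign \<tau> v * pos_sign (\<tau> - {v}) u) (frag_of (\<tau> - {v, u})))"
  let ?P = "Sigma \<tau> (\<lambda>v. \<tau> - {v})"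
  have "simplicial_boundary (bd \<tau>) = (\<Sum>v\<in>\<tau>. \<Sum>u\<in>\<tau> - {v}. f (v, u))"
    by (subst bd_eq) (simp add: simplicial_boundary_sum simplicial_boundary_cmul bd_eq frag_cmul_sum f_def
      insert_commute Diff_insert2[symmetric])
  also have "\<dots> = sum f ?P" using fin by (subst sum.Sigma) auto
  finally have 1: "simplicial_boundary (bd \<tau>) = sum f ?P" .
  have "sum f ?P = (\<Sum>p\<in>?P. f (prod.swap p))"
    by (rule sum.reindex_bij_witness[of _ prod.swap prod.swap]) auto
  also have "\<dots> = (\<Sum>p\<in>?P. - f p)"
  proof (rule sum.cong[OF refl])
    fix p assume "p \<in> ?P"
    then obtain v u where "p = (v, u)" "v \<in> \<tau>" "u \<in> \<tau>" "u \<noteq> v" by auto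
    then show "f (prod.swap p) = - f p"
      using pos_sign_swap[OF fin, of u v] by (simp add: f_def insert_commute)
  qed
  finally have "sum f ?P = - sum f ?P" by (simp add: sum_negf)
  then have "Poly_Mapping.lookup (sum f ?P) r = - Poly_Mapping.lookup (sum f ?P) r" for r
    by (metis lookup_uminus)
  then have "sum f ?P = 0" by (intro poly_mapping_eqI) (simp add: eq_neg_iff_add_eq_0)
  with 1 show ?thesis by simp
qed

lemma keys_bd: "Poly_Mapping.keys (bd \<tau>) \<subseteq> (\<lambda>v. \<tau> - {v}) ` \<tau>"
  unfolding bd_eq by (rule order_trans[OF keys_sum]) auto

text \<open>Expand the boundary of the boundary of \<open>insert v0 \<tau>\<close>, which vanishes.\<close>

lemma bd_eq_comb_cone:
  assumes fin: "finite \<tau>" and v0: "\<And>u. u \<in> \<tau> \<Longrightarrow> v0 < u"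
  shows "bd \<tau> = (\<Sum>v\<in>\<tau>. frag_cmul (pos_sign \<tau> v) (bd (insert v0 (\<tau> - {v}))))"
proof -
  have nin: "v0 \<notin> \<tau>" using v0 by blast
  have "{u \<in> insert v0 \<tau>. u < v0} = {}" using v0 by force
  then have s0: "pos_sign (insert v0 \<tau>) v0 = (1::int)" by (simp only: pos_sign_def card.empty power_0)
  have s: "pos_sign (insert v0 \<tau>) v = - (pos_sign \<tau> v :: int)" if "v \<in> \<tau>" for v
  proof -
    have "{u \<in> insert v0 \<tau>. u < v} = insert v0 {u \<in> \<tau>. u < v}" using v0 that by auto
    then show ?thesis using nin fin by (simp add: pos_sign_def)
  qed
  have "bd (insert v0 \<tau>) = frag_of \<tau> + (\<Sum>v\<in>\<tau>. frag_cmul (- pos_sign \<tau> v) (frag_of (insert v0 (\<tau> - {v}))))"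
    unfolding bd_eq[of "insert v0 \<tau>"] using fin nin v0
    by (subst sum.insert) (auto simp: s0 s insert_Diff_if intro!: sum.cong)
  then have "0 = bd \<tau> + (\<Sum>v\<in>\<tau>. frag_cmul (- pos_sign \<tau> v) (bd (insert v0 (\<tau> - {v}))))"
    using boundary_of_boundary_simplex[of "insert v0 \<tau>"] fin
    by (simp add: simplicial_boundary_add simplicial_boundary_sum simplicial_boundary_cmul del: minus_frag_cmul)
  then have "bd \<tau> = - (\<Sum>v\<in>\<tau>. frag_cmul (- pos_sign \<tau> v) (bd (insert v0 (\<tau> - {v}))))"
    by (simp add: eq_neg_iff_add_eq_0)
  then show ?thesis by (simp flip: sum_negf)
qed

section \<open>Homology of a finite complex\<close>

lemma mem_faces: "\<tau> \<in> faces (int d) K \<longleftrightarrow> \<tau> \<in> K \<and> card \<tau> = d + 1"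
  by (auto simp: faces_def face_dim_def)

lemma simplicial_complexD:
  assumes "simplicial_complex K" "\<tau> \<in> K" 
  shows "finite \<tau>" "\<rho> \<subseteq> \<tau> \<Longrightarrow> \<rho> \<in> K"
  using assms by (auto simp: simplicial_complex_def)

lemma keys_bd_faces:
  assumes K: "simplicial_complex K" and \<tau>: "\<tau> \<in> faces (i + 1) K"
  shows "Poly_Mapping.keys (bd \<tau>) \<subseteq> faces i K"
proof
  fix \<rho> assume "\<rho> \<in> Poly_Mapping.keys (bd \<tau>)"
  then obtain v where v: "v \<in> \<tau>" "\<rho> = \<tau> - {v}" using keys_bd by blast
  have "\<tau> \<in> K" "int (card \<tau>) = i + 2" using \<tau> by (auto simp: faces_def face_dim_def)
  moreover have "card \<rho> = card \<tau> - 1" "card \<tau> > 0"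
    using v simplicial_complexD(1)[OF K \<open>\<tau> \<in> K\<close>] by (auto simp: card_gt_0_iff)
  ultimately show "\<rho> \<in> faces i K"
    using v simplicial_complexD(2)[OF K \<open>\<tau> \<in> K\<close>, of \<rho>] by (auto simp: faces_def face_dim_def)
qed

lemma simplicial_cycles_eq:
  "simplicial_cycles i K = {c. Poly_Mapping.keys c \<subseteq> faces i K \<and> simplicial_boundary c = 0}"
  by (auto simp: simplicial_cycles_def kernel_def simplicial_chain_group_def)

lemma simplicial_boundaries_eq:
  assumes fin: "finite (faces (i + 1) K)"
  shows "simplicial_boundaries i K = int_span bd (faces (i + 1) K)"
proof (intro equalityI subsetI)
  fix z assume "z \<in> simplicial_boundaries i K"
  then obtain c where "Poly_Mapping.keys c \<subseteq> faces (i + 1) K" "z = simplicial_boundary c"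
    by (auto simp: simplicial_boundaries_def simplicial_chain_group_def)
  then show "z \<in> int_span bd (faces (i + 1) K)"
    using simplicial_boundary_eq_comb[OF fin] by (auto simp: int_span_def)
next
  fix z assume "z \<in> int_span bd (faces (i + 1) K)"
  then obtain c where z: "z = int_comb bd (faces (i + 1) K) c" by (auto simp: int_span_def)
  let ?c = "\<Sum>\<tau>\<in>faces (i + 1) K. frag_cmul (c \<tau>) (frag_of \<tau>)"
  have "simplicial_boundary ?c = z"
    unfolding z int_comb_def by (simp add: simplicial_boundary_sum simplicial_boundary_cmul)
  moreover have "Poly_Mapping.keys ?c \<subseteq> faces (i + 1) K"
    by (rule order_trans[OF keys_sum]) auto
  ultimately show "z \<in> simplicial_boundaries i K"
    by (auto simp: simplicial_boundaries_def simplicial_chain_group_def)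
qed

lemma frag_subgroup_cycles: "frag_subgroup (simplicial_cycles i K)"
  unfolding frag_subgroup_def simplicial_cycles_eq
  using keys_diff by (fastforce simp: simplicial_boundary_0 simplicial_boundary_diff)

lemma finite_faces: "finite K \<Longrightarrow> finite (faces i K)"
  by (simp add: faces_def)

lemma bd_in_cycles:
  assumes "simplicial_complex K" "\<tau> \<in> faces (i + 1) K" shows "bd \<tau> \<in> simplicial_cycles i K"
  using keys_bd_faces[OF assms] boundary_of_boundary_simplex[of \<tau>] simplicial_complexD(1)[OF assms(1), of \<tau>] assms(2)
  by (auto simp: simplicial_cycles_eq faces_def)

text \<open>By \<open>\<partial>\<partial> = 0\<close> boundaries are cycles, without which the quotient would not be a group.\<close>

lemma homology_quotient:
  assumes K: "simplicial_complex K" and fin: "finite K"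
  shows "frag_quotient (faces i K) (simplicial_cycles i K) (simplicial_boundaries i K)"
proof
  have eq: "simplicial_boundaries i K = int_span bd (faces (i + 1) K)"
    using finite_faces[OF fin] by (rule simplicial_boundaries_eq)
  show "frag_subgroup (simplicial_boundaries i K)" unfolding eq by (rule frag_subgroup_int_span)
  show "simplicial_boundaries i K \<subseteq> simplicial_cycles i K"
    unfolding eq by (intro int_span_subset frag_subgroup_cycles bd_in_cycles[OF K])
qed (auto simp: simplicial_cycles_eq frag_subgroup_cycles[unfolded simplicial_cycles_eq])

lemma betti_eq_rank_mod:
  assumes "simplicial_complex K" "finite K"
  shows "betti i K = rank_mod (simplicial_cycles i K) (simplicial_boundaries i K)"
  unfolding betti_def reduced_homology_group_def simplicial_chain_group_def
  by (rule frag_quotient.ab_rank_Q[OF homology_quotient[OF assms]])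

lemma torsion_order_eq_index:
  assumes "simplicial_complex K" "finite K"
  shows "torsion_order i K
     = coset_index (saturation (simplicial_cycles i K) (simplicial_boundaries i K)) (simplicial_boundaries i K)"
  unfolding torsion_order_def reduced_homology_group_def simplicial_chain_group_def
  by (rule frag_quotient.card_torsion_Q[OF homology_quotient[OF assms]])

section \<open>Spanning trees as lattice bases\<close>

locale finite_complex =
  fixes K :: "nat set set" and d :: nat
  assumes K: "simplicial_complex K" and fin: "finite K" and dim: "complex_dim K = int d"
begin

abbreviation "F \<equiv> faces (int d) K"
abbreviation "X \<equiv> simplicial_cycles (int d - 1) K"
abbreviation "trees \<equiv> spanning_trees (int d) K"
abbreviation "skel \<equiv> skeleton (int d - 1) K"

lemma face_dim_le: "\<tau> \<in> K \<Longrightarrow> face_dim \<tau> \<le> int d"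
  unfolding dim[symmetric] complex_dim_def using fin by (intro Max_ge) auto

lemma F_nonempty: "F \<noteq> {}"
proof -
  have "K \<noteq> {}" using K by (auto simp: simplicial_complex_def)
  then have "complex_dim K \<in> face_dim ` K" unfolding complex_dim_def using fin by (intro Max_in) auto
  then show ?thesis by (auto simp: dim faces_def)
qed

lemma bd_F_in_X: "\<tau> \<in> F \<Longrightarrow> bd \<tau> \<in> X"
  by (rule bd_in_cycles[OF K]) simp

sublocale lattice_family bd F X
  by unfold_locales (auto intro: finite_faces fin frag_subgroup_cycles bd_F_in_X)

lemma finite_skel: "finite skel"
  using fin by (simp add: skeleton_def)

lemma subcomplex:
  assumes B: "B \<subseteq> F"
  shows "simplicial_complex (skel \<union> B)" "finite (skel \<union> B)" "skeleton (int d - 1) (skel \<union> B) = skel"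
    "faces (int d) (skel \<union> B) = B" "faces (int d + 1) (skel \<union> B) = {}" 
    "faces (int d - 1) (skel \<union> B) = faces (int d - 1) K"
proof -
  show "simplicial_complex (skel \<union> B)"
    unfolding simplicial_complex_def
  proof (intro conjI ballI allI impI)
    show "{} \<in> skel \<union> B" using K by (auto simp: simplicial_complex_def skeleton_def face_dim_def)
    fix \<tau> assume \<tau>: "\<tau> \<in> skel \<union> B"
    then have \<tau>K: "\<tau> \<in> K" using B by (auto simp: skeleton_def faces_def)
    show "finite \<tau>" using simplicial_complexD(1)[OF K \<tau>K] .
    fix \<rho> assume \<rho>: "\<rho> \<subseteq> \<tau>"
    have \<rho>K: "\<rho> \<in> K" using simplicial_complexD(2)[OF K \<tau>K \<rho>] .
    show "\<rho> \<in> skel \<union> B"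
    proof (cases "\<rho> = \<tau>")
      case False
      then have "card \<rho> < card \<tau>" using \<rho> \<open>finite \<tau>\<close> by (intro psubset_card_mono) auto
      then have "face_dim \<rho> \<le> int d - 1" using face_dim_le[OF \<tau>K] by (simp add: face_dim_def)
      then show ?thesis using \<rho>K by (simp add: skeleton_def)
    qed (use \<tau> in simp)
  qed
  show "finite (skel \<union> B)" using finite_skel B finite_F by (auto intro: finite_subset)
qed (use B in \<open>auto simp: skeleton_def faces_def\<close>)

lemma subcomplex_boundaries:
  assumes B: "B \<subseteq> F"
  shows "simplicial_boundaries (int d - 1) (skel \<union> B) = int_span bd B"
    and "simplicial_cycles (int d - 1) (skel \<union> B) = X"
  using simplicial_boundaries_eq[of "int d - 1" "skel \<union> B"] subcomplex[OF B] finite_F B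
  by (auto simp: simplicial_cycles_eq intro: finite_subset)

lemma boundaries_K: "simplicial_boundaries (int d - 1) K = int_span bd F"
  using simplicial_boundaries_eq[of "int d - 1" K] finite_F by simp

lemma torsion_order_subcomplex:
  assumes B: "B \<subseteq> F" shows "torsion_order (int d - 1) (skel \<union> B) = basis_index B"
  unfolding torsion_order_eq_index[OF subcomplex(1,2)[OF B]] subcomplex_boundaries[OF B] basis_index_def ..

lemma betti_top_zero_iff:
  assumes B: "B \<subseteq> F" shows "betti (int d) (skel \<union> B) = 0 \<longleftrightarrow> int_indep bd B"
proof -
  let ?T = "skel \<union> B"
  have finB: "finite B" using B finite_F by (rule finite_subset)
  have "simplicial_boundaries (int d) ?T = {0}"
    using simplicial_boundaries_eq[of "int d" ?T] subcomplex(5)[OF B]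
    by (simp add: int_span_def int_comb_def image_constant_conv)
  then have "betti (int d) ?T = 0 \<longleftrightarrow> simplicial_cycles (int d) ?T \<subseteq> {0}"
    unfolding betti_eq_rank_mod[OF subcomplex(1,2)[OF B]]
    using rank_mod_zero_iff[of B "simplicial_cycles (int d) ?T"] finB subcomplex(4)[OF B]
    by (simp add: simplicial_cycles_eq)
  also have "\<dots> \<longleftrightarrow> int_indep bd B"
  proof
    assume cyc: "simplicial_cycles (int d) ?T \<subseteq> {0}"
    show "int_indep bd B" unfolding int_indep_def
    proof (intro allI impI ballI)
      fix c \<tau> assume c: "int_comb bd B c = 0" and \<tau>: "\<tau> \<in> B"
      let ?z = "\<Sum>\<tau>\<in>B. frag_cmul (c \<tau>) (frag_of \<tau>)"
      have "simplicial_boundary ?z = 0"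
        using c by (simp add: simplicial_boundary_sum simplicial_boundary_cmul int_comb_def)
      moreover have "Poly_Mapping.keys ?z \<subseteq> B" by (rule order_trans[OF keys_sum]) auto
      ultimately have "?z = 0" using cyc subcomplex(4)[OF B] by (auto simp: simplicial_cycles_eq)
      then have "Poly_Mapping.lookup ?z \<tau> = 0" by simp
      then show "c \<tau> = 0" using \<tau> finB by (simp add: lookup_sum if_distrib[of "(*) _"] cong: if_cong)
    qed
  next
    assume ind: "int_indep bd B"
    show "simplicial_cycles (int d) ?T \<subseteq> {0}"
    proof
      fix z assume "z \<in> simplicial_cycles (int d) ?T"
      then have z: "Poly_Mapping.keys z \<subseteq> B" "simplicial_boundary z = 0"
        using subcomplex(4)[OF B] by (auto simp: simplicial_cycles_eq)
      then have "Poly_Mapping.lookup z \<tau> = 0" if "\<tau> \<in> B" for \<tau>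
        using int_indepD[OF ind _ that] simplicial_boundary_eq_comb[OF finB z(1)] by simp
      then have "z = 0" using z(1) by (intro poly_mapping_eqI) (metis in_keys_iff lookup_zero subsetD)
      then show "z \<in> {0}" by simp
    qed
  qed
  finally show ?thesis .
qed

text \<open>The cycles of codimension one depend on the skeleton alone, so the two homology groups are quotients
  of the same group by nested groups of boundaries.\<close>

lemma betti_codim1_eq_iff:
  assumes B: "B \<subseteq> F"
  shows "betti (int d - 1) (skel \<union> B) = betti (int d - 1) K
     \<longleftrightarrow> (\<forall>\<tau>\<in>F. \<exists>m. m \<noteq> 0 \<and> frag_cmul m (bd \<tau>) \<in> int_span bd B)"
proof -
  have "betti (int d - 1) (skel \<union> B) = betti (int d - 1) K \<longleftrightarrow> rank_mod X (int_span bd B) = rank_mod X (int_span bd F)"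
    unfolding betti_eq_rank_mod[OF subcomplex(1,2)[OF B]] betti_eq_rank_mod[OF K fin]
      subcomplex_boundaries[OF B] boundaries_K ..
  also have "\<dots> \<longleftrightarrow> int_span bd F \<subseteq> saturation X (int_span bd B)"
    using finite_faces[OF fin] int_span_mono[OF finite_F B] int_span_subset_X[OF subset_refl]
    by (intro rank_mod_eq_iff[of "faces (int d - 1) K"] frag_subgroup_int_span) (auto simp: simplicial_cycles_eq)
  also have "\<dots> \<longleftrightarrow> (\<forall>\<tau>\<in>F. bd \<tau> \<in> saturation X (int_span bd B))"
  proof
    assume "\<forall>\<tau>\<in>F. bd \<tau> \<in> saturation X (int_span bd B)"
    then show "int_span bd F \<subseteq> saturation X (int_span bd B)"
      by (intro int_span_subset frag_subgroup_saturation subgroup_X frag_subgroup_int_span) auto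
  next
    assume "int_span bd F \<subseteq> saturation X (int_span bd B)"
    then show "\<forall>\<tau>\<in>F. bd \<tau> \<in> saturation X (int_span bd B)"
      using int_span_base[OF finite_F, of _ bd] by blast
  qed
  also have "\<dots> \<longleftrightarrow> (\<forall>\<tau>\<in>F. \<exists>m. m \<noteq> 0 \<and> frag_cmul m (bd \<tau>) \<in> int_span bd B)"
    using bd_F_in_X by (auto simp: saturation_def)
  finally show ?thesis .
qed

lemma bd_nonzero: "\<tau> \<in> F \<Longrightarrow> bd \<tau> \<noteq> 0"
proof
  assume \<tau>: "\<tau> \<in> F" and "bd \<tau> = 0"
  then have "finite \<tau>" "\<tau> \<noteq> {}" using simplicial_complexD(1)[OF K] by (auto simp: mem_faces)
  then obtain v where "v \<in> \<tau>" by blast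
  with lookup_bd_facet[OF \<open>finite \<tau>\<close> this] \<open>bd \<tau> = 0\<close> show False by (simp add: pos_sign_def)
qed

text \<open>Without a \<open>d\<close>-face the corresponding subcomplex would have the wrong dimension.\<close>

lemma lattice_basis_nonempty: "B \<in> lattice_bases bd F \<Longrightarrow> B \<noteq> {}"
proof
  assume B: "B \<in> lattice_bases bd F" "B = {}"
  obtain \<tau> where \<tau>: "\<tau> \<in> F" using F_nonempty by blast
  then obtain m n where "m \<noteq> 0" "frag_cmul m (bd \<tau>) = int_comb bd {} n"
    using lattice_basis_relation[OF B(1)] B(2) by blast
  then show False using bd_nonzero[OF \<tau>] by (simp add: int_comb_def)
qed

lemma trees_eq: "trees = (\<lambda>B. skel \<union> B) ` lattice_bases bd F"
proof (intro equalityI subsetI)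
  fix T assume T: "T \<in> trees"
  then have T': "T \<subseteq> K" "skeleton (int d - 1) T = skel"
    "betti (int d - 1) T = betti (int d - 1) K" "betti (int d) T = 0"
    by (auto simp: spanning_trees_def)
  let ?B = "faces (int d) T"
  have B: "?B \<subseteq> F" using T' by (auto simp: faces_def)
  have "T = skeleton (int d - 1) T \<union> ?B"
  proof (intro equalityI subsetI)
    fix \<tau> assume "\<tau> \<in> T"
    moreover from this have "face_dim \<tau> \<le> int d" using T' face_dim_le by blast
    ultimately show "\<tau> \<in> skeleton (int d - 1) T \<union> ?B" by (auto simp: skeleton_def faces_def)
  qed (auto simp: skeleton_def faces_def)
  then have TB: "T = skel \<union> ?B" using T' by simp
  have "?B \<in> lattice_bases bd F"
    using B T' betti_top_zero_iff[OF B] betti_codim1_eq_iff[OF B] TB by (simp add: lattice_bases_def)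
  with TB show "T \<in> (\<lambda>B. skel \<union> B) ` lattice_bases bd F" by blast
next
  fix T assume "T \<in> (\<lambda>B. skel \<union> B) ` lattice_bases bd F"
  then obtain B where T: "T = skel \<union> B" and B: "B \<in> lattice_bases bd F" by blast
  note BF = lattice_basesD(1)[OF B]
  have TK: "T \<subseteq> K" using BF by (auto simp: T skeleton_def faces_def)
  obtain \<tau> where \<tau>: "\<tau> \<in> B" using lattice_basis_nonempty[OF B] by blast
  have "complex_dim T = int d"
    unfolding complex_dim_def
  proof (rule Max_eqI)
    show "finite (face_dim ` T)" using subcomplex(2)[OF BF] T by simp
    show "y \<le> int d" if "y \<in> face_dim ` T" for y using that TK face_dim_le by auto
    show "int d \<in> face_dim ` T" using \<tau> BF by (auto simp: T faces_def intro!: rev_image_eqI[of \<tau>])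
  qed
  then show "T \<in> trees"
    using TK subcomplex(1,3)[OF BF] betti_top_zero_iff[OF BF] betti_codim1_eq_iff[OF BF] B
    by (simp add: spanning_trees_def T lattice_bases_def)
qed

lemma tree_number_eq:
  "weighted_tree_number (int d) K
     = (\<Sum>B\<in>lattice_bases bd F. (\<Prod>\<tau>\<in>B. face_weight \<tau>) * of_nat (basis_index B) ^ 2)"
proof -
  have inj: "inj_on (\<lambda>B. skel \<union> B) (lattice_bases bd F)"
    by (rule inj_on_inverseI[of _ "faces (int d)"]) (use subcomplex(4) lattice_basesD(1) in blast)
  show ?thesis
    unfolding weighted_tree_number_def trees_eq sum.reindex[OF inj] o_def
    by (intro sum.cong refl)
      (simp add: subcomplex(4)[OF lattice_basesD(1)] torsion_order_subcomplex[OF lattice_basesD(1)])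
qed

end

section \<open>Positions in a finite set\<close>

definition pos :: "nat set \<Rightarrow> nat \<Rightarrow> nat" where
  "pos \<tau> t = card {u \<in> \<tau>. u < t}"

lemma pos_sign_eq_pos: "pos_sign \<tau> v = (- 1) ^ pos \<tau> v"
  by (simp add: pos_sign_def pos_def)

lemma pos_mono: "finite \<tau> \<Longrightarrow> s \<le> t \<Longrightarrow> pos \<tau> s \<le> pos \<tau> t"
  unfolding pos_def by (intro card_mono) auto

lemma pos_less_iff:
  assumes "finite \<tau>" "s \<in> \<tau>" shows "pos \<tau> s < pos \<tau> t \<longleftrightarrow> s < t"
proof
  assume "s < t"
  then show "pos \<tau> s < pos \<tau> t" unfolding pos_def using assms by (intro psubset_card_mono) auto
next
  assume "pos \<tau> s < pos \<tau> t"
  then show "s < t" using pos_mono[OF assms(1), of t s] by (meson not_le)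
qed

lemma pos_less_card: "finite \<tau> \<Longrightarrow> t \<in> \<tau> \<Longrightarrow> pos \<tau> t < card \<tau>"
  unfolding pos_def by (intro psubset_card_mono) auto

lemma inj_on_pos: "finite \<tau> \<Longrightarrow> inj_on (pos \<tau>) \<tau>"
  by (metis inj_onI linorder_neqE_nat pos_less_iff less_irrefl)

lemma pos_image: "finite \<tau> \<Longrightarrow> pos \<tau> ` \<tau> = {..<card \<tau>}"
  using pos_less_card[of \<tau>] card_image[OF inj_on_pos[of \<tau>]] by (intro card_subset_eq) auto

lemma ex_pos_eq: "finite \<tau> \<Longrightarrow> k < card \<tau> \<Longrightarrow> \<exists>t\<in>\<tau>. pos \<tau> t = k"
  using pos_image[of \<tau>] by (metis imageE lessThan_iff)

lemma card_pos_less: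
  assumes "finite \<tau>" "k \<le> card \<tau>" shows "card {t \<in> \<tau>. pos \<tau> t < k} = k"
proof -
  have "pos \<tau> ` {t \<in> \<tau>. pos \<tau> t < k} = {..<k}"
  proof (intro equalityI subsetI)
    fix j assume "j \<in> {..<k}"
    then obtain t where "t \<in> \<tau>" "pos \<tau> t = j" using ex_pos_eq[OF assms(1), of j] assms(2) by auto
    then show "j \<in> pos \<tau> ` {t \<in> \<tau>. pos \<tau> t < k}" using \<open>j \<in> {..<k}\<close> by auto
  qed auto
  moreover have "inj_on (pos \<tau>) {t \<in> \<tau>. pos \<tau> t < k}"
    using inj_on_pos[OF assms(1)] by (rule inj_on_subset) auto
  ultimately show ?thesis by (metis card_image card_lessThan)
qed

lemma pos_insert:
  assumes "finite \<tau>" "v \<notin> \<tau>" shows "pos (insert v \<tau>) t = (if v < t then Suc (pos \<tau> t) else pos \<tau> t)"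
proof -
  have "{u \<in> insert v \<tau>. u < t} = (if v < t then insert v {u \<in> \<tau>. u < t} else {u \<in> \<tau>. u < t})" by auto
  then show ?thesis using assms by (simp add: pos_def)
qed

lemma pos_nth_sorted_list_of_set:
  assumes "finite \<tau>" "i < card \<tau>" shows "pos \<tau> (sorted_list_of_set \<tau> ! i) = i"
proof -
  let ?xs = "sorted_list_of_set \<tau>"
  have xs: "set ?xs = \<tau>" "distinct ?xs" "sorted_wrt (<) ?xs" "length ?xs = card \<tau>"
    using assms by auto
  have "{u \<in> \<tau>. u < ?xs ! i} = (!) ?xs ` {..<i}"
  proof (intro equalityI subsetI)
    fix u assume "u \<in> {u \<in> \<tau>. u < ?xs ! i}"
    then obtain j where j: "j < length ?xs" "u = ?xs ! j" "u < ?xs ! i"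
      using xs(1) by (metis (no_types, lifting) in_set_conv_nth mem_Collect_eq)
    have "j < i"
    proof (rule ccontr)
      assume "\<not> j < i"
      then have "i = j \<or> ?xs ! i < ?xs ! j" using sorted_wrt_nth_less[OF xs(3), of i j] j by fastforce
      then show False using j by auto
    qed
    then show "u \<in> (!) ?xs ` {..<i}" using j by auto
  next
    fix u assume "u \<in> (!) ?xs ` {..<i}"
    then obtain j where j: "j < i" "u = ?xs ! j" by auto
    then show "u \<in> {u \<in> \<tau>. u < ?xs ! i}"
      using sorted_wrt_nth_less[OF xs(3), of j i] assms xs nth_mem[of j ?xs] by auto
  qed
  moreover have "inj_on ((!) ?xs) {..<i}"
    using xs assms by (intro inj_on_nth) auto
  ultimately show ?thesis by (simp add: pos_def card_image)
qed

lemma prod_eq_zeroI: "finite A \<Longrightarrow> a \<in> A \<Longrightarrow> f a = 0 \<Longrightarrow> prod f A = (0::'a::comm_ring_1)"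
  by (metis mult_zero_left prod.remove)

section \<open>An explicit cycle and its potential\<close>

text \<open>The value \<open>l 0 = 0\<close> is a sentinel below all vertices; since \<open>D 0 = 0\<close>, it carries no weight.\<close>

locale gale_chain =
  fixes x :: "nat \<Rightarrow> 'k::comm_ring_1" and l :: "nat \<Rightarrow> nat" and d n :: nat
  assumes l0: "l 0 = 0" and l_mono: "strict_mono_on {..Suc d} l" and l_n: "l (Suc d) \<le> n"
begin

definition "D q = (\<Sum>r=1..q. x r)"

text \<open>With \<open>e\<close> the unit chains, \<open>g k\<close> is the difference \<open>z\<^bsub>k+1\<^esub> - z\<^sub>k\<close> of the \<open>0\<close>-cycles
  \<open>z\<^sub>k = D\<^bsub>l\<^sub>k\<^esub> e\<^bsub>l\<^sub>k\<^esub> - \<Sum>r\<le>l\<^sub>k. x\<^sub>r e\<^sub>r\<close>.  It is a \<open>0\<close>-cycle supported on the interval \<open>[l\<^sub>k, l\<^bsub>k+1\<^esub>]\<close>.\<close>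

definition g :: "nat \<Rightarrow> nat \<Rightarrow> 'k" where
  "g k v = (if v = l (Suc k) then D (l (Suc k)) else 0) - (if v = l k then D (l k) else 0)
     - (if l k < v \<and> v \<le> l (Suc k) then x v else 0)"

lemma l_less: "i < j \<Longrightarrow> j \<le> Suc d \<Longrightarrow> l i < l j"
  using l_mono by (auto simp: strict_mono_on_def)

lemma l_le: "i \<le> j \<Longrightarrow> j \<le> Suc d \<Longrightarrow> l i \<le> l j"
  using l_less[of i j] by (cases "i = j") auto

lemma l_le_iff: "i \<le> Suc d \<Longrightarrow> j \<le> Suc d \<Longrightarrow> l i \<le> l j \<longleftrightarrow> i \<le> j"
  using l_le[of i j] l_less[of j i] by (meson not_le)

lemma l_less_iff: "i \<le> Suc d \<Longrightarrow> j \<le> Suc d \<Longrightarrow> l i < l j \<longleftrightarrow> i < j"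
  using l_le_iff[of j i] by (meson not_le)

lemma D_0: "D 0 = 0" by (simp add: D_def)

lemma D_diff: "a \<le> b \<Longrightarrow> D b = D a + (\<Sum>r\<in>{a<..b}. x r)"
proof -
  assume "a \<le> b"
  then have "{1..b} = {1..a} \<union> {a<..b}" by auto
  then show ?thesis unfolding D_def by (simp only:) (rule sum.union_disjoint, auto)
qed

lemma D_pred: "q \<ge> 1 \<Longrightarrow> D q - x q = D (q - 1)"
  unfolding D_def by (cases q) auto

lemma g_support:
  assumes "g k v \<noteq> 0" "k \<le> d" shows "l k \<le> v" "v \<le> l (Suc k)"
  using assms l_less[of k "Suc k"] by (auto simp: g_def split: if_splits)

lemma sum_g:
  assumes "k \<le> d" shows "(\<Sum>v\<in>{1..n}. g k v) = 0"
proof -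
  have lk: "l k < l (Suc k)" "l (Suc k) \<le> n" using l_less[of k "Suc k"] l_le[of "Suc k" "Suc d"] l_n assms by auto
  have 1: "(\<Sum>v\<in>{1..n}. if v = l (Suc k) then D (l (Suc k)) else 0) = D (l (Suc k))"
    using lk by (subst sum.delta) auto
  have 2: "(\<Sum>v\<in>{1..n}. if v = l k then D (l k) else 0) = D (l k)"
    using lk l0 D_0 by (subst sum.delta) (auto simp: not_le)
  have "(\<Sum>v\<in>{1..n}. if l k < v \<and> v \<le> l (Suc k) then x v else 0)
      = (\<Sum>v\<in>{v \<in> {1..n}. l k < v \<and> v \<le> l (Suc k)}. x v)"
    by (rule sum.inter_filter[symmetric]) simp
  also have "{v \<in> {1..n}. l k < v \<and> v \<le> l (Suc k)} = {l k<..l (Suc k)}" using lk by auto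
  finally have 3: "(\<Sum>v\<in>{1..n}. if l k < v \<and> v \<le> l (Suc k) then x v else 0) = D (l (Suc k)) - D (l k)"
    using D_diff[of "l k" "l (Suc k)"] lk by simp
  show ?thesis unfolding g_def sum_subtractf 1 2 3 by simp
qed

lemma sum_g_below:
  assumes "m \<le> Suc d" "v \<ge> 1"
  shows "(\<Sum>k<m. g k v) = (if v = l m then D (l m) else 0) - (if v \<le> l m then x v else 0)"
  using assms
proof (induction m)
  case 0 then show ?case using l0 by simp
next
  case (Suc m)
  then show ?case using l_less[of m "Suc m"] by (simp add: g_def)
qed

text \<open>The coefficient at \<open>\<tau>\<close> of the exterior product \<open>g\<^sub>0 \<and> \<dots> \<and> g\<^sub>d\<close>.  The supports of the factors are
  intervals meeting in end points, so distinct vertices from consecutive factors are automatically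
  increasing, and only the increasing enumeration of \<open>\<tau>\<close> contributes to the determinant.\<close>

definition \<Psi> :: "nat set \<Rightarrow> 'k" where "\<Psi> \<tau> = (\<Prod>t\<in>\<tau>. g (pos \<tau> t) t)"

text \<open>The coefficient at \<open>\<rho>\<close> of \<open>g\<^sub>1 \<and> \<dots> \<and> g\<^sub>d\<close>, for the same reason a single product.\<close>

definition Y :: "nat set \<Rightarrow> 'k" where "Y \<rho> = (\<Prod>t\<in>\<rho>. g (Suc (pos \<rho> t)) t)"

lemma \<Psi>_support:
  assumes "finite \<tau>" "card \<tau> = Suc d" "\<Psi> \<tau> \<noteq> 0" "t \<in> \<tau>" shows "t \<le> l (Suc (pos \<tau> t))"
proof -
  have "g (pos \<tau> t) t \<noteq> 0" using assms prod_eq_zeroI unfolding \<Psi>_def by metis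
  then show ?thesis using g_support(2)[of "pos \<tau> t" t] pos_less_card[OF assms(1,4)] assms(2) by simp
qed

text \<open>Let \<open>G k v\<close> be the product obtained by placing \<open>v\<close> in the factor \<open>g k\<close> and the elements of \<open>\<rho>\<close>, in
  order, in the remaining factors.  As each \<open>g k\<close> sums to zero, so does \<open>(-1)\<^sup>k G k v\<close> over all \<open>k\<close> and
  \<open>v\<close>.  For \<open>v \<notin> \<rho>\<close> the supports leave only \<open>k = pos \<rho> v\<close>, which is the boundary term.  For \<open>v \<in> \<rho>\<close> they
  leave \<open>k = pos \<rho> v\<close> and \<open>k = pos \<rho> v + 1\<close>, where the same vertex \<open>v\<close> occupies two neighbouring factors; these
  two terms cancel.\<close>

theorem \<Psi>_cycle:
  assumes \<rho>: "finite \<rho>" "card \<rho> = d" "\<rho> \<subseteq> {1..n}"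
  shows "(\<Sum>v\<in>{1..n} - \<rho>. pos_sign \<rho> v * \<Psi> (insert v \<rho>)) = 0"
proof -
  let ?p = "pos \<rho>"
  define h where "h k t = (if ?p t < k then g (?p t) t else g (Suc (?p t)) t)" for k t
  define G where "G k v = g k v * (\<Prod>t\<in>\<rho>. h k t)" for k v
  have ins: "\<Psi> (insert v \<rho>) = G (?p v) v" if "v \<notin> \<rho>" for v
  proof -
    have "(\<Prod>t\<in>\<rho>. g (pos (insert v \<rho>) t) t) = (\<Prod>t\<in>\<rho>. h (?p v) t)"
      using that \<rho>(1) by (intro prod.cong refl) (auto simp: pos_insert h_def pos_less_iff)
    then show ?thesis using that \<rho>(1) by (simp add: \<Psi>_def G_def pos_insert)
  qed
  have supp: "(?p t < k \<longrightarrow> t \<le> v) \<and> (k \<le> ?p t \<longrightarrow> v \<le> t)" if "G k v \<noteq> 0" "k \<le> d" "t \<in> \<rho>" for k v t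
  proof -
    have gk: "g k v \<noteq> 0" using that by (auto simp: G_def)
    have ht: "h k t \<noteq> 0" using that prod_eq_zeroI[OF \<rho>(1) that(3), of "h k"] by (auto simp: G_def)
    have pt: "?p t < d" using pos_less_card[OF \<rho>(1) that(3)] \<rho>(2) by simp
    show ?thesis
    proof (intro conjI impI)
      assume "?p t < k"
      then have "t \<le> l (Suc (?p t))" using ht g_support(2) pt by (simp add: h_def)
      also have "\<dots> \<le> l k" using \<open>?p t < k\<close> that by (intro l_le) auto
      also have "\<dots> \<le> v" using g_support(1)[OF gk that(2)] .
      finally show "t \<le> v" .
    next
      assume k: "k \<le> ?p t"
      have "v \<le> l (Suc k)" using g_support(2)[OF gk that(2)] .
      also have "\<dots> \<le> l (Suc (?p t))" using k pt by (intro l_le) auto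
      also have "\<dots> \<le> t" using ht g_support(1)[of "Suc (?p t)" t] pt k by (simp add: h_def)
      finally show "v \<le> t" .
    qed
  qed
  have out: "G k v = 0" if "v \<notin> \<rho>" "k \<le> d" "k \<noteq> ?p v" for k v
  proof (rule ccontr)
    assume nz: "G k v \<noteq> 0"
    have "t < v \<longleftrightarrow> ?p t < k" if "t \<in> \<rho>" for t
      using supp[OF nz \<open>k \<le> d\<close> that] that \<open>v \<notin> \<rho>\<close> by (metis le_neq_implies_less not_le)
    then have "{t \<in> \<rho>. t < v} = {t \<in> \<rho>. ?p t < k}" by auto
    then have "?p v = k" using card_pos_less[OF \<rho>(1), of k] that \<rho>(2) by (simp add: pos_def[of \<rho> v])
    then show False using that by simp
  qed
  have inside: "(\<Sum>k\<le>d. (- 1) ^ k * G k v) = 0" if v: "v \<in> \<rho>" for v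
  proof -
    let ?j = "?p v"
    have jd: "?j < d" using pos_less_card[OF \<rho>(1) v] \<rho>(2) by simp
    have "G k v = 0" if k: "k \<le> d" "k \<noteq> ?j" "k \<noteq> Suc ?j" for k
    proof (rule ccontr)
      assume nz: "G k v \<noteq> 0"
      show False
      proof (cases "k < ?j")
        case True
        then obtain t where t: "t \<in> \<rho>" "?p t = k" using ex_pos_eq[OF \<rho>(1), of k] jd \<rho>(2) by auto
        then show False using supp[OF nz k(1) t(1)] pos_less_iff[OF \<rho>(1) t(1), of v] True by simp
      next
        case False
        then have "Suc ?j < k" using k by simp
        then obtain t where t: "t \<in> \<rho>" "?p t = Suc ?j" using ex_pos_eq[OF \<rho>(1), of "Suc ?j"] k \<rho>(2) by auto
        then show False using supp[OF nz k(1) t(1)] pos_less_iff[OF \<rho>(1) v, of t] \<open>Suc ?j < k\<close> by simp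
      qed
    qed
    then have "(\<Sum>k\<le>d. (- 1) ^ k * G k v) = (\<Sum>k\<in>{?j, Suc ?j}. (- 1) ^ k * G k v)"
      using jd by (intro sum.mono_neutral_right) auto
    also have "\<dots> = (- 1) ^ ?j * (G ?j v - G (Suc ?j) v)" by (simp add: algebra_simps)
    also have "G ?j v = G (Suc ?j) v"
    proof -
      have "(\<Prod>t\<in>\<rho> - {v}. h ?j t) = (\<Prod>t\<in>\<rho> - {v}. h (Suc ?j) t)"
      proof (rule prod.cong[OF refl])
        fix t assume t: "t \<in> \<rho> - {v}"
        then have "?p t \<noteq> ?j" using inj_on_pos[OF \<rho>(1)] v by (auto dest: inj_onD)
        then show "h ?j t = h (Suc ?j) t" by (auto simp: h_def)
      qed
      then show ?thesis
        using prod.remove[OF \<rho>(1) v, of "h ?j"] prod.remove[OF \<rho>(1) v, of "h (Suc ?j)"]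
        by (simp add: G_def h_def[of _ v] mult_ac)
    qed
    finally show ?thesis by simp
  qed
  have "0 = (\<Sum>k\<le>d. (- 1) ^ k * ((\<Sum>v\<in>{1..n}. g k v) * (\<Prod>t\<in>\<rho>. h k t)))"
    using sum_g by (intro sum.neutral[symmetric] ballI) (simp del: One_nat_def)
  also have "\<dots> = (\<Sum>v\<in>{1..n}. \<Sum>k\<le>d. (- 1) ^ k * G k v)"
    unfolding G_def sum_distrib_right sum_distrib_left by (rule sum.swap)
  also have "\<dots> = (\<Sum>v\<in>{1..n} - \<rho>. \<Sum>k\<le>d. (- 1) ^ k * G k v)"
    using inside by (intro sum.mono_neutral_right) auto
  also have "\<dots> = (\<Sum>v\<in>{1..n} - \<rho>. pos_sign \<rho> v * \<Psi> (insert v \<rho>))"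
  proof (rule sum.cong[OF refl])
    fix v assume v: "v \<in> {1..n} - \<rho>"
    have "?p v \<le> d" unfolding pos_def using \<rho> card_mono[of \<rho> "{u \<in> \<rho>. u < v}"] by auto
    then have "(\<Sum>k\<le>d. (- 1) ^ k * G k v) = (\<Sum>k\<in>{?p v}. (- 1) ^ k * G k v)"
      using out v by (intro sum.mono_neutral_right) auto
    then show "(\<Sum>k\<le>d. (- 1) ^ k * G k v) = pos_sign \<rho> v * \<Psi> (insert v \<rho>)"
      using ins v by (simp add: pos_sign_eq_pos)
  qed
  finally show ?thesis ..
qed

definition top_face :: "nat set" where "top_face = l ` {1..Suc d}"

lemma finite_top_face: "finite top_face" by (simp add: top_face_def)

lemma inj_l: "inj_on l {..Suc d}"
  using l_mono by (rule strict_mono_on_imp_inj_on)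

lemma card_top_face: "card top_face = Suc d"
proof -
  have "inj_on l {1..Suc d}" using inj_l by (rule inj_on_subset) auto
  then show ?thesis by (simp add: top_face_def card_image)
qed

lemma pos_top_face: assumes "k \<le> d" shows "pos top_face (l (Suc k)) = k"
proof -
  have "{u \<in> top_face. u < l (Suc k)} = l ` {1..k}"
    using assms l_less_iff unfolding top_face_def by (fastforce simp: less_Suc_eq_le)
  moreover have "inj_on l {1..k}" using inj_l by (rule inj_on_subset) (use assms in auto)
  ultimately show ?thesis by (simp add: pos_def card_image)
qed

lemma prod_top_face: "(\<Prod>t\<in>top_face. f t) = (\<Prod>k\<le>d. f (l (Suc k)))"
proof -
  have "top_face = (\<lambda>k. l (Suc k)) ` {..d}"
    unfolding top_face_def image_Suc_atMost[symmetric] image_image ..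
  moreover have "inj_on (\<lambda>k. l (Suc k)) {..d}"
    using inj_l by (auto simp: inj_on_def)
  ultimately show ?thesis by (simp add: prod.reindex)
qed

lemma \<Psi>_top_face: "\<Psi> top_face = (\<Prod>k\<le>d. D (l (Suc k) - 1))"
  unfolding \<Psi>_def prod_top_face
proof (rule prod.cong[OF refl])
  fix k assume "k \<in> {..d}"
  then have k: "k \<le> d" by simp
  then have "l k < l (Suc k)" using l_less[of k "Suc k"] by simp
  then show "g (pos top_face (l (Suc k))) (l (Suc k)) = D (l (Suc k) - 1)"
    unfolding pos_top_face[OF k] using D_pred[of "l (Suc k)"] by (simp add: g_def)
qed

text \<open>The right-hand side is the coefficient of \<open>x \<and> Y\<close>, where \<open>x\<close> stands for the chain \<open>\<Sum>x\<^sub>v e\<^sub>v\<close>; below,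
  \<open>W w\<close> is the coefficient of \<open>w \<and> Y\<close>.  Telescoping gives \<open>x = u - \<Sum>g\<^sub>k\<close> with \<open>u\<close> supported on vertices
  \<open>\<ge> l\<^bsub>d+1\<^esub>\<close>.  Here \<open>g\<^sub>0 \<and> Y\<close> is \<open>\<Psi>\<close>, and \<open>g\<^sub>k \<and> Y = 0\<close> for \<open>k \<ge> 1\<close> because \<open>g\<^sub>k\<close> is already a factor of \<open>Y\<close>.
  The sets in the support of \<open>u \<and> Y\<close> dominate the top face, so the assumption \<open>top\<close> leaves only the top
  face itself.\<close>

theorem \<Psi>_coboundary:
  assumes \<tau>: "finite \<tau>" "card \<tau> = Suc d" "\<tau> \<subseteq> {1..n}"
    and top: "(\<And>t. t \<in> \<tau> \<Longrightarrow> l (Suc (pos \<tau> t)) \<le> t) \<Longrightarrow> \<tau> = top_face"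
  shows "(if \<tau> = top_face then \<Prod>k\<le>d. D (l (Suc k)) else 0) - \<Psi> \<tau>
     = (\<Sum>v\<in>\<tau>. pos_sign \<tau> v * (x v * Y (\<tau> - {v})))"
proof -
  let ?p = "pos \<tau>"
  define h where "h v t = (if t < v then g (Suc (?p t)) t else g (?p t) t)" for v t
  define W where "W w = (\<Sum>v\<in>\<tau>. pos_sign \<tau> v * (w v * Y (\<tau> - {v})))" for w :: "nat \<Rightarrow> 'k"
  have pd: "?p t \<le> d" if "t \<in> \<tau>" for t using pos_less_card[OF \<tau>(1) that] \<tau>(2) by simp
  have Yh: "Y (\<tau> - {v}) = (\<Prod>t\<in>\<tau> - {v}. h v t)" if v: "v \<in> \<tau>" for v
    unfolding Y_def
  proof (rule prod.cong[OF refl])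
    fix t assume t: "t \<in> \<tau> - {v}"
    have "?p t = pos (insert v (\<tau> - {v})) t" using v by (simp add: insert_absorb)
    also have "\<dots> = (if v < t then Suc (pos (\<tau> - {v}) t) else pos (\<tau> - {v}) t)"
      using \<tau>(1) by (intro pos_insert) auto
    finally show "g (Suc (pos (\<tau> - {v}) t)) t = h v t" using t by (auto simp: h_def split: if_splits)
  qed
  have supp: "(t < v \<longrightarrow> l (Suc (?p t)) \<le> t) \<and> (v < t \<longrightarrow> t \<le> l (Suc (?p t)))"
    if "Y (\<tau> - {v}) \<noteq> 0" "v \<in> \<tau>" "t \<in> \<tau>" for v t
  proof (intro conjI impI)
    have ht: "h v t \<noteq> 0" if "t \<noteq> v"
      using prod_eq_zeroI[of "\<tau> - {v}" t "h v"] \<tau>(1) that \<open>Y (\<tau> - {v}) \<noteq> 0\<close> \<open>t \<in> \<tau>\<close> Yh[OF \<open>v \<in> \<tau>\<close>] by auto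
    show "l (Suc (?p t)) \<le> t" if "t < v"
    proof -
      have "?p t < d" using pos_less_iff[OF \<tau>(1) \<open>t \<in> \<tau>\<close>, of v] pd[OF \<open>v \<in> \<tau>\<close>] that by simp
      then show ?thesis using ht that g_support(1)[of "Suc (?p t)" t] by (simp add: h_def)
    qed
    show "t \<le> l (Suc (?p t))" if "v < t"
      using ht that g_support(2)[of "?p t" t] pd[OF \<open>t \<in> \<tau>\<close>] by (simp add: h_def)
  qed
  have W0: "W (g 0) = \<Psi> \<tau>"
  proof -
    obtain v0 where v0: "v0 \<in> \<tau>" "?p v0 = 0" using ex_pos_eq[OF \<tau>(1), of 0] \<tau>(2) by auto
    have "g 0 v * Y (\<tau> - {v}) = 0" if v: "v \<in> \<tau>" "v \<noteq> v0" for v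
    proof (rule ccontr)
      assume "g 0 v * Y (\<tau> - {v}) \<noteq> 0"
      then have nz: "g 0 v \<noteq> 0" "Y (\<tau> - {v}) \<noteq> 0" by auto
      have "?p v \<noteq> 0" using v v0 inj_onD[OF inj_on_pos[OF \<tau>(1)], of v v0] by auto
      then have "v0 < v" using pos_less_iff[OF \<tau>(1) v0(1), of v] v0 by simp
      then have "l (Suc 0) \<le> v0" using supp[OF nz(2) v(1) v0(1)] v0 by simp
      with g_support(2)[OF nz(1)] \<open>v0 < v\<close> show False by simp
    qed
    then have "W (g 0) = (\<Sum>v\<in>{v0}. pos_sign \<tau> v * (g 0 v * Y (\<tau> - {v})))"
      unfolding W_def using \<tau>(1) v0 by (intro sum.mono_neutral_right) auto
    also have "\<dots> = g 0 v0 * (\<Prod>t\<in>\<tau> - {v0}. h v0 t)" using v0 Yh by (simp add: pos_sign_eq_pos)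
    also have "(\<Prod>t\<in>\<tau> - {v0}. h v0 t) = (\<Prod>t\<in>\<tau> - {v0}. g (?p t) t)"
    proof (rule prod.cong[OF refl])
      fix t assume "t \<in> \<tau> - {v0}"
      then have "\<not> t < v0" using pos_less_iff[OF \<tau>(1), of t v0] v0 by auto
      then show "h v0 t = g (?p t) t" by (simp add: h_def)
    qed
    also have "g 0 v0 * \<dots> = \<Psi> \<tau>" unfolding \<Psi>_def using prod.remove[OF \<tau>(1) v0(1), of "\<lambda>t. g (?p t) t"] v0(2) by simp
    finally show ?thesis .
  qed
  \<comment> \<open>Only the vertices in positions \<open>k - 1\<close> and \<open>k\<close> can be placed in the extra factor, and they can be interchanged.\<close>
  have Wk: "W (g k) = 0" if k: "1 \<le> k" "k \<le> d" for k
  proof -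
    have "k - 1 < card \<tau>" "k < card \<tau>" using \<tau>(2) k by auto
    then obtain p q where p: "p \<in> \<tau>" "?p p = k - 1" and q: "q \<in> \<tau>" "?p q = k"
      using ex_pos_eq[OF \<tau>(1)] by metis
    have pq: "p < q" "p \<noteq> q" using pos_less_iff[OF \<tau>(1) p(1), of q] p q k by auto
    have "g k v * Y (\<tau> - {v}) = 0" if v: "v \<in> \<tau>" "v \<noteq> p" "v \<noteq> q" for v
    proof (rule ccontr)
      assume "g k v * Y (\<tau> - {v}) \<noteq> 0"
      then have nz: "g k v \<noteq> 0" "Y (\<tau> - {v}) \<noteq> 0" by auto
      have "?p v \<noteq> k" "?p v \<noteq> k - 1"
        using v p q inj_onD[OF inj_on_pos[OF \<tau>(1)], of v q] inj_onD[OF inj_on_pos[OF \<tau>(1)], of v p] by auto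
      then consider "k < ?p v" | "?p v < k - 1" by linarith
      then show False
      proof cases
        case 1
        then have "q < v" using pos_less_iff[OF \<tau>(1) q(1), of v] q by simp
        then have "l (Suc k) \<le> q" using supp[OF nz(2) v(1) q(1)] q by simp
        with g_support(2)[OF nz(1) k(2)] \<open>q < v\<close> show False by simp
      next
        case 2
        then have "v < p" using pos_less_iff[OF \<tau>(1) v(1), of p] p by simp
        then have "p \<le> l k" using supp[OF nz(2) v(1) p(1)] p k by simp
        with g_support(1)[OF nz(1) k(2)] \<open>v < p\<close> show False by simp
      qed
    qed
    then have "W (g k) = (\<Sum>v\<in>{p, q}. pos_sign \<tau> v * (g k v * Y (\<tau> - {v})))"
      unfolding W_def using \<tau>(1) p q by (intro sum.mono_neutral_right) auto
    also have "\<dots> = (- 1) ^ (k - 1) * (g k p * Y (\<tau> - {p}) - g k q * Y (\<tau> - {q}))"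
      using pq p(2) q(2) k by (cases k) (simp_all add: pos_sign_eq_pos algebra_simps)
    also have "g k p * Y (\<tau> - {p}) = g k q * Y (\<tau> - {q})"
    proof -
      have "Y (\<tau> - {p}) = g k q * (\<Prod>t\<in>\<tau> - {p} - {q}. h p t)"
        unfolding Yh[OF p(1)] using \<tau>(1) p q pq by (subst prod.remove[of _ q]) (auto simp: h_def)
      moreover have "Y (\<tau> - {q}) = g k p * (\<Prod>t\<in>\<tau> - {q} - {p}. h q t)"
        unfolding Yh[OF q(1)] using \<tau>(1) p q pq k by (subst prod.remove[of _ p]) (auto simp: h_def)
      moreover have "(\<Prod>t\<in>\<tau> - {q} - {p}. h q t) = (\<Prod>t\<in>\<tau> - {p} - {q}. h p t)"
      proof (rule prod.cong)
        fix t assume t: "t \<in> \<tau> - {p} - {q}"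
        have "t < q \<longleftrightarrow> t < p"
        proof
          assume "t < q"
          then have "?p t \<le> ?p p" using pos_less_iff[OF \<tau>(1), of t q] t p q k by auto
          moreover have "?p t \<noteq> ?p p" using t p inj_onD[OF inj_on_pos[OF \<tau>(1)], of t p] by auto
          ultimately show "t < p" using pos_less_iff[OF \<tau>(1), of t p] t by auto
        qed (use pq in auto)
        then show "h q t = h p t" by (simp add: h_def)
      qed auto
      ultimately show ?thesis by (simp add: mult_ac)
    qed
    finally show ?thesis by simp
  qed
  \<comment> \<open>What is left of \<open>x\<close> after adding all \<open>g k\<close>.\<close>
  define u where "u v = (if v = l (Suc d) then D (l (Suc d)) else 0) + (if l (Suc d) < v then x v else 0)" for v
  have u_eq: "x v = u v - (\<Sum>k\<le>d. g k v)" if "v \<in> \<tau>" for v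
  proof -
    have "1 \<le> v" using that \<tau>(3) by auto
    from sum_g_below[OF le_refl this] show ?thesis by (auto simp: u_def lessThan_Suc_atMost)
  qed
  have Wu: "W u = (if \<tau> = top_face then \<Prod>k\<le>d. D (l (Suc k)) else 0)"
  proof -
    have nz_top: "?p v = d \<and> \<tau> = top_face" if nz: "u v * Y (\<tau> - {v}) \<noteq> 0" and v: "v \<in> \<tau>" for v
    proof -
      have nz': "u v \<noteq> 0" "Y (\<tau> - {v}) \<noteq> 0" using nz by auto
      have vl: "l (Suc d) \<le> v" using nz'(1) by (auto simp: u_def split: if_splits)
      have mx: "t \<le> v" if t: "t \<in> \<tau>" for t
      proof (rule ccontr)
        assume "\<not> t \<le> v"
        then have "t \<le> l (Suc (?p t))" using supp[OF nz'(2) v t] by simp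
        also have "\<dots> \<le> l (Suc d)" using pd[OF t] by (intro l_le) auto
        finally show False using vl \<open>\<not> t \<le> v\<close> by simp
      qed
      have "{t \<in> \<tau>. t < v} = \<tau> - {v}" using mx by force
      then have pv: "?p v = d" using \<tau> v by (simp add: pos_def)
      have "\<tau> = top_face"
      proof (rule top)
        fix t assume t: "t \<in> \<tau>"
        show "l (Suc (?p t)) \<le> t"
          using supp[OF nz'(2) v t] mx[OF t] vl pv by (cases "t = v") auto
      qed
      with pv show ?thesis by simp
    qed
    show ?thesis
    proof (cases "\<tau> = top_face")
      case False
      then have "u v * Y (\<tau> - {v}) = 0" if "v \<in> \<tau>" for v using nz_top that by blast
      then have "W u = 0" unfolding W_def by (intro sum.neutral) simp
      with False show ?thesis by simp
    next
      case True
      let ?v = "l (Suc d)"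
      have v: "?v \<in> \<tau>" using True by (simp add: top_face_def)
      have pv: "?p ?v = d" using pos_top_face[of d] True by simp
      have other: "u v * Y (\<tau> - {v}) = 0" if "v \<in> \<tau>" "v \<noteq> ?v" for v
      proof (rule ccontr)
        assume "u v * Y (\<tau> - {v}) \<noteq> 0"
        then have "?p v = ?p ?v" using nz_top that pv by simp
        then show False using inj_onD[OF inj_on_pos[OF \<tau>(1)], of v ?v] that v by auto
      qed
      have "W u = (\<Sum>v\<in>{?v}. pos_sign \<tau> v * (u v * Y (\<tau> - {v})))"
        unfolding W_def using \<tau>(1) v other by (intro sum.mono_neutral_right) auto
      also have "\<dots> = (- 1) ^ d * (D ?v * Y (\<tau> - {?v}))" using pv by (simp add: pos_sign_eq_pos u_def)
      also have "Y (\<tau> - {?v}) = (\<Prod>k<d. - D (l (Suc k)))"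
      proof -
        have "inj_on (\<lambda>k. l (Suc k)) {..<d}"
        proof (rule inj_onI)
          fix i j assume "i \<in> {..<d}" "j \<in> {..<d}" "l (Suc i) = l (Suc j)"
          then show "i = j" using inj_onD[OF inj_l, of "Suc i" "Suc j"] by simp
        qed
        moreover have "\<tau> - {?v} = (\<lambda>k. l (Suc k)) ` {..<d}"
        proof (intro equalityI subsetI)
          fix t assume "t \<in> \<tau> - {?v}"
          then obtain j where j: "t = l j" "1 \<le> j" "j \<le> Suc d" "l j \<noteq> l (Suc d)" using True by (auto simp: top_face_def)
          then have "j \<noteq> Suc d" by auto
          with j have "1 \<le> j" "j \<le> d" by auto
          with j(1) show "t \<in> (\<lambda>k. l (Suc k)) ` {..<d}" by (intro image_eqI[of _ _ "j - 1"]) auto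
        next
          fix t assume "t \<in> (\<lambda>k. l (Suc k)) ` {..<d}"
          then obtain k where k: "k < d" "t = l (Suc k)" by auto
          then show "t \<in> \<tau> - {?v}" using l_less[of "Suc k" "Suc d"] True by (auto simp: top_face_def)
        qed
        ultimately have "Y (\<tau> - {?v}) = (\<Prod>k<d. h ?v (l (Suc k)))"
          unfolding Yh[OF v] by (simp add: prod.reindex)
        also have "\<dots> = (\<Prod>k<d. - D (l (Suc k)))"
        proof (rule prod.cong[OF refl])
          fix k assume "k \<in> {..<d}"
          then have k: "k < d" by simp
          have lt: "l (Suc k) < ?v" "l (Suc k) < l (Suc (Suc k))"
            using l_less[of "Suc k" "Suc d"] l_less[of "Suc k" "Suc (Suc k)"] k by auto
          have "?p (l (Suc k)) = k" using pos_top_face[of k] True k by simp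
          then show "h ?v (l (Suc k)) = - D (l (Suc k))" using lt by (simp add: h_def g_def)
        qed
        finally show ?thesis .
      qed
      also have "(\<Prod>k<d. - D (l (Suc k))) = (- 1) ^ d * (\<Prod>k<d. D (l (Suc k)))"
        by (simp add: prod_uminus)
      also have "(- 1) ^ d * (D ?v * ((- 1) ^ d * (\<Prod>k<d. D (l (Suc k)))))
          = ((- 1) ^ d * (- 1) ^ d) * ((\<Prod>k<d. D (l (Suc k))) * D ?v)"
        by (simp only: mult_ac)
      also have "(- 1) ^ d * (- 1) ^ d = (1 :: 'k)" by (simp flip: power_mult_distrib)
      also have "1 * ((\<Prod>k<d. D (l (Suc k))) * D ?v) = (\<Prod>k\<le>d. D (l (Suc k)))"
        by (simp add: lessThan_Suc_atMost[symmetric])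
      finally show ?thesis using True by simp
    qed
  qed
  have "W x = W u - (\<Sum>k\<le>d. W (g k))"
  proof -
    have "W x = (\<Sum>v\<in>\<tau>. pos_sign \<tau> v * (u v * Y (\<tau> - {v})) - (\<Sum>k\<le>d. pos_sign \<tau> v * (g k v * Y (\<tau> - {v}))))"
      unfolding W_def
    proof (rule sum.cong[OF refl])
      fix v assume "v \<in> \<tau>"
      from u_eq[OF this] show "pos_sign \<tau> v * (x v * Y (\<tau> - {v}))
          = pos_sign \<tau> v * (u v * Y (\<tau> - {v})) - (\<Sum>k\<le>d. pos_sign \<tau> v * (g k v * Y (\<tau> - {v})))"
        by (simp only: left_diff_distrib right_diff_distrib sum_distrib_left sum_distrib_right)
    qed
    also have "\<dots> = W u - (\<Sum>k\<le>d. W (g k))"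
      unfolding W_def sum_subtractf by (subst sum.swap) simp
    finally show ?thesis .
  qed
  also have "(\<Sum>k\<le>d. W (g k)) = (\<Sum>k\<in>{0}. W (g k))"
    using Wk by (intro sum.mono_neutral_right) auto
  finally show ?thesis using W0 Wu by (simp add: W_def)
qed

end

section \<open>Shifted complexes\<close>

lemma (in lattice_family) lattice_bases_remove:
  assumes s: "s \<in> F" and span: "a s \<in> int_span a (F - {s})"
  shows "lattice_bases a (F - {s}) = {B \<in> lattice_bases a F. s \<notin> B}"
proof (intro equalityI subsetI)
  fix B assume B: "B \<in> lattice_bases a (F - {s})"
  have "int_span a (F - {s}) \<subseteq> saturation X (int_span a B)"
    using B a_in_X by (intro int_span_subset frag_subgroup_saturation subgroup_X frag_subgroup_int_span)
      (auto simp: lattice_bases_def saturation_def)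
  then have "\<exists>m. m \<noteq> 0 \<and> frag_cmul m (a s) \<in> int_span a B" using span by (auto simp: saturation_def)
  with B show "B \<in> {B \<in> lattice_bases a F. s \<notin> B}" by (auto simp: lattice_bases_def)
qed (auto simp: lattice_bases_def)

lemma lookup_bd_nonzeroD: "Poly_Mapping.lookup (bd \<tau>) \<rho> \<noteq> 0 \<Longrightarrow> \<exists>v\<in>\<tau>. \<rho> = \<tau> - {v}"
  using keys_bd[of \<tau>] by (force simp: in_keys_iff)

lemma sum_over_cofaces:
  assumes V: "finite V" "\<rho> \<subseteq> V"
  shows "(\<Sum>\<tau>\<in>{\<tau>. \<tau> \<subseteq> V \<and> card \<tau> = Suc (card \<rho>)}. f \<tau> * of_int (Poly_Mapping.lookup (bd \<tau>) \<rho>))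
       = (\<Sum>v\<in>V - \<rho>. pos_sign \<rho> v * (f (insert v \<rho>) :: 'a::comm_ring_1))"
proof -
  have fin: "finite \<rho>" using V by (rule rev_finite_subset)
  have inj: "inj_on (\<lambda>v. insert v \<rho>) (V - \<rho>)" by (auto simp: inj_on_def)
  have "(\<Sum>\<tau>\<in>{\<tau>. \<tau> \<subseteq> V \<and> card \<tau> = Suc (card \<rho>)}. f \<tau> * of_int (Poly_Mapping.lookup (bd \<tau>) \<rho>))
     = (\<Sum>\<tau>\<in>(\<lambda>v. insert v \<rho>) ` (V - \<rho>). f \<tau> * of_int (Poly_Mapping.lookup (bd \<tau>) \<rho>))"
  proof (rule sum.mono_neutral_right)
    show "\<forall>\<tau>\<in>{\<tau>. \<tau> \<subseteq> V \<and> card \<tau> = Suc (card \<rho>)} - (\<lambda>v. insert v \<rho>) ` (V - \<rho>).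
        f \<tau> * of_int (Poly_Mapping.lookup (bd \<tau>) \<rho>) = 0"
    proof
      fix \<tau> assume \<tau>: "\<tau> \<in> {\<tau>. \<tau> \<subseteq> V \<and> card \<tau> = Suc (card \<rho>)} - (\<lambda>v. insert v \<rho>) ` (V - \<rho>)"
      have "Poly_Mapping.lookup (bd \<tau>) \<rho> = 0"
      proof (rule ccontr)
        assume "Poly_Mapping.lookup (bd \<tau>) \<rho> \<noteq> 0"
        then obtain v where "v \<in> \<tau>" "\<rho> = \<tau> - {v}" using lookup_bd_nonzeroD by blast
        then have "\<tau> = insert v \<rho>" "v \<in> V - \<rho>" using \<tau> by auto
        then show False using \<tau> by blast
      qed
      then show "f \<tau> * of_int (Poly_Mapping.lookup (bd \<tau>) \<rho>) = 0" by simp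
    qed
  qed (use V fin in auto)
  also have "\<dots> = (\<Sum>v\<in>V - \<rho>. f (insert v \<rho>) * of_int (Poly_Mapping.lookup (bd (insert v \<rho>)) \<rho>))"
    by (simp add: sum.reindex[OF inj])
  also have "\<dots> = (\<Sum>v\<in>V - \<rho>. pos_sign \<rho> v * f (insert v \<rho>))"
  proof (rule sum.cong[OF refl])
    fix v assume v: "v \<in> V - \<rho>"
    then have "insert v \<rho> - {v} = \<rho>" by auto
    with lookup_bd_facet[of "insert v \<rho>" v] fin
    have "Poly_Mapping.lookup (bd (insert v \<rho>)) \<rho> = pos_sign \<rho> v" by (simp add: pos_sign_insert_self)
    then show "f (insert v \<rho>) * of_int (Poly_Mapping.lookup (bd (insert v \<rho>)) \<rho>) = pos_sign \<rho> v * f (insert v \<rho>)"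
      by (simp add: mult.commute)
  qed
  finally show ?thesis .
qed

lemma sum_over_facets:
  assumes R: "finite R" "\<And>v. v \<in> \<tau> \<Longrightarrow> \<tau> - {v} \<in> R" and \<tau>: "finite \<tau>"
  shows "(\<Sum>\<rho>\<in>R. of_int (Poly_Mapping.lookup (bd \<tau>) \<rho>) * (y \<rho> :: 'a::comm_ring_1)) = (\<Sum>v\<in>\<tau>. pos_sign \<tau> v * y (\<tau> - {v}))"
proof -
  have inj: "inj_on (\<lambda>v. \<tau> - {v}) \<tau>" by (auto simp: inj_on_def)
  have "(\<Sum>\<rho>\<in>R. of_int (Poly_Mapping.lookup (bd \<tau>) \<rho>) * y \<rho>)
     = (\<Sum>\<rho>\<in>(\<lambda>v. \<tau> - {v}) ` \<tau>. of_int (Poly_Mapping.lookup (bd \<tau>) \<rho>) * y \<rho>)"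
  proof (rule sum.mono_neutral_right)
    show "\<forall>\<rho>\<in>R - (\<lambda>v. \<tau> - {v}) ` \<tau>. of_int (Poly_Mapping.lookup (bd \<tau>) \<rho>) * y \<rho> = 0"
    proof
      fix \<rho> assume "\<rho> \<in> R - (\<lambda>v. \<tau> - {v}) ` \<tau>"
      then have "Poly_Mapping.lookup (bd \<tau>) \<rho> = 0" using lookup_bd_nonzeroD[of \<tau> \<rho>] by blast
      then show "of_int (Poly_Mapping.lookup (bd \<tau>) \<rho>) * y \<rho> = 0" by simp
    qed
  qed (use R in auto)
  also have "\<dots> = (\<Sum>v\<in>\<tau>. pos_sign \<tau> v * y (\<tau> - {v}))"
    by (simp add: sum.reindex[OF inj] lookup_bd_facet[OF \<tau>])
  finally show ?thesis .
qed

lemma coset_index_self: "frag_subgroup H \<Longrightarrow> coset_index H H = 1"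
proof -
  assume H: "frag_subgroup H"
  have "frag_coset H x = frag_coset H 0" if "x \<in> H" for x
    using that frag_coset_eq_iff[OF H, of x 0] by simp
  then have "frag_coset H ` H = (\<lambda>_. frag_coset H 0) ` H" by (rule image_cong[OF refl])
  also have "\<dots> = {frag_coset H 0}" using frag_subgroup_0[OF H] by auto
  finally have "frag_coset H ` H = {frag_coset H 0}" .
  then show ?thesis by (simp add: coset_index_def)
qed

locale shifted_complex = finite_complex +
  assumes positive: "\<And>\<tau>. \<tau> \<in> K \<Longrightarrow> 0 \<notin> \<tau>" and shifted: "shifted K"
begin

lemma shiftD: "\<tau> \<in> K \<Longrightarrow> q \<in> \<tau> \<Longrightarrow> 1 \<le> r \<Longrightarrow> r < q \<Longrightarrow> insert r (\<tau> - {q}) \<in> K"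
  using shifted by (auto simp: shifted_def)

text \<open>The \<open>d\<close>-faces through the vertex \<open>1\<close> form the basis in terms of which all boundaries have integer
  coordinates; the coordinate at \<open>\<tau>\<close> is read off at the face \<open>\<tau> - {1}\<close>, which lies in the boundary of no other
  \<open>d\<close>-face through \<open>1\<close>.\<close>

abbreviation "cone_faces \<equiv> {\<tau> \<in> F. 1 \<in> \<tau>}"

lemma finite_cone: "finite cone_faces" using finite_F by simp

lemma F_D: "\<tau> \<in> F \<Longrightarrow> finite \<tau>" "\<tau> \<in> F \<Longrightarrow> 0 \<notin> \<tau>" "\<tau> \<in> F \<Longrightarrow> card \<tau> = d + 1" "\<tau> \<in> F \<Longrightarrow> \<tau> \<in> K"
  using simplicial_complexD(1)[OF K] positive by (auto simp: mem_faces)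

lemma cone_coeff:
  assumes \<tau>: "\<tau> \<in> cone_faces" shows "Poly_Mapping.lookup (int_comb bd cone_faces c) (\<tau> - {1}) = c \<tau>"
proof -
  have "Poly_Mapping.lookup (int_comb bd cone_faces c) (\<tau> - {1})
     = (\<Sum>\<tau>'\<in>cone_faces. if \<tau>' = \<tau> then c \<tau> else 0)"
    unfolding lookup_int_comb
  proof (rule sum.cong[OF refl])
    fix \<tau>' assume \<tau>': "\<tau>' \<in> cone_faces"
    show "c \<tau>' * Poly_Mapping.lookup (bd \<tau>') (\<tau> - {1}) = (if \<tau>' = \<tau> then c \<tau> else 0)"
    proof (cases "\<tau>' = \<tau>")
      case True
      have "{u \<in> \<tau>. u < 1} = {}" using F_D(2)[of \<tau>] \<tau> by (auto simp: less_Suc_eq)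
      then have "pos_sign \<tau> 1 = (1::int)" by (simp only: pos_sign_def card.empty power_0)
      then show ?thesis using True \<tau> lookup_bd_facet[of \<tau> 1] F_D(1)[of \<tau>] by simp
    next
      case False
      have "Poly_Mapping.lookup (bd \<tau>') (\<tau> - {1}) = 0"
      proof (rule ccontr)
        assume "Poly_Mapping.lookup (bd \<tau>') (\<tau> - {1}) \<noteq> 0"
        then obtain v where v: "v \<in> \<tau>'" "\<tau> - {1} = \<tau>' - {v}" using lookup_bd_nonzeroD by blast
        then have "v = 1" using \<tau>' by auto
        then show False using v \<tau> \<tau>' False by auto
      qed
      then show ?thesis using False by simp
    qed
  qed
  then show ?thesis using finite_cone \<tau> by simp
qed

text \<open>Shiftedness puts into the complex all the faces that occur in the cone expansion of \<open>\<partial>\<tau>\<close>.\<close>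

lemma bd_in_cone_span: assumes \<tau>: "\<tau> \<in> F" shows "bd \<tau> \<in> int_span bd cone_faces"
proof (cases "1 \<in> \<tau>")
  case True
  then show ?thesis using \<tau> finite_cone by (intro int_span_base) auto
next
  case False
  have gt: "1 < v" if "v \<in> \<tau>" for v using F_D(2)[OF \<tau>] False that by (metis less_one linorder_neqE_nat)
  have "insert 1 (\<tau> - {v}) \<in> cone_faces" if v: "v \<in> \<tau>" for v
    using shiftD[OF F_D(4)[OF \<tau>] v _ gt[OF v]] F_D(1,3)[OF \<tau>] False v by (auto simp: mem_faces)
  then have "bd (insert 1 (\<tau> - {v})) \<in> int_span bd cone_faces" if "v \<in> \<tau>" for v
    using that finite_cone by (intro int_span_base) auto
  moreover have "bd \<tau> = (\<Sum>v\<in>\<tau>. frag_cmul (pos_sign \<tau> v) (bd (insert 1 (\<tau> - {v}))))"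
    using F_D(1)[OF \<tau>] gt by (rule bd_eq_comb_cone)
  ultimately show ?thesis
    by (simp only:) (intro frag_subgroup_sum frag_subgroup_cmul frag_subgroup_int_span, assumption)
qed

lemma cone_lattice_basis: "cone_faces \<in> lattice_bases bd F"
  unfolding lattice_bases_def
proof (intro CollectI conjI)
  show "int_indep bd cone_faces" unfolding int_indep_def
  proof (intro allI impI ballI)
    fix c \<tau> assume "int_comb bd cone_faces c = 0" "\<tau> \<in> cone_faces"
    then show "c \<tau> = 0" using cone_coeff[of \<tau> c] by simp
  qed
  show "\<forall>\<tau>\<in>F. \<exists>m. m \<noteq> 0 \<and> frag_cmul m (bd \<tau>) \<in> int_span bd cone_faces"
    using bd_in_cone_span by (intro ballI exI[of _ 1]) simp
qed auto

text \<open>This basis supplies a spanning tree with nonzero weight.\<close>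

lemma cone_index: "basis_index cone_faces = 1"
proof -
  have "saturation X (int_span bd cone_faces) = int_span bd cone_faces"
  proof (intro equalityI subsetI)
    fix z assume "z \<in> saturation X (int_span bd cone_faces)"
    then obtain m c where m: "m \<noteq> 0" "frag_cmul m z = int_comb bd cone_faces c"
      by (auto simp: saturation_def int_span_def)
    let ?b = "\<lambda>\<tau>. Poly_Mapping.lookup z (\<tau> - {1})"
    have "int_comb bd cone_faces c = int_comb bd cone_faces (\<lambda>\<tau>. m * ?b \<tau>)"
    proof (rule int_comb_cong)
      fix \<tau> assume "\<tau> \<in> cone_faces"
      from cone_coeff[OF this, of c] show "c \<tau> = m * ?b \<tau>" unfolding m(2)[symmetric] by simp
    qed
    then have "frag_cmul m z = frag_cmul m (int_comb bd cone_faces ?b)" using m(2) by (simp add: int_comb_cmul)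
    moreover have "frag_cmul m (z - int_comb bd cone_faces ?b)
        = frag_cmul m z - frag_cmul m (int_comb bd cone_faces ?b)"
      by (rule poly_mapping_eqI) (simp only: lookup_minus lookup_frag_cmul right_diff_distrib)
    ultimately have "frag_cmul m (z - int_comb bd cone_faces ?b) = 0" by (simp only: diff_self)
    then have "z = int_comb bd cone_faces ?b" using m(1) by simp
    then show "z \<in> int_span bd cone_faces" by (auto simp: int_span_def)
  qed (use subset_saturation[OF int_span_subset_X[of cone_faces]] in auto)
  then show ?thesis by (simp add: basis_index_def coset_index_self frag_subgroup_int_span)
qed

text \<open>
  Lower the elements of the top set to those of \<open>\<tau>\<close> one at a time, beginning with the smallest.  The new
  element never collides with the remaining ones, because it is at most the one it replaces.
\<close>

lemma gale_below:
  assumes l: "\<And>i j. i < j \<Longrightarrow> j \<le> Suc d \<Longrightarrow> l i < l j" and top: "l ` {1..Suc d} \<in> K"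
    and \<tau>: "finite \<tau>" "card \<tau> = Suc d" "0 \<notin> \<tau>" and le: "\<And>t. t \<in> \<tau> \<Longrightarrow> t \<le> l (Suc (pos \<tau> t))"
  shows "\<tau> \<in> K"
proof -
  have "{t \<in> \<tau>. pos \<tau> t < j} \<union> l ` {Suc j..Suc d} \<in> K" if "j \<le> Suc d" for j
    using that
  proof (induction j)
    case 0 then show ?case using top by simp
  next
    case (Suc j)
    let ?S = "{t \<in> \<tau>. pos \<tau> t < j} \<union> l ` {Suc j..Suc d}"
    have S: "?S \<in> K" using Suc by simp
    obtain t where t: "t \<in> \<tau>" "pos \<tau> t = j" using ex_pos_eq[OF \<tau>(1), of j] \<tau>(2) Suc.prems by auto
    have tl: "t \<le> l (Suc j)" using le[OF t(1)] t(2) by simp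
    have t1: "1 \<le> t" using t \<tau>(3) by (cases t) auto
    have A: "{s \<in> \<tau>. pos \<tau> s < Suc j} = insert t {s \<in> \<tau>. pos \<tau> s < j}"
    proof -
      have eq: "s = t" if "s \<in> \<tau>" "pos \<tau> s = j" for s
        using inj_onD[OF inj_on_pos[OF \<tau>(1)], of s t] that t by simp
      show ?thesis
      proof (intro equalityI subsetI)
        fix s assume "s \<in> {s \<in> \<tau>. pos \<tau> s < Suc j}"
        then show "s \<in> insert t {s \<in> \<tau>. pos \<tau> s < j}" using eq[of s] by (cases "pos \<tau> s = j") auto
      qed (use t in auto)
    qed
    have "{Suc j..Suc d} = insert (Suc j) {Suc (Suc j)..Suc d}" using Suc.prems by auto
    then have B: "l ` {Suc j..Suc d} = insert (l (Suc j)) (l ` {Suc (Suc j)..Suc d})"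
      by (simp only: image_insert)
    show ?case
    proof (cases "t = l (Suc j)")
      case True
      then have "{s \<in> \<tau>. pos \<tau> s < Suc j} \<union> l ` {Suc (Suc j)..Suc d} = ?S" unfolding A B by blast
      then show ?thesis using S by (simp only:)
    next
      case False
      then have lt: "t < l (Suc j)" using tl by simp
      have "l (Suc j) \<in> ?S" unfolding B by blast
      from shiftD[OF S this t1 lt] have ins: "insert t (?S - {l (Suc j)}) \<in> K" .
      have 1: "l (Suc j) \<notin> {s \<in> \<tau>. pos \<tau> s < j}"
        using pos_less_iff[OF \<tau>(1), of "l (Suc j)" t] t lt by auto
      have 2: "l (Suc j) \<notin> l ` {Suc (Suc j)..Suc d}"
      proof
        assume "l (Suc j) \<in> l ` {Suc (Suc j)..Suc d}"
        then obtain i where "l (Suc j) = l i" "Suc j < i" "i \<le> Suc d" by auto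
        with l[of "Suc j" i] show False by simp
      qed
      have "{s \<in> \<tau>. pos \<tau> s < Suc j} \<union> l ` {Suc (Suc j)..Suc d} = insert t (?S - {l (Suc j)})"
        using 1 2 unfolding A B by blast
      then show ?thesis using ins by (simp only:)
    qed
  qed
  from this[of "Suc d"] have "{t \<in> \<tau>. pos \<tau> t < Suc d} \<in> K" by simp
  moreover have "{t \<in> \<tau>. pos \<tau> t < Suc d} = \<tau>" using pos_less_card[OF \<tau>(1)] \<tau>(2) by auto
  ultimately show ?thesis by simp
qed

end

section \<open>Sums of monomials\<close>

lemma to_fract_prod: "to_fract (prod f A) = (\<Prod>i\<in>A. to_fract (f i))"
  by (induction A rule: infinite_finite_induct) auto

lemma to_fract_of_nat: "to_fract (of_nat m) = of_nat m"
  by (induction m) auto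

lemma to_fract_power: "to_fract (p ^ m) = to_fract p ^ m"
  by (induction m) auto

definition monomials :: "weight_poly set" where
  "monomials = range (\<lambda>m. Poly_Mapping.single m 1)"

lemma monomials_prod: "(\<And>i. i \<in> A \<Longrightarrow> f i \<in> monomials) \<Longrightarrow> prod f A \<in> monomials"
proof (induction A rule: infinite_finite_induct)
  case (insert i A)
  then have "f i \<in> monomials" "prod f A \<in> monomials" by auto
  then obtain m m' where "f i = Poly_Mapping.single m 1" "prod f A = Poly_Mapping.single m' 1"
    unfolding monomials_def by blast
  then show ?case using insert by (auto simp: monomials_def mult_single)
qed (auto simp: monomials_def intro: single_one[symmetric])

lemma monomials_face_weight: "face_weight \<tau> \<in> monomials"
  unfolding face_weight_def by (rule monomials_prod) (auto simp: monomials_def vertex_weight_def)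

lemma monomials_nonzero: "p \<in> monomials \<Longrightarrow> p \<noteq> 0"
  by (auto simp: monomials_def)

text \<open>Nonnegative coefficients cannot cancel.\<close>

lemma sum_monomials_nonzero:
  assumes A: "finite A" "i \<in> A" "c i > 0" and p: "\<And>j. j \<in> A \<Longrightarrow> p j \<in> monomials"
  shows "(\<Sum>j\<in>A. p j * of_nat (c j)) \<noteq> (0 :: weight_poly)"
proof
  assume zero: "(\<Sum>j\<in>A. p j * of_nat (c j)) = 0"
  have single: "\<exists>m. p j * of_nat (c j) = Poly_Mapping.single m (int (c j))" if j: "j \<in> A" for j
  proof -
    obtain m where "p j = Poly_Mapping.single m 1" using p[OF j] by (auto simp: monomials_def)
    moreover have "(of_nat (c j) :: weight_poly) = Poly_Mapping.single 0 (int (c j))" by simp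
    ultimately show ?thesis by (auto simp: mult_single simp del: single_of_nat)
  qed
  then have nonneg: "Poly_Mapping.lookup (p j * of_nat (c j)) m \<ge> 0" if "j \<in> A" for j m
    using that by (metis lookup_single_eq lookup_single_not_eq of_nat_0_le_iff order_refl)
  obtain m where m: "p i * of_nat (c i) = Poly_Mapping.single m (int (c i))" using single[OF A(2)] by blast
  have "0 < Poly_Mapping.lookup (p i * of_nat (c i)) m" using m A(3) by simp
  also have "\<dots> \<le> (\<Sum>j\<in>A. Poly_Mapping.lookup (p j * of_nat (c j)) m)"
    using A nonneg by (intro member_le_sum) auto
  also have "\<dots> = 0" using zero by (simp flip: lookup_sum)
  finally show False by simp
qed

section \<open>The ratio of weighted tree-numbers\<close>

lemma gale_leI:
  assumes \<tau>: "finite \<tau>" and \<sigma>: "finite \<sigma>" and c: "card \<sigma> = card \<tau>"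
    and le: "\<And>s t. s \<in> \<sigma> \<Longrightarrow> t \<in> \<tau> \<Longrightarrow> pos \<sigma> s = pos \<tau> t \<Longrightarrow> s \<le> t"
  shows "gale_le \<sigma> \<tau>"
  unfolding gale_le_def
proof (intro conjI allI impI \<tau> \<sigma> c)
  fix i assume i: "i < card \<sigma>"
  show "sorted_list_of_set \<sigma> ! i \<le> sorted_list_of_set \<tau> ! i"
  proof (rule le)
    show "sorted_list_of_set \<sigma> ! i \<in> \<sigma>" "sorted_list_of_set \<tau> ! i \<in> \<tau>"
      using i \<sigma> \<tau> c by (metis length_sorted_list_of_set nth_mem set_sorted_list_of_set)+
    show "pos \<sigma> (sorted_list_of_set \<sigma> ! i) = pos \<tau> (sorted_list_of_set \<tau> ! i)"
      using i \<sigma> \<tau> c by (simp add: pos_nth_sorted_list_of_set)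
  qed
qed

text \<open>The ratio without denominators.  The splitting of \<open>e\<^sub>\<sigma>\<close> is scaled by \<open>\<Prod>D\<^bsub>l\<^sub>q\<^esub>\<close>, and the potential of
  the orthogonal part is \<open>Y \<rho> / x\<^sub>\<rho>\<close>: the weight of \<open>\<tau>\<close> divided by that of \<open>\<tau> - {v}\<close> is the factor \<open>x\<^sub>v\<close> that
  occurs in \<open>x \<and> Y\<close>.\<close>

lemma weighted_tree_number_shifted:
  fixes n d :: nat and \<Delta> :: "nat set set" and \<sigma> :: "nat set" and l :: "nat \<Rightarrow> nat"
  assumes cx: "simplicial_complex \<Delta>"
    and sub: "\<Delta> \<subseteq> Pow {1..n}"
    and dim: "complex_dim \<Delta> = int d"
    and shifted: "shifted \<Delta>"
    and l: "strict_mono_on {1..d + 1} l"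
    and \<sigma>: "\<sigma> = l ` {1..d + 1}"
    and facet: "\<sigma> \<in> facets \<Delta>"
    and top: "\<And>\<tau>. \<tau> \<in> facets \<Delta> \<Longrightarrow> gale_le \<sigma> \<tau> \<Longrightarrow> \<tau> = \<sigma>"
    and l1: "l 1 \<ge> 2"
  shows "to_fract (weighted_tree_number (int d) \<Delta>) * (\<Prod>q=1..d + 1. to_fract (weight_sum (l q - 1)))
       = to_fract (weighted_tree_number (int d) (\<Delta> - {\<sigma>})) * (\<Prod>q=1..d + 1. to_fract (weight_sum (l q)))"
    and "weighted_tree_number (int d) (\<Delta> - {\<sigma>}) \<noteq> 0"
proof -
  have fin: "finite \<Delta>" using sub by (rule finite_subset) simp
  have sub': "\<tau> \<subseteq> {1..n}" if "\<tau> \<in> \<Delta>" for \<tau> using that sub by blast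
  have zero: "0 \<notin> \<tau>" if "\<tau> \<in> \<Delta>" for \<tau> using sub'[OF that] by auto
  interpret shifted_complex \<Delta> d
    by unfold_locales (use cx fin dim shifted zero in auto)
  have \<sigma>\<Delta>: "\<sigma> \<in> \<Delta>" using facet by (simp add: facets_def)
  have pos_l: "l i < l j" if "1 \<le> i" "i < j" "j \<le> Suc d" for i j
    using l that by (auto simp: strict_mono_on_def)
  define x where "x v = to_fract (vertex_weight v)" for v
  \<comment> \<open>Shift to the enumeration with the sentinel \<open>l0 0 = 0\<close>.\<close>
  define l0 where "l0 k = (if k = 0 then 0 else l k)" for k
  have l0_less: "l0 i < l0 j" if "i < j" "j \<le> Suc d" for i j
    using that pos_l[of i j] pos_l[of 1 j] l1 by (cases "j = 1") (auto simp: l0_def)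
  have l0_img: "l0 ` {1..Suc d} = \<sigma>" unfolding \<sigma> by (intro image_cong) (auto simp: l0_def)
  interpret G: gale_chain x l0 d n
  proof
    show "l0 0 = 0" by (simp add: l0_def)
    show "strict_mono_on {..Suc d} l0" using l0_less by (auto simp: strict_mono_on_def)
    have "l0 (Suc d) \<in> \<sigma>" unfolding l0_img[symmetric] by auto
    then show "l0 (Suc d) \<le> n" using sub'[OF \<sigma>\<Delta>] by auto
  qed
  have top_face: "G.top_face = \<sigma>" unfolding G.top_face_def l0_img ..
  have \<sigma>F: "\<sigma> \<in> F" using \<sigma>\<Delta> G.card_top_face by (simp add: mem_faces top_face)
  have one_\<sigma>: "1 \<notin> \<sigma>"
  proof
    assume "1 \<in> \<sigma>"
    then obtain k where "1 = l k" "1 \<le> k" "k \<le> Suc d" unfolding \<sigma> by auto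
    then show False using l1 pos_l[of 1 k] by (cases "k = 1") auto
  qed
  have F_facets: "\<tau> \<in> facets \<Delta>" if \<tau>: "\<tau> \<in> F" for \<tau>
    unfolding facets_def
  proof (intro CollectI conjI ballI impI)
    fix \<rho> assume \<rho>: "\<rho> \<in> \<Delta>" "\<tau> \<subseteq> \<rho>"
    have "card \<rho> \<le> card \<tau>" using face_dim_le[OF \<rho>(1)] F_D(3)[OF \<tau>] by (simp add: face_dim_def)
    then show "\<rho> = \<tau>" using card_seteq[OF simplicial_complexD(1)[OF cx \<rho>(1)] \<rho>(2)] by simp
  qed (use F_D(4)[OF \<tau>] in simp)
  have F_sub: "F \<subseteq> {\<tau>. \<tau> \<subseteq> {1..n} \<and> card \<tau> = Suc d}" using sub by (auto simp: mem_faces)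

  define w where "w \<tau> = to_fract (face_weight \<tau>)" for \<tau>
  have w_prod: "w \<tau> = (\<Prod>v\<in>\<tau>. x v)" for \<tau> by (simp add: w_def face_weight_def to_fract_prod x_def)
  have w_nz: "w \<tau> \<noteq> 0" for \<tau> using monomials_nonzero[OF monomials_face_weight] by (simp add: w_def)

  have cycle: "(\<Sum>\<tau>\<in>F. G.\<Psi> \<tau> * of_int (Poly_Mapping.lookup (bd \<tau>) \<rho>)) = 0" for \<rho>
  proof (cases "\<rho> \<subseteq> {1..n} \<and> card \<rho> = d")
    case True
    then have fin\<rho>: "finite \<rho>" by (auto intro: finite_subset)
    have "(\<Sum>\<tau>\<in>F. G.\<Psi> \<tau> * of_int (Poly_Mapping.lookup (bd \<tau>) \<rho>))
       = (\<Sum>\<tau>\<in>{\<tau>. \<tau> \<subseteq> {1..n} \<and> card \<tau> = Suc d}. G.\<Psi> \<tau> * of_int (Poly_Mapping.lookup (bd \<tau>) \<rho>))"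
    proof (rule sum.mono_neutral_left)
      show "\<forall>\<tau>\<in>{\<tau>. \<tau> \<subseteq> {1..n} \<and> card \<tau> = Suc d} - F. G.\<Psi> \<tau> * of_int (Poly_Mapping.lookup (bd \<tau>) \<rho>) = 0"
      proof
        fix \<tau> assume \<tau>: "\<tau> \<in> {\<tau>. \<tau> \<subseteq> {1..n} \<and> card \<tau> = Suc d} - F"
        then have \<tau>': "finite \<tau>" "card \<tau> = Suc d" "0 \<notin> \<tau>" by (auto intro: finite_subset)
        have "G.\<Psi> \<tau> = 0"
        proof (rule ccontr)
          assume nz: "G.\<Psi> \<tau> \<noteq> 0"
          have "\<tau> \<in> \<Delta>"
          proof (rule gale_below[OF l0_less _ \<tau>'])
            show "l0 ` {1..Suc d} \<in> \<Delta>" using \<sigma>\<Delta> l0_img by simp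
          qed (use G.\<Psi>_support[OF \<tau>'(1,2) nz] in auto)
          then show False using \<tau> by (simp add: mem_faces)
        qed
        then show "G.\<Psi> \<tau> * of_int (Poly_Mapping.lookup (bd \<tau>) \<rho>) = 0" by simp
      qed
    qed (use F_sub in auto)
    also have "\<dots> = (\<Sum>v\<in>{1..n} - \<rho>. pos_sign \<rho> v * G.\<Psi> (insert v \<rho>))"
      using sum_over_cofaces[of "{1..n}" \<rho> G.\<Psi>] True by simp
    also have "\<dots> = 0" using G.\<Psi>_cycle[OF fin\<rho>] True by simp
    finally show ?thesis .
  next
    case False
    have "Poly_Mapping.lookup (bd \<tau>) \<rho> = 0" if \<tau>: "\<tau> \<in> F" for \<tau>
    proof (rule ccontr)
      assume "Poly_Mapping.lookup (bd \<tau>) \<rho> \<noteq> 0"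
      then obtain v where v: "v \<in> \<tau>" "\<rho> = \<tau> - {v}" using lookup_bd_nonzeroD by blast
      then have "\<rho> \<subseteq> {1..n}" "card \<rho> = d" using F_D[OF \<tau>] F_sub \<tau> by auto
      with False show False by simp
    qed
    then show ?thesis by (intro sum.neutral) simp
  qed
  let ?D = "\<Prod>k\<le>d. G.D (l0 (Suc k))"
  define y where "y \<rho> = G.Y \<rho> / w \<rho>" for \<rho>
  have coboundary: "(if \<tau> = \<sigma> then ?D else 0) - G.\<Psi> \<tau>
      = w \<tau> * (\<Sum>\<rho>\<in>Pow {1..n}. of_int (Poly_Mapping.lookup (bd \<tau>) \<rho>) * y \<rho>)" if \<tau>: "\<tau> \<in> F" for \<tau>
  proof -
    have \<tau>n: "finite \<tau>" "card \<tau> = Suc d" "\<tau> \<subseteq> {1..n}" using F_D[OF \<tau>] F_sub \<tau> by auto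
    have "(if \<tau> = \<sigma> then ?D else 0) - G.\<Psi> \<tau> = (\<Sum>v\<in>\<tau>. pos_sign \<tau> v * (x v * G.Y (\<tau> - {v})))"
    proof (rule G.\<Psi>_coboundary[OF \<tau>n, unfolded top_face])
      assume above: "\<And>t. t \<in> \<tau> \<Longrightarrow> l0 (Suc (pos \<tau> t)) \<le> t"
      have "gale_le \<sigma> \<tau>"
      proof (rule gale_leI[OF \<tau>n(1)])
        show "finite \<sigma>" "card \<sigma> = card \<tau>"
          using G.finite_top_face G.card_top_face \<tau>n(2) by (simp_all add: top_face)
        fix s t assume s: "s \<in> \<sigma>" and t: "t \<in> \<tau>" and eq: "pos \<sigma> s = pos \<tau> t"
        obtain k where "k \<in> {1..Suc d}" "s = l0 k" using s unfolding l0_img[symmetric] by blast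
        then obtain j where k: "j \<le> d" "s = l0 (Suc j)" by (cases k) auto
        then have "pos \<sigma> s = j" using G.pos_top_face[of j] by (simp add: top_face)
        then show "s \<le> t" using above[OF t] k eq by simp
      qed
      then show "\<tau> = \<sigma>" using top F_facets[OF \<tau>] by blast
    qed
    also have "\<dots> = w \<tau> * (\<Sum>v\<in>\<tau>. pos_sign \<tau> v * y (\<tau> - {v}))"
      unfolding sum_distrib_left
    proof (rule sum.cong[OF refl])
      fix v assume v: "v \<in> \<tau>"
      have "w \<tau> = x v * w (\<tau> - {v})" unfolding w_prod using \<tau>n(1) v by (rule prod.remove)
      then show "pos_sign \<tau> v * (x v * G.Y (\<tau> - {v})) = w \<tau> * (pos_sign \<tau> v * y (\<tau> - {v}))"
        using w_nz[of "\<tau> - {v}"] by (simp add: y_def)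
    qed
    also have "(\<Sum>v\<in>\<tau>. pos_sign \<tau> v * y (\<tau> - {v}))
        = (\<Sum>\<rho>\<in>Pow {1..n}. of_int (Poly_Mapping.lookup (bd \<tau>) \<rho>) * y \<rho>)"
      using \<tau>n by (intro sum_over_facets[symmetric]) auto
    finally show ?thesis .
  qed
  from basis_weight_sum_avoiding[OF \<sigma>F w_nz cycle coboundary]
  have main: "G.\<Psi> \<sigma> * (\<Sum>B\<in>lattice_bases bd F. basis_weight w B)
      = ?D * (\<Sum>B\<in>{B \<in> lattice_bases bd F. \<sigma> \<notin> B}. basis_weight w B)" .

  have weight_eq: "to_fract ((\<Prod>\<tau>\<in>B. face_weight \<tau>) * of_nat (basis_index B) ^ 2) = basis_weight w B" for B
    by (simp add: basis_weight_def to_fract_prod w_def to_fract_power to_fract_of_nat)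
  have all: "to_fract (weighted_tree_number (int d) \<Delta>) = (\<Sum>B\<in>lattice_bases bd F. basis_weight w B)"
    unfolding tree_number_eq to_fract_sum weight_eq ..

  have cone_F: "cone_faces \<subseteq> F - {\<sigma>}" using one_\<sigma> by auto
  have bd_\<sigma>: "bd \<sigma> \<in> int_span bd (F - {\<sigma>})"
    using bd_in_cone_span[OF \<sigma>F] int_span_mono[OF _ cone_F] finite_F by blast
  have dim': "complex_dim (\<Delta> - {\<sigma>}) = int d"
    unfolding complex_dim_def
  proof (rule Max_eqI)
    show "finite (face_dim ` (\<Delta> - {\<sigma>}))" using fin by simp
    show "y \<le> int d" if "y \<in> face_dim ` (\<Delta> - {\<sigma>})" for y using that face_dim_le by auto
    obtain \<tau> where "\<tau> \<in> cone_faces" using lattice_basis_nonempty[OF cone_lattice_basis] by blast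
    then show "int d \<in> face_dim ` (\<Delta> - {\<sigma>})"
      using one_\<sigma> by (intro image_eqI[of _ _ \<tau>]) (auto simp: faces_def)
  qed
  have cx': "simplicial_complex (\<Delta> - {\<sigma>})"
    unfolding simplicial_complex_def
  proof (intro conjI ballI allI impI)
    show "{} \<in> \<Delta> - {\<sigma>}" using cx F_D(3)[OF \<sigma>F] by (auto simp: simplicial_complex_def)
    fix \<tau> assume \<tau>: "\<tau> \<in> \<Delta> - {\<sigma>}"
    then show "finite \<tau>" using simplicial_complexD[OF cx] by blast
    fix \<rho> assume "\<rho> \<subseteq> \<tau>"
    then show "\<rho> \<in> \<Delta> - {\<sigma>}" using \<tau> facet simplicial_complexD(2)[OF cx] by (auto simp: facets_def)
  qed
  interpret D': finite_complex "\<Delta> - {\<sigma>}" d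
    by unfold_locales (use cx' dim' fin in auto)
  have F': "faces (int d) (\<Delta> - {\<sigma>}) = F - {\<sigma>}" by (auto simp: faces_def)
  have "faces (int d - 1) (\<Delta> - {\<sigma>}) = faces (int d - 1) \<Delta>"
    using F_D(3)[OF \<sigma>F] by (auto simp: faces_def face_dim_def)
  then have X': "simplicial_cycles (int d - 1) (\<Delta> - {\<sigma>}) = X" by (simp add: simplicial_cycles_eq)
  have bases': "lattice_bases bd (F - {\<sigma>}) = {B \<in> lattice_bases bd F. \<sigma> \<notin> B}"
    by (rule lattice_bases_remove[OF \<sigma>F bd_\<sigma>])
  have index': "D'.basis_index B = basis_index B" for B
    unfolding D'.basis_index_def basis_index_def X' ..
  have del: "weighted_tree_number (int d) (\<Delta> - {\<sigma>})
      = (\<Sum>B\<in>{B \<in> lattice_bases bd F. \<sigma> \<notin> B}. (\<Prod>\<tau>\<in>B. face_weight \<tau>) * of_nat (basis_index B) ^ 2)"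
    unfolding D'.tree_number_eq F' bases' index' ..
  have del': "to_fract (weighted_tree_number (int d) (\<Delta> - {\<sigma>}))
      = (\<Sum>B\<in>{B \<in> lattice_bases bd F. \<sigma> \<notin> B}. basis_weight w B)"
    unfolding del to_fract_sum weight_eq ..

  have Gw: "G.D q = to_fract (weight_sum q)" for q
    by (simp add: G.D_def weight_sum_def x_def)
  have reindex: "(\<Prod>k\<le>d. f (l0 (Suc k))) = (\<Prod>q=1..d + 1. f (l q))" for f :: "nat \<Rightarrow> weight_poly fract"
  proof -
    have "(\<Prod>q=1..d + 1. f (l q)) = (\<Prod>q\<in>Suc ` {..d}. f (l q))" by (simp only: image_Suc_atMost Suc_eq_plus1)
    also have "\<dots> = (\<Prod>k\<le>d. f (l0 (Suc k)))" by (simp add: prod.reindex l0_def)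
    finally show ?thesis ..
  qed
  have "G.\<Psi> \<sigma> = (\<Prod>q=1..d + 1. to_fract (weight_sum (l q - 1)))"
    unfolding top_face[symmetric] G.\<Psi>_top_face Gw by (rule reindex[of "\<lambda>v. to_fract (weight_sum (v - 1))"])
  moreover have "?D = (\<Prod>q=1..d + 1. to_fract (weight_sum (l q)))"
    unfolding Gw by (rule reindex[of "\<lambda>v. to_fract (weight_sum v)"])
  ultimately show "to_fract (weighted_tree_number (int d) \<Delta>) * (\<Prod>q=1..d + 1. to_fract (weight_sum (l q - 1)))
       = to_fract (weighted_tree_number (int d) (\<Delta> - {\<sigma>})) * (\<Prod>q=1..d + 1. to_fract (weight_sum (l q)))"
    using main unfolding all del' by (simp only: mult.commute)

  show "weighted_tree_number (int d) (\<Delta> - {\<sigma>}) \<noteq> 0"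
  proof -
    have "(\<Sum>B\<in>{B \<in> lattice_bases bd F. \<sigma> \<notin> B}. (\<Prod>\<tau>\<in>B. face_weight \<tau>) * of_nat (basis_index B ^ 2)) \<noteq> 0"
    proof (rule sum_monomials_nonzero)
      show "cone_faces \<in> {B \<in> lattice_bases bd F. \<sigma> \<notin> B}" using cone_lattice_basis one_\<sigma> by simp
      show "0 < basis_index cone_faces ^ 2" unfolding cone_index by simp
    qed (use finite_lattice_bases in \<open>auto intro: monomials_prod monomials_face_weight\<close>)
    then show ?thesis unfolding del by simp
  qed
qed

lemma weight_sum_nonzero: "q \<ge> 1 \<Longrightarrow> weight_sum q \<noteq> 0"
  using sum_monomials_nonzero[of "{1..q}" 1 "\<lambda>_. 1" vertex_weight]
  by (auto simp: weight_sum_def monomials_def vertex_weight_def)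

theorem theorem6p2:
  fixes n d :: nat and \<Delta> :: "nat set set" and \<sigma> :: "nat set" and l :: "nat \<Rightarrow> nat"
  assumes "simplicial_complex \<Delta>"
    and "\<Delta> \<subseteq> Pow {1..n}"
    and "complex_dim \<Delta> = int d"
    and "pure_complex \<Delta>"
    and "shifted \<Delta>"
    and "strict_mono_on {1..d + 1} l"
    and "\<sigma> = l ` {1..d + 1}"
    and "\<sigma> \<in> facets \<Delta>"
    and "\<And>\<tau>. \<tau> \<in> facets \<Delta> \<Longrightarrow> gale_le \<sigma> \<tau> \<Longrightarrow> \<tau> = \<sigma>"
    and "l 1 \<ge> 2"
  shows "to_fract (weighted_tree_number (int d) \<Delta>)
           / to_fract (weighted_tree_number (int d) (\<Delta> - {\<sigma>}))
         = (\<Prod>q=1..d + 1. to_fract (weight_sum (l q)) / to_fract (weight_sum (l q - 1)))"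
proof -
  have "l q \<ge> 2" if "q \<in> {1..d + 1}" for q
  proof (cases "q = 1")
    case False
    then have "l 1 < l q" using assms(6) that by (auto simp: strict_mono_on_def)
    then show ?thesis using assms(10) by simp
  qed (use assms(10) in simp)
  then have "weight_sum (l q - 1) \<noteq> 0" if "q \<in> {1..d + 1}" for q
    using that by (intro weight_sum_nonzero) fastforce
  then have "(\<Prod>q=1..d + 1. to_fract (weight_sum (l q - 1))) \<noteq> 0" by (simp add: prod_zero_iff)
  then show ?thesis
    using weighted_tree_number_shifted[OF assms(1-3,5-10)]
    by (simp add: prod_dividef frac_eq_eq mult.commute)
qed

end
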